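(* For each irrational number $\theta\in(0,1)$, the Effros–Shen algebra $A_\theta$ contains a Cartan subalgebra that is not conjugate to the standard diagonal subalgebra $D_\theta$.
   Context: Effros–Shen algebra. For irrational $\theta$ with simple continued fraction expansion $[g_0,g_1,\ldots]$, let $q_0=1$, $q_1=g_1$, $q_n=g_nq_{n-1}+q_{n-2}$ for $n\ge2$. Let $A_0=M_{q_0}=\mathbb C$ and $A_n=M_{q_n}\oplus M_{q_{n-1}}$ for $n\ge1$, with (unital) inclusions $A_{n-1}\hookrightarrow A_n$ having partial multiplicities $\begin{pmatrix}g_n&1\\1&0\end{pmatrix}$ (with $A_0$ viewed as $\mathbb C\oplus0$). $A_\theta=\overline{\bigcup_nA_n}$ is the resulting AF algebra. The standard diagonal subalgebra (in the sense of Strătilă–Voiculescu) is $D_\theta=\overline{\bigcup_n D_n}$, where $D_n\subseteq A_n$ is the algebra of diagonal matrices with respect to systems of matrix units for the $A_n$ chosen compatibly with the inclusions (each matrix unit of $A_{n-1}$ is a sum of matrix units of $A_n$). A Cartan subalgebra (in the sense of Renault) of a $C^*$-algebra $A$ is a maximal abelian $C^*$-subalgebra $B$ that contains an approximate unit of $A$, is regular (the normalizers $\{n\in A: nBn^*\subseteq B,\ n^*Bn\subseteq B\}$ generate $A$), and is the range of a faithful conditional expectation $A\to B$. Two Cartan subalgebras of $A$ are conjugate if some automorphism of $A$ carries one onto the other. *)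

theory Defs
  imports "HOL-Analysis.Analysis"
begin

section \<open>C*-algebras\<close>

text \<open>
  C*-algebras over the complex numbers, not assumed unital. The real Banach algebra structure
  comes from the library; complex scalars are added on top of it.
\<close>

class cstar_algebra = banach + real_normed_algebra +
  fixes scaleC :: "complex \<Rightarrow> 'a \<Rightarrow> 'a" (infixr \<open>*\<^sub>C\<close> 75)
    and star :: "'a \<Rightarrow> 'a"
  assumes scaleC_add_right: "c *\<^sub>C (x + y) = c *\<^sub>C x + c *\<^sub>C y"
    and scaleC_add_left: "(c + d) *\<^sub>C x = c *\<^sub>C x + d *\<^sub>C x"
    and scaleC_scaleC: "c *\<^sub>C (d *\<^sub>C x) = (c * d) *\<^sub>C x"
    and scaleC_of_real: "complex_of_real r *\<^sub>C x = r *\<^sub>R x"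
    and norm_scaleC: "norm (c *\<^sub>C x) = cmod c * norm x"
    and mult_scaleC_left: "(c *\<^sub>C x) * y = c *\<^sub>C (x * y)"
    and mult_scaleC_right: "x * (c *\<^sub>C y) = c *\<^sub>C (x * y)"
    and star_star: "star (star x) = x"
    and star_add: "star (x + y) = star x + star y"
    and star_scaleC: "star (c *\<^sub>C x) = cnj c *\<^sub>C star x"
    and star_mult: "star (x * y) = star y * star x"
    and cstar_identity: "norm (star x * x) = (norm x)\<^sup>2"

instantiation complex :: cstar_algebra
begin
definition scaleC_complex :: "complex \<Rightarrow> complex \<Rightarrow> complex" where "scaleC_complex c x = c * x"
definition star_complex :: "complex \<Rightarrow> complex" where "star_complex = cnj"
instance
  by standard
    (auto simp: scaleC_complex_def star_complex_def algebra_simps norm_mult power2_eq_square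
      scaleR_conv_of_real)
end

global_interpretation complex_vector:
  vector_space "scaleC :: complex \<Rightarrow> 'a \<Rightarrow> 'a::cstar_algebra"
  defines csubspace = complex_vector.subspace
    and cspan = complex_vector.span
proof
  show "1 *\<^sub>C x = x" for x :: 'a
    using scaleC_of_real[of 1 x] by simp
qed (simp_all add: scaleC_add_right scaleC_add_left scaleC_scaleC)

text \<open>
  All algebras considered are C*-subalgebras, given by their carrier, of an ambient C*-algebra
  (which may be the algebra itself).
\<close>

definition cstar_subalgebra :: "'a::cstar_algebra set \<Rightarrow> bool" where
  "cstar_subalgebra B \<longleftrightarrow> csubspace B \<and> closed B \<and>
     (\<forall>x\<in>B. \<forall>y\<in>B. x * y \<in> B) \<and> (\<forall>x\<in>B. star x \<in> B)"

definition abelian :: "'a::cstar_algebra set \<Rightarrow> bool" where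
  "abelian B \<longleftrightarrow> (\<forall>x\<in>B. \<forall>y\<in>B. x * y = y * x)"

definition positive_in :: "'a::cstar_algebra set \<Rightarrow> 'a \<Rightarrow> bool" where
  "positive_in A x \<longleftrightarrow> (\<exists>y\<in>A. x = star y * y)"

definition star_automorphism :: "'a::cstar_algebra set \<Rightarrow> ('a \<Rightarrow> 'a) \<Rightarrow> bool" where
  "star_automorphism A \<alpha> \<longleftrightarrow> bij_betw \<alpha> A A \<and>
     (\<forall>x\<in>A. \<forall>y\<in>A. \<alpha> (x + y) = \<alpha> x + \<alpha> y) \<and>
     (\<forall>c. \<forall>x\<in>A. \<alpha> (c *\<^sub>C x) = c *\<^sub>C \<alpha> x) \<and>
     (\<forall>x\<in>A. \<forall>y\<in>A. \<alpha> (x * y) = \<alpha> x * \<alpha> y) \<and>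
     (\<forall>x\<in>A. \<alpha> (star x) = star (\<alpha> x))"


section \<open>Cartan subalgebras\<close>

definition maximal_abelian :: "'a::cstar_algebra set \<Rightarrow> 'a set \<Rightarrow> bool" where
  "maximal_abelian A B \<longleftrightarrow> cstar_subalgebra B \<and> B \<subseteq> A \<and> abelian B \<and>
     (\<forall>C. cstar_subalgebra C \<and> C \<subseteq> A \<and> abelian C \<and> B \<subseteq> C \<longrightarrow> C = B)"

text \<open>An approximate unit is a net; nets are rendered as proper filters.\<close>

definition contains_approximate_unit :: "'a::cstar_algebra set \<Rightarrow> 'a set \<Rightarrow> bool" where
  "contains_approximate_unit A B \<longleftrightarrow>
     (\<exists>F. F \<noteq> bot \<and> (\<forall>\<^sub>F u in F. u \<in> B \<and> positive_in B u \<and> norm u \<le> 1) \<and>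
       (\<forall>a\<in>A. ((\<lambda>u. u * a) \<longlongrightarrow> a) F \<and> ((\<lambda>u. a * u) \<longlongrightarrow> a) F))"

definition normalizers :: "'a::cstar_algebra set \<Rightarrow> 'a set \<Rightarrow> 'a set" where
  "normalizers A B = {n \<in> A. \<forall>b\<in>B. n * b * star n \<in> B \<and> star n * b * n \<in> B}"

definition regular_in :: "'a::cstar_algebra set \<Rightarrow> 'a set \<Rightarrow> bool" where
  "regular_in A B \<longleftrightarrow> cstar_subalgebra hull (normalizers A B) = A"

text \<open>
  Only abelian ranges \<open>B\<close> occur below, so positivity of \<open>E\<close> already entails complete positivity.
\<close>

definition conditional_expectation ::
    "'a::cstar_algebra set \<Rightarrow> 'a set \<Rightarrow> ('a \<Rightarrow> 'a) \<Rightarrow> bool" where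
  "conditional_expectation A B E \<longleftrightarrow> E ` A = B \<and> (\<forall>b\<in>B. E b = b) \<and>
     (\<forall>x\<in>A. \<forall>y\<in>A. E (x + y) = E x + E y) \<and>
     (\<forall>c. \<forall>x\<in>A. E (c *\<^sub>C x) = c *\<^sub>C E x) \<and>
     (\<forall>x\<in>A. norm (E x) \<le> norm x) \<and>
     (\<forall>x\<in>A. positive_in A x \<longrightarrow> positive_in B (E x)) \<and>
     (\<forall>x\<in>A. \<forall>b\<in>B. E (b * x) = b * E x \<and> E (x * b) = E x * b)"

definition faithful_on :: "'a::cstar_algebra set \<Rightarrow> ('a \<Rightarrow> 'a) \<Rightarrow> bool" where
  "faithful_on A E \<longleftrightarrow> (\<forall>x\<in>A. E (star x * x) = 0 \<longrightarrow> x = 0)"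

definition cartan_subalgebra :: "'a::cstar_algebra set \<Rightarrow> 'a set \<Rightarrow> bool" where
  "cartan_subalgebra A B \<longleftrightarrow> maximal_abelian A B \<and> contains_approximate_unit A B \<and>
     regular_in A B \<and> (\<exists>E. conditional_expectation A B E \<and> faithful_on A E)"

definition conjugate_in :: "'a::cstar_algebra set \<Rightarrow> 'a set \<Rightarrow> 'a set \<Rightarrow> bool" where
  "conjugate_in A B C \<longleftrightarrow> (\<exists>\<alpha>. star_automorphism A \<alpha> \<and> \<alpha> ` B = C)"


section \<open>Continued fractions\<close>

primrec cf_complete_quotient :: "real \<Rightarrow> nat \<Rightarrow> real" where
  "cf_complete_quotient \<theta> 0 = \<theta>"
| "cf_complete_quotient \<theta> (Suc n) = 1 / frac (cf_complete_quotient \<theta> n)"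

definition cf_coeff :: "real \<Rightarrow> nat \<Rightarrow> nat" where
  "cf_coeff \<theta> n = nat \<lfloor>cf_complete_quotient \<theta> n\<rfloor>"

fun cf_denom :: "real \<Rightarrow> nat \<Rightarrow> nat" where
  "cf_denom \<theta> 0 = 1"
| "cf_denom \<theta> (Suc 0) = cf_coeff \<theta> 1"
| "cf_denom \<theta> (Suc (Suc n)) = cf_coeff \<theta> (Suc (Suc n)) * cf_denom \<theta> (Suc n) + cf_denom \<theta> n"


section \<open>Effros--Shen algebras\<close>

text \<open>
  The two summands of \<open>A\<^sub>n\<close> are numbered 0 and 1. The algebra \<open>A\<^sub>0\<close> is viewed as
  \<open>\<complex> \<oplus> 0\<close>, so its summand 1 has matrix size 0.
\<close>

definition es_size :: "real \<Rightarrow> nat \<Rightarrow> nat \<Rightarrow> nat" where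
  "es_size \<theta> n k =
     (if k = 0 then cf_denom \<theta> n else if n = 0 then 0 else cf_denom \<theta> (n - 1))"

text \<open>
  \<open>es_mult \<theta> n k l\<close> is the multiplicity of summand \<open>l\<close> of \<open>A\<^sub>n\<^sub>-\<^sub>1\<close> in summand \<open>k\<close> of \<open>A\<^sub>n\<close>,
  for \<open>n > 0\<close>.
\<close>

definition es_mult :: "real \<Rightarrow> nat \<Rightarrow> nat \<Rightarrow> nat \<Rightarrow> nat" where
  "es_mult \<theta> n k l =
     (if k = 0 \<and> l = 0 then cf_coeff \<theta> n else if k = 1 \<and> l = 1 then 0 else 1)"

text \<open>
  \<open>(l, s, a) \<in> es_blocks \<theta> n k\<close> stands for row \<open>a\<close> of the \<open>s\<close>-th copy of summand \<open>l\<close> of \<open>A\<^sub>n\<close>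
  inside summand \<open>k\<close> of the next algebra.
\<close>

definition es_blocks :: "real \<Rightarrow> nat \<Rightarrow> nat \<Rightarrow> (nat \<times> nat \<times> nat) set" where
  "es_blocks \<theta> n k =
     {(l, s, a). l < 2 \<and> s < es_mult \<theta> (Suc n) k l \<and> a < es_size \<theta> n l}"

lemma card_es_blocks:
  assumes "k < 2"
  shows "card (es_blocks \<theta> n k) = es_size \<theta> (Suc n) k"
proof -
  have "es_blocks \<theta> n k =
      Sigma {..<2} (\<lambda>l. {..<es_mult \<theta> (Suc n) k l} \<times> {..<es_size \<theta> n l})"
    by (auto simp: es_blocks_def)
  then have "card (es_blocks \<theta> n k) = (\<Sum>l<2. es_mult \<theta> (Suc n) k l * es_size \<theta> n l)"
    by (simp add: card_cartesian_product)
  also have "\<dots> = es_size \<theta> (Suc n) k"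
    using assms by (cases n) (auto simp: es_mult_def es_size_def numeral_2_eq_2 less_Suc_eq)
  finally show ?thesis .
qed

text \<open>
  A compatible system of matrix units for the sequence of the \<open>A\<^sub>n\<close>, realized in an ambient
  C*-algebra: \<open>e n k a b\<close> is the matrix unit in position \<open>(a, b)\<close> of summand \<open>k\<close> of \<open>A\<^sub>n\<close>.
  In the last condition \<open>\<phi>\<close> tells which basis vector of the next level each row of each copy
  corresponds to. That \<open>\<phi> k\<close> is onto expresses that the inclusions are unital; the unit of every
  \<open>A\<^sub>n\<close> is the projection \<open>e 0 0 0 0\<close>, which need not be a unit of the ambient algebra.
\<close>

definition es_matrix_units ::
    "real \<Rightarrow> (nat \<Rightarrow> nat \<Rightarrow> nat \<Rightarrow> nat \<Rightarrow> 'a::cstar_algebra) \<Rightarrow> bool" where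
  "es_matrix_units \<theta> e \<longleftrightarrow>
     (\<forall>n. \<forall>k<2. \<forall>l<2. \<forall>a<es_size \<theta> n k. \<forall>b<es_size \<theta> n k. \<forall>c<es_size \<theta> n l. \<forall>d<es_size \<theta> n l.
        e n k a b * e n l c d = (if k = l \<and> b = c then e n k a d else 0)) \<and>
     (\<forall>n. \<forall>k<2. \<forall>a<es_size \<theta> n k. \<forall>b<es_size \<theta> n k.
        star (e n k a b) = e n k b a \<and> e n k a b \<noteq> 0) \<and>
     (\<forall>n. \<exists>\<phi>. (\<forall>k<2. bij_betw (\<phi> k) (es_blocks \<theta> n k) {..<es_size \<theta> (Suc n) k}) \<and>
        (\<forall>l<2. \<forall>a<es_size \<theta> n l. \<forall>b<es_size \<theta> n l.
           e n l a b =
             (\<Sum>k<2. \<Sum>s<es_mult \<theta> (Suc n) k l. e (Suc n) k (\<phi> k (l, s, a)) (\<phi> k (l, s, b)))))"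

definition es_level ::
    "real \<Rightarrow> (nat \<Rightarrow> nat \<Rightarrow> nat \<Rightarrow> nat \<Rightarrow> 'a::cstar_algebra) \<Rightarrow> nat \<Rightarrow> 'a set" where
  "es_level \<theta> e n = cspan {e n k a b | k a b. k < 2 \<and> a < es_size \<theta> n k \<and> b < es_size \<theta> n k}"

definition es_diag_level ::
    "real \<Rightarrow> (nat \<Rightarrow> nat \<Rightarrow> nat \<Rightarrow> nat \<Rightarrow> 'a::cstar_algebra) \<Rightarrow> nat \<Rightarrow> 'a set" where
  "es_diag_level \<theta> e n = cspan {e n k a a | k a. k < 2 \<and> a < es_size \<theta> n k}"

definition effros_shen_algebra ::
    "real \<Rightarrow> (nat \<Rightarrow> nat \<Rightarrow> nat \<Rightarrow> nat \<Rightarrow> 'a::cstar_algebra) \<Rightarrow> 'a set" where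
  "effros_shen_algebra \<theta> e = closure (\<Union>n. es_level \<theta> e n)"

definition standard_diagonal ::
    "real \<Rightarrow> (nat \<Rightarrow> nat \<Rightarrow> nat \<Rightarrow> nat \<Rightarrow> 'a::cstar_algebra) \<Rightarrow> 'a set" where
  "standard_diagonal \<theta> e = closure (\<Union>n. es_diag_level \<theta> e n)"

end

theory Submission
  imports Defs
begin

text \<open>
  The Cartan subalgebra is an increasing union of finite-dimensional commutative algebras
  \<open>B\<^sub>j\<close>, where \<open>B\<^sub>j\<close> is a subalgebra, but not a maximal abelian one, of a finite-dimensional
  \<open>F\<^sub>j = (M\<^sub>2 \<otimes> M\<^sub>h) \<oplus> M\<^sub>y\<close>, and the \<open>F\<^sub>j\<close> increase to the whole algebra: \<open>B\<^sub>j\<close> consists of the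
  scalars in \<open>M\<^sub>2\<close> tensored with the diagonal of \<open>M\<^sub>h\<close>, and of the diagonal of \<open>M\<^sub>y\<close>. If the matrix
  of partial multiplicities of \<open>F\<^sub>j\<close> in \<open>F\<^sub>j\<^sub>+\<^sub>1\<close> is the identity modulo 2, then such a decomposition
  propagates: pairs of copies of the second summand in the first one form new factors \<open>M\<^sub>2\<close>, and a
  pair of copies of the first summand in the second one turns \<open>M\<^sub>2\<close> into \<open>M\<^sub>2 \<otimes> 1 \<subseteq> M\<^sub>2 \<otimes> M\<^sub>2\<close>, where the
  Bell basis is taken as the new diagonal. The Pauli matrices permute this basis up to signs, and
  nontrivially, so they normalize \<open>B\<close> and are killed by the conditional expectation. On the other
  hand, along a path that stays in the first summand a character of \<open>B\<close> keeps all the states of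
  \<open>M\<^sub>2\<close> as extensions, while the characters of the standard diagonal extend uniquely.

  The parity condition is met along a subsequence: between \<open>A\<^sub>n\<close> and \<open>A\<^sub>n\<^sub>+\<^sub>1\<close> one inserts the algebra
  with summands of sizes \<open>q\<^sub>n + q\<^sub>n\<^sub>-\<^sub>1\<close> and \<open>q\<^sub>n\<close>. Then the first summand has even size infinitely
  often, and by the pigeonhole principle infinitely many of these levels agree modulo 2.
\<close>

section \<open>Orthogonal families\<close>

text \<open>The two off-diagonal multiplicities must be even for different reasons. An unpaired copy
  of \<open>M\<^sub>2\<close> in the second summand would have an orthonormal basis of
  \<open>\<complex>\<^sup>2\<close> as its diagonal, and since no vector state of
  \<open>\<complex>\<^sup>2\<close> is the trace, the expectations of successive stages would
  disagree; a Bell vector does induce the trace. An unpaired copy of the second summand in the first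
  could not join a factor \<open>M\<^sub>2\<close>. The diagonal multiplicities may have any parity.
  Recurrence of the parities of the sizes alone controls one row of a multiplicity matrix modulo 2;
  a second vector moved by the same matrices controls the other. Inclusions are encoded by columns,
  that is, partial isometries starting at a minimal projection. Composition is then multiplication
  of columns, multiplicities are cardinalities, and the Bell basis is a unitary change inside a span
  of columns, which alters the diagonal but not the algebra. Faithfulness of the expectation is
  reduced to one column at a time, where the expectation of \<open>c * star c\<close> has norm at
  least 1/2.\<close>

lemmas scaleC_mult = mult_scaleC_left mult_scaleC_right

lemma star_zero [simp]: "star (0::'a::cstar_algebra) = 0"
  using star_add[of "0::'a" 0] by simp

lemma star_minus: "star (- x) = - star (x::'a::cstar_algebra)"
  using star_add[of x "- x"] by (simp add: add_eq_0_iff)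

lemma star_diff: "star (x - y) = star x - star (y::'a::cstar_algebra)"
  using star_add[of x "- y"] by (simp add: star_minus)

lemma star_sum: "star (sum f A) = (\<Sum>x\<in>A. star (f x :: 'a::cstar_algebra))"
  by (induction A rule: infinite_finite_induct) (auto simp: star_add)

lemma star_scaleR: "star (a *\<^sub>R x) = a *\<^sub>R star (x::'a::cstar_algebra)"
  using star_scaleC[of "complex_of_real a" x] by (simp add: scaleC_of_real)

lemmas star_simps = star_add star_diff star_minus star_sum star_scaleR star_scaleC star_mult star_star

lemma norm_star [simp]: "norm (star x) = norm (x::'a::cstar_algebra)"
proof -
  have le: "norm y \<le> norm (star y)" for y :: 'a
  proof (cases "y = 0")
    case False
    have "(norm y)^2 \<le> norm (star y) * norm y"
      using cstar_identity[of y] norm_mult_ineq[of "star y" y] by simp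
    then show ?thesis using False by (simp add: power2_eq_square)
  qed simp
  from le[of x] le[of "star x"] show ?thesis by (simp add: star_star)
qed

lemma star_mult_self_eq_0 [simp]: "star x * x = 0 \<longleftrightarrow> x = (0::'a::cstar_algebra)"
  using cstar_identity[of x] by auto

lemma bounded_linear_star: "bounded_linear (star :: 'a::cstar_algebra \<Rightarrow> 'a)"
  by (rule bounded_linear_intro[of _ 1]) (auto simp: star_simps)

lemmas tendsto_star = bounded_linear.tendsto[OF bounded_linear_star]

lemma bounded_linear_scaleC: "bounded_linear (\<lambda>x::'a::cstar_algebra. a *\<^sub>C x)"
proof (rule bounded_linear_intro[of _ "cmod a"])
  show "a *\<^sub>C (r *\<^sub>R x) = r *\<^sub>R (a *\<^sub>C x)" for r and x :: 'a
    by (simp add: scaleC_of_real[symmetric] scaleC_scaleC mult.commute)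
qed (auto simp: scaleC_add_right norm_scaleC)

lemmas tendsto_scaleC = bounded_linear.tendsto[OF bounded_linear_scaleC]

lemma cspan_scaleR: "x \<in> cspan S \<Longrightarrow> a *\<^sub>R x \<in> cspan S"
  using complex_vector.span_scale[of x S "complex_of_real a"] by (simp add: scaleC_of_real)

lemma csubspace_scaleR: "csubspace S \<Longrightarrow> x \<in> S \<Longrightarrow> a *\<^sub>R x \<in> S"
  using complex_vector.subspace_scale[of S x "complex_of_real a"] by (simp add: scaleC_of_real)

lemma cspan_scaleC_left:
  assumes "x \<in> cspan S" "\<And>x. x \<in> S \<Longrightarrow> f x \<in> cspan T"
    and "\<And>x y. f (x + y) = f x + f y" "\<And>a x. f (a *\<^sub>C x) = a *\<^sub>C f x"
  shows "f x \<in> cspan T"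
  using assms(1)
proof (induction rule: complex_vector.span_induct_alt)
  case base
  have "f 0 = 0" using assms(3)[of 0 0] by simp
  then show ?case by (simp add: complex_vector.span_zero)
next
  case (step c x y)
  then show ?case using assms(2)[of x] by (simp add: assms(3,4) complex_vector.span_add complex_vector.span_scale)
qed

lemma cspan_star_mult:
  assumes "v \<in> cspan S" "w \<in> cspan S'"
  shows "v * star w \<in> cspan {x * star z | x z. x \<in> S \<and> z \<in> (S' :: 'a::cstar_algebra set)}" (is "_ \<in> cspan ?G")
  using assms(1)
proof (rule cspan_scaleC_left[of v S "\<lambda>v. v * star w"])
  fix x assume x: "x \<in> S"
  show "x * star w \<in> cspan ?G" using assms(2)
  proof (induction rule: complex_vector.span_induct_alt)
    case base then show ?case by (simp add: complex_vector.span_zero)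
  next
    case (step c z y)
    have "x * star z \<in> cspan ?G" using x step(1) by (auto intro!: complex_vector.span_base)
    then show ?case using step.IH by (simp add: star_simps ring_distribs scaleC_mult complex_vector.span_add complex_vector.span_scale)
  qed
qed (simp_all add: ring_distribs scaleC_mult)

text \<open>If \<open>x > K > 0\<close>, the powers of \<open>x / K\<close> are unbounded by
  Bernoulli's inequality. Hence a constant such as the number of summands disappears under repeated
  squaring.\<close>

lemma le_if_power_le:
  fixes x K C :: real
  assumes "\<And>k. x ^ (2 ^ Suc k) \<le> C * K ^ (2 ^ Suc k)" "0 \<le> K" "0 \<le> x"
  shows "x \<le> K"
proof (rule ccontr)
  assume "\<not> x \<le> K"
  then have xK: "K < x" by simp
  show False
  proof (cases "K = 0")
    case True
    then show ?thesis using assms(1)[of 0] xK by simp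
  next
    case False
    then have K: "K > 0" using assms by simp
    define d where "d = x / K - 1"
    have d: "d > 0" using xK K by (simp add: d_def)
    obtain n :: nat where n: "C < real n * d" using d reals_Archimedean3 by blast
    have "1 + real n * d \<le> (1 + d) ^ n" using d by (intro Bernoulli_inequality) simp
    also have "\<dots> \<le> (1 + d) ^ (2 ^ Suc n)"
      using d less_exp[of n] by (intro power_increasing) (auto intro: order.trans[of n "2 ^ n"])
    also have "\<dots> = x ^ (2 ^ Suc n) / K ^ (2 ^ Suc n)"
      by (simp add: d_def power_divide)
    also have "\<dots> \<le> C" using assms(1)[of n] K by (simp add: divide_simps)
    finally show False using n by simp
  qed
qed

text \<open>
  Repeated squaring of \<open>star a * a\<close> turns the trivial estimate by the sum of the norms into one
  by their maximum; \<open>norm_le_columns\<close> below uses the same argument in place of spectral theory.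
\<close>

lemma norm_sum_orthogonal:
  fixes y :: "'i \<Rightarrow> 'a::cstar_algebra"
  assumes "finite I" "0 \<le> K" "\<And>i. i \<in> I \<Longrightarrow> norm (y i) \<le> K"
    and orth: "\<And>i j. i \<in> I \<Longrightarrow> j \<in> I \<Longrightarrow> i \<noteq> j \<Longrightarrow> star (y i) * y j = 0 \<and> y i * star (y j) = 0"
  shows "norm (\<Sum>i\<in>I. y i) \<le> K"
proof -
  define a where "a = (\<Sum>i\<in>I. y i)"
  define g where "g k i = ((\<lambda>z. z * z) ^^ k) (star (y i) * y i)" for k i
  define h where "h k = (\<Sum>i\<in>I. g k i)" for k
  have gS: "g (Suc k) i = g k i * g k i" for k i by (simp add: g_def)
  have g0: "g k i * g k j = 0" if "i \<in> I" "j \<in> I" "i \<noteq> j" for k i j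
  proof (induction k)
    case 0
    have "g 0 i * g 0 j = star (y i) * (y i * star (y j)) * y j" by (simp add: g_def mult.assoc)
    then show ?case using orth that by simp
  next
    case (Suc k)
    have "g (Suc k) i * g (Suc k) j = g k i * (g k i * g k j) * g k j" by (simp add: gS mult.assoc)
    then show ?case using Suc by simp
  qed
  have gs: "star (g k i) = g k i" for k i
    by (induction k) (auto simp: gS star_simps, simp add: g_def star_simps)
  have hS: "h (Suc k) = h k * h k" for k
  proof -
    have "h k * h k = (\<Sum>i\<in>I. \<Sum>j\<in>I. g k i * g k j)" by (simp add: h_def sum_product)
    also have "\<dots> = (\<Sum>i\<in>I. \<Sum>j\<in>I. if j = i then g (Suc k) i else 0)"
      by (intro sum.cong refl) (auto simp: g0 gS)
    also have "\<dots> = h (Suc k)" by (simp add: h_def assms(1))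
    finally show ?thesis ..
  qed
  have hs: "star (h k) = h k" for k by (simp add: h_def star_simps gs)
  have h0: "h 0 = star a * a"
  proof -
    have "star a * a = (\<Sum>i\<in>I. \<Sum>j\<in>I. star (y i) * y j)" by (simp add: a_def star_sum sum_product)
    also have "\<dots> = (\<Sum>i\<in>I. \<Sum>j\<in>I. if j = i then g 0 i else 0)"
      by (intro sum.cong refl) (auto simp: orth g_def)
    also have "\<dots> = h 0" by (simp add: h_def assms(1))
    finally show ?thesis ..
  qed
  have nh: "norm (h k) = norm a ^ (2 ^ Suc k)" for k
  proof (induction k)
    case 0 show ?case by (simp add: h0 cstar_identity)
  next
    case (Suc k)
    have "norm (h (Suc k)) = (norm (h k))^2" using cstar_identity[of "h k"] by (simp add: hs hS)
    then show ?case using Suc by (simp add: power_mult[symmetric] mult.commute)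
  qed
  have ng: "norm (g k i) \<le> K ^ (2 ^ Suc k)" if "i \<in> I" for k i
  proof (induction k)
    case 0 show ?case using assms(2) assms(3)[OF that] by (simp add: g_def cstar_identity power_mono)
  next
    case (Suc k)
    have "norm (g (Suc k) i) = (norm (g k i))^2" using cstar_identity[of "g k i"] by (simp add: gs gS)
    also have "\<dots> \<le> (K ^ (2 ^ Suc k))^2" by (intro power_mono Suc) simp
    finally show ?case by (simp add: power_mult[symmetric] mult.commute)
  qed
  have "norm a ^ (2 ^ Suc k) \<le> real (card I) * K ^ (2 ^ Suc k)" for k
    unfolding nh[symmetric] h_def by (rule order.trans[OF norm_sum]) (rule sum_bounded_above[OF ng])
  then show ?thesis using le_if_power_le assms(2) unfolding a_def by (metis norm_ge_zero)
qed

definition projection :: "'a::cstar_algebra \<Rightarrow> bool" where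
  "projection p \<longleftrightarrow> star p = p \<and> p * p = p \<and> p \<noteq> 0"

lemma projectionD: assumes "projection p" shows "star p = p" "p * p = p" "p \<noteq> 0" "norm p = 1"
proof -
  show "star p = p" "p * p = p" "p \<noteq> 0" using assms by (auto simp: projection_def)
  then show "norm p = 1" using cstar_identity[of p] by (simp add: power2_eq_square)
qed

text \<open>By the C*-identity it is enough to expand \<open>star z * z\<close> for
  \<open>z = c - c * q\<close>, which is \<open>q - q - q + q\<close>.\<close>

lemma right_support:
  assumes "star c * c = q" "projection q" shows "c * q = c"
proof -
  have "star (c - c * q) * (c - c * q) = star c * c - star c * c * q - star q * (star c * c) + star q * (star c * c) * q"
    by (simp add: star_simps algebra_simps)
  also have "\<dots> = 0" using assms projectionD[of q] by (simp add: mult.assoc)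
  finally show ?thesis by simp
qed

text \<open>An orthonormal basis in the sense of Hilbert spaces: on \<open>cspan S\<close> the
  product \<open>star v * w\<close> is an inner product with values in the multiples of
  \<open>q\<close>.\<close>

definition orthonormal :: "'a::cstar_algebra set \<Rightarrow> 'a \<Rightarrow> bool" where
  "orthonormal S q \<longleftrightarrow> finite S \<and> (\<forall>v\<in>S. \<forall>w\<in>S. star v * w = (if v = w then q else 0))"

lemma orthonormal_inner:
  assumes S: "orthonormal S q" and "x \<in> cspan S" "z \<in> cspan S"
  shows "\<exists>m. star x * z = m *\<^sub>C q"
proof -
  have 1: "\<exists>m. star v * z = m *\<^sub>C q" if "v \<in> S" for v
    using assms(3)
  proof (induction rule: complex_vector.span_induct_alt)
    case base show ?case by (auto intro!: exI[of _ 0])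
  next
    case (step c w y)
    then obtain m where m: "star v * y = m *\<^sub>C q" by auto
    have "star v * (c *\<^sub>C w + y) = (c * (if v = w then 1 else 0) + m) *\<^sub>C q"
      using S that step(1) m by (auto simp: orthonormal_def ring_distribs scaleC_mult scaleC_add_left)
    then show ?case by blast
  qed
  show ?thesis using assms(2)
  proof (induction rule: complex_vector.span_induct_alt)
    case base show ?case by (auto intro!: exI[of _ 0])
  next
    case (step c v y)
    then obtain m n where m: "star y * z = m *\<^sub>C q" "star v * z = n *\<^sub>C q" using 1 by metis
    have "star (c *\<^sub>C v + y) * z = (cnj c * n + m) *\<^sub>C q"
      using m by (simp add: star_simps ring_distribs scaleC_mult scaleC_add_left scaleC_scaleC)
    then show ?case by blast
  qed
qed

lemma orthonormal_square:
  assumes S: "orthonormal S q" and x: "x \<in> cspan S"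
  shows "\<exists>m\<ge>0. star x * x = complex_of_real m *\<^sub>C q"
proof -
  have fin: "finite S" using S by (simp add: orthonormal_def)
  obtain u where u: "x = (\<Sum>v\<in>S. u v *\<^sub>C v)"
    using x complex_vector.span_finite[OF fin] by auto
  have "star x * x = (\<Sum>v\<in>S. \<Sum>w\<in>S. (cnj (u v) * u w) *\<^sub>C (star v * w))"
    by (simp add: u star_simps sum_product scaleC_mult scaleC_scaleC mult.commute)
  also have "\<dots> = (\<Sum>v\<in>S. \<Sum>w\<in>S. if w = v then (cnj (u v) * u v) *\<^sub>C q else 0)"
    using S by (intro sum.cong refl) (auto simp: orthonormal_def)
  also have "\<dots> = (\<Sum>v\<in>S. complex_of_real ((cmod (u v))^2) *\<^sub>C q)"
    using fin by (simp only: sum.delta complex_norm_square) (simp add: mult.commute)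
  also have "\<dots> = complex_of_real (\<Sum>v\<in>S. (cmod (u v))^2) *\<^sub>C q"
    by (simp add: complex_vector.scale_sum_left)
  finally show ?thesis by (intro exI[of _ "\<Sum>v\<in>S. (cmod (u v))^2"]) (auto intro: sum_nonneg)
qed

section \<open>Stages\<close>

text \<open>
  A function \<open>c :: bool \<Rightarrow> 'a\<close> stands for a pair of columns, that is, for an isometric copy of
  \<open>\<complex>\<^sup>2\<close> tensored with a column of matrix units; \<open>pauli i s c c'\<close> is the Pauli matrix \<open>X\<^sup>i Z\<^sup>s\<close>
  tensored with the matrix unit that takes \<open>c'\<close> to \<open>c\<close>.
\<close>

definition block :: "(bool \<Rightarrow> 'a::cstar_algebra) \<Rightarrow> 'a" where
  "block c = (\<Sum>b\<in>UNIV. c b * star (c b))"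

definition pauli :: "bool \<Rightarrow> bool \<Rightarrow> (bool \<Rightarrow> 'a::cstar_algebra) \<Rightarrow> (bool \<Rightarrow> 'a) \<Rightarrow> 'a" where
  "pauli i s c c' = c i * star (c' False) + (if s then -1 else 1) *\<^sub>R (c (\<not> i) * star (c' True))"

text \<open>The Bell vector of \<open>\<complex>\<^sup>2 \<otimes> \<complex>\<^sup>2\<close>
  obtained from \<open>bell False False c u\<close> by applying \<open>X^i Z^s\<close> to the first
  tensor factor; \<open>c\<close> spans the first factor and \<open>u\<close> the second.\<close>

definition bell :: "bool \<Rightarrow> bool \<Rightarrow> (bool \<Rightarrow> 'a::cstar_algebra) \<Rightarrow> (bool \<Rightarrow> 'a) \<Rightarrow> 'a" where
  "bell i s c u = (1 / sqrt 2) *\<^sub>R (c i * u False + (if s then -1 else 1) *\<^sub>R (c (\<not> i) * u True))"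

text \<open>
  In \<open>(M\<^sub>2 \<otimes> M\<^sub>h) \<oplus> M\<^sub>y\<close>, fix minimal projections \<open>q\<close> and \<open>r\<close> of the two summands. Then \<open>H\<close> and \<open>Y\<close> are
  the partial isometries from \<open>q\<close> and \<open>r\<close> onto the minimal projections of the diagonal, those in the
  first summand being grouped into pairs. The algebra and its commutative subalgebra are \<open>alg\<close>
  and \<open>diag\<close> below.
\<close>

locale frame =
  fixes one :: "'a::cstar_algebra" and H :: "(bool \<Rightarrow> 'a) set" and Y :: "'a set" and q r :: 'a
  assumes finH: "finite H" and finY: "finite Y"
    and HH: "c \<in> H \<Longrightarrow> c' \<in> H \<Longrightarrow> star (c b) * c' b' = (if c = c' \<and> b = b' then q else 0)"
    and YY: "y \<in> Y \<Longrightarrow> y' \<in> Y \<Longrightarrow> star y * y' = (if y = y' then r else 0)"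
    and HY: "c \<in> H \<Longrightarrow> y \<in> Y \<Longrightarrow> star (c b) * y = 0"
    and total: "(\<Sum>c\<in>H. block c) + (\<Sum>y\<in>Y. y * star y) = one"
    and q: "projection q" and r: "projection r"
begin

lemma YH: "c \<in> H \<Longrightarrow> y \<in> Y \<Longrightarrow> star y * c b = 0"
  using arg_cong[OF HY, of c y star b] by (simp add: star_simps)

lemma cq: "c \<in> H \<Longrightarrow> c b * q = c b"
  by (rule right_support[OF _ q]) (simp add: HH)

lemma yr: "y \<in> Y \<Longrightarrow> y * r = y"
  by (rule right_support[OF _ r]) (simp add: YY)

lemma qc: "c \<in> H \<Longrightarrow> q * star (c b) = star (c b)"
  using arg_cong[OF cq, of c star b] by (simp add: star_simps projectionD[OF q])

lemma ry: "y \<in> Y \<Longrightarrow> r * star y = star y"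
  using arg_cong[OF yr, of y star] by (simp add: star_simps projectionD[OF r])

lemma HH2: "c \<in> H \<Longrightarrow> c' \<in> H \<Longrightarrow> star (c b) * (c' b' * z) = (if c = c' \<and> b = b' then q * z else 0)"
  by (simp add: mult.assoc[symmetric] HH)

lemma YY2: "y \<in> Y \<Longrightarrow> y' \<in> Y \<Longrightarrow> star y * (y' * z) = (if y = y' then r * z else 0)"
  by (simp add: mult.assoc[symmetric] YY)

lemma HY2: "c \<in> H \<Longrightarrow> y \<in> Y \<Longrightarrow> star (c b) * (y * z) = 0"
  by (simp add: mult.assoc[symmetric] HY)

lemma YH2: "c \<in> H \<Longrightarrow> y \<in> Y \<Longrightarrow> star y * (c b * z) = 0"
  by (simp add: mult.assoc[symmetric] YH)

lemma cq2: "c \<in> H \<Longrightarrow> c b * (q * z) = c b * z"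
  by (simp add: mult.assoc[symmetric] cq)

lemma yr2: "y \<in> Y \<Longrightarrow> y * (r * z) = y * z"
  by (simp add: mult.assoc[symmetric] yr)

lemma qc2: "c \<in> H \<Longrightarrow> q * (star (c b) * z) = star (c b) * z"
  by (simp add: mult.assoc[symmetric] qc)

lemma ry2: "y \<in> Y \<Longrightarrow> r * (star y * z) = star y * z"
  by (simp add: mult.assoc[symmetric] ry)

lemmas rules = mult.assoc HH YY HY YH cq yr qc ry HH2 YY2 HY2 YH2 cq2 yr2 qc2 ry2
  block_def UNIV_bool ring_distribs

lemma inj2: "c \<in> H \<Longrightarrow> c' \<in> H \<Longrightarrow> c b = c' b' \<Longrightarrow> c = c' \<and> b = b'"
  using HH[of c c' b b'] HH[of c c b b] projectionD(3)[OF q] by (auto split: if_splits)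

section \<open>Column spaces and the algebra of a stage\<close>

definition cols where "cols = (\<Union>c\<in>H. range c)"

lemma orthonormal_cols: "orthonormal cols q"
  unfolding orthonormal_def
proof (intro conjI ballI)
  show "finite cols" using finH by (auto simp: cols_def)
  fix v w assume "v \<in> cols" "w \<in> cols"
  then obtain c b c' b' where "c \<in> H" "c' \<in> H" "v = c b" "w = c' b'" by (auto simp: cols_def)
  then show "star v * w = (if v = w then q else 0)" using inj2[of c c' b b'] by (auto simp: HH)
qed

lemma orthonormal_Y: "orthonormal Y r"
  unfolding orthonormal_def using finY by (auto simp: YY)

lemma cols_Y: "x \<in> cspan cols \<Longrightarrow> y \<in> cspan Y \<Longrightarrow> star x * y = 0"
proof -
  assume x: "x \<in> cspan cols" and y: "y \<in> cspan Y"
  have 1: "star (c b) * y = 0" if "c \<in> H" for c b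
    using y by (induction rule: complex_vector.span_induct_alt) (use that in \<open>auto simp: rules scaleC_mult\<close>)
  show ?thesis
    using x by (induction rule: complex_vector.span_induct_alt) (auto simp: cols_def star_simps 1 ring_distribs scaleC_mult)
qed

lemma block_c: "c \<in> H \<Longrightarrow> c' \<in> H \<Longrightarrow> block c * c' b = (if c = c' then c' b else 0)"
  by (cases b) (auto simp: rules)

lemma block_y: "c \<in> H \<Longrightarrow> y \<in> Y \<Longrightarrow> block c * y = 0"
  by (auto simp: rules)

lemma star_block: "star (block c) = block c"
  by (simp add: block_def star_simps)

lemma one_c: "c \<in> H \<Longrightarrow> one * c b = c b"
  unfolding total[symmetric] using finH by (simp add: ring_distribs sum_distrib_right block_c rules(1) YH)

lemma one_y: "y \<in> Y \<Longrightarrow> one * y = y"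
  unfolding total[symmetric] using finY
  by (simp add: ring_distribs sum_distrib_right block_y rules(1) YY if_distrib[of "(*) _"] yr cong: if_cong)

lemma star_one: "star one = one"
  unfolding total[symmetric] by (simp add: star_simps star_block)

definition gens where "gens = {c b * star (c' b') | c b c' b'. c \<in> H \<and> c' \<in> H} \<union> {y * star y' | y y'. y \<in> Y \<and> y' \<in> Y}"

definition alg where "alg = cspan gens"

lemma algI: "x \<in> gens \<Longrightarrow> x \<in> alg" by (simp add: alg_def complex_vector.span_base)

lemma algH: "c \<in> H \<Longrightarrow> c' \<in> H \<Longrightarrow> c b * star (c' b') \<in> alg"
  by (intro algI) (unfold gens_def, blast)

lemma algY: "y \<in> Y \<Longrightarrow> y' \<in> Y \<Longrightarrow> y * star y' \<in> alg"
  by (intro algI) (unfold gens_def, blast)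

lemma csubspace_alg: "csubspace alg" by (simp add: alg_def complex_vector.subspace_span)

lemma alg_induct [consumes 1, case_names zero add H Y]:
  assumes "x \<in> alg" "P 0"
    and "\<And>a x y. x \<in> gens \<Longrightarrow> y \<in> alg \<Longrightarrow> P x \<Longrightarrow> P y \<Longrightarrow> P (a *\<^sub>C x + y)"
    and "\<And>c b c' b'. c \<in> H \<Longrightarrow> c' \<in> H \<Longrightarrow> P (c b * star (c' b'))"
    and "\<And>y y'. y \<in> Y \<Longrightarrow> y' \<in> Y \<Longrightarrow> P (y * star y')"
  shows "P x"
proof -
  have "x \<in> alg \<and> P x"
    using assms(1) unfolding alg_def
  proof (induction rule: complex_vector.span_induct_alt)
    case base then show ?case using assms(2) by (simp add: complex_vector.span_zero)
  next
    case (step c x y)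
    moreover have "P x" using step(1) assms(4,5) by (auto simp: gens_def)
    ultimately show ?case using assms(3)[of x y c] 
      by (auto simp: alg_def complex_vector.span_base complex_vector.span_add complex_vector.span_scale)
  qed
  then show ?thesis by simp
qed

lemma alg_star: "x \<in> alg \<Longrightarrow> star x \<in> alg"
proof (induction rule: alg_induct)
  case zero show ?case using complex_vector.subspace_0[OF csubspace_alg] by simp
next
  case (add a x y)
  then show ?case using csubspace_alg
    by (auto simp: star_simps complex_vector.subspace_add complex_vector.subspace_scale)
qed (simp_all add: star_simps algH algY)

lemma alg_cols: assumes "x \<in> alg" "v \<in> cspan cols" shows "x * v \<in> cspan cols"
  using assms(1)
proof (induction rule: alg_induct)
  case (add a x y)
  then show ?case by (simp add: ring_distribs scaleC_mult complex_vector.span_add complex_vector.span_scale)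
next
  case (H c b c' b')
  then have cb: "c b \<in> cspan cols" "c' b' \<in> cspan cols" by (auto simp: cols_def intro!: complex_vector.span_base)
  obtain m where "star (c' b') * v = m *\<^sub>C q" using orthonormal_inner[OF orthonormal_cols cb(2) assms(2)] by blast
  then show ?case using cb H by (simp add: mult.assoc scaleC_mult cq complex_vector.span_scale)
next
  case (Y y y')
  then have "star (star v * y') = 0" using cols_Y[OF assms(2), of y'] by (simp add: complex_vector.span_base)
  then show ?case by (simp add: star_simps mult.assoc complex_vector.span_zero)
qed (simp add: complex_vector.span_zero)

lemma alg_Y: assumes "x \<in> alg" "v \<in> cspan Y" shows "x * v \<in> cspan Y"
  using assms(1)
proof (induction rule: alg_induct)
  case (add a x y)
  then show ?case by (simp add: ring_distribs scaleC_mult complex_vector.span_add complex_vector.span_scale)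
next
  case (Y y y')
  then have cb: "y \<in> cspan Y" "y' \<in> cspan Y" by (auto intro!: complex_vector.span_base)
  obtain m where "star y' * v = m *\<^sub>C r" using orthonormal_inner[OF orthonormal_Y cb(2) assms(2)] by blast
  then show ?case using cb Y by (simp add: mult.assoc scaleC_mult yr complex_vector.span_scale)
next
  case (H c b c' b')
  then have "star (c' b') * v = 0" by (intro cols_Y assms) (auto simp: cols_def intro!: complex_vector.span_base)
  then show ?case by (simp add: mult.assoc complex_vector.span_zero)
qed (simp add: complex_vector.span_zero)

lemma cols_cols_alg: assumes "v \<in> cspan cols" "w \<in> cspan cols" shows "v * star w \<in> alg"
proof -
  have "{x * star z | x z. x \<in> cols \<and> z \<in> cols} \<subseteq> gens" unfolding cols_def gens_def by blast
  from complex_vector.span_mono[OF this] show ?thesis unfolding alg_def using cspan_star_mult[OF assms] by blast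
qed

lemma Y_Y_alg: assumes "v \<in> cspan Y" "w \<in> cspan Y" shows "v * star w \<in> alg"
proof -
  have "{x * star z | x z. x \<in> Y \<and> z \<in> Y} \<subseteq> gens" unfolding gens_def by blast
  from complex_vector.span_mono[OF this] show ?thesis unfolding alg_def using cspan_star_mult[OF assms] by blast
qed

lemma alg_mult: assumes "x \<in> alg" "z \<in> alg" shows "x * z \<in> alg"
  using assms(2)
proof (induction rule: alg_induct)
  case zero show ?case using complex_vector.subspace_0[OF csubspace_alg] by simp
next
  case (add a z y)
  then show ?case using csubspace_alg
    by (auto simp: ring_distribs scaleC_mult complex_vector.subspace_add complex_vector.subspace_scale)
next
  case (H c b c' b')
  then have cb: "c b \<in> cspan cols" "c' b' \<in> cspan cols" by (auto simp: cols_def intro!: complex_vector.span_base)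
  show ?case using cols_cols_alg[OF alg_cols[OF assms(1) cb(1)] cb(2)] by (simp add: mult.assoc)
next
  case (Y y y')
  then have cb: "y \<in> cspan Y" "y' \<in> cspan Y" by (auto intro!: complex_vector.span_base)
  show ?case using Y_Y_alg[OF alg_Y[OF assms(1) cb(1)] cb(2)] by (simp add: mult.assoc)
qed

lemma one_alg: "one \<in> alg"
  unfolding total[symmetric] block_def
  by (intro complex_vector.subspace_add[OF csubspace_alg] complex_vector.subspace_sum[OF csubspace_alg])
    (simp_all add: algH algY)

lemma one_left: "x \<in> alg \<Longrightarrow> one * x = x"
  by (induction rule: alg_induct) (auto simp: ring_distribs scaleC_mult mult.assoc[symmetric] one_c one_y)

lemma one_right: assumes "x \<in> alg" shows "x * one = x"
proof -
  have "star (one * star x) = star (star x)" using one_left[OF alg_star[OF assms]] by simp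
  then show ?thesis by (simp add: star_simps star_one)
qed

lemma alg_coeff: assumes "x \<in> alg" "c \<in> H" "c' \<in> H" shows "\<exists>m. star (c b) * x * c' b' = m *\<^sub>C q"
proof -
  have cb: "c b \<in> cspan cols" "c' b' \<in> cspan cols" using assms(2,3) by (auto simp: cols_def intro!: complex_vector.span_base)
  show ?thesis using orthonormal_inner[OF orthonormal_cols cb(1) alg_cols[OF assms(1) cb(2)]] by (simp add: mult.assoc)
qed

lemma alg_coeff_Y: assumes "x \<in> alg" "y \<in> Y" "y' \<in> Y" shows "\<exists>m. star y * x * y' = m *\<^sub>C r"
proof -
  have cb: "y \<in> cspan Y" "y' \<in> cspan Y" using assms(2,3) by (auto intro!: complex_vector.span_base)
  show ?thesis using orthonormal_inner[OF orthonormal_Y cb(1) alg_Y[OF assms(1) cb(2)]] by (simp add: mult.assoc)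
qed

text \<open>The algebra acts by left multiplication on its two column spaces, and the operator norm
  of this action bounds the norm. The C*-identity carries the bound over to \<open>star x\<close>,
  so it is multiplicative along the repeated squares of \<open>star x * x\<close>. Writing
  \<open>one\<close> as a sum over the columns costs a factor equal to their number, which
  \<open>le_if_power_le\<close> removes.\<close>

lemma norm_le_columns:
  assumes x: "x \<in> alg" and s: "0 \<le> s" and le: "\<And>v. v \<in> cspan cols \<union> cspan Y \<Longrightarrow> norm (x * v) \<le> s * norm v"
  shows "norm x \<le> s"
proof -
  define L where "L = cspan cols \<union> cspan Y"
  have Lx: "z * v \<in> L" if "z \<in> alg" "v \<in> L" for z v
    using alg_cols[OF that(1)] alg_Y[OF that(1)] that(2) by (auto simp: L_def)
  have sx: "norm (star x * v) \<le> s * norm v" if v: "v \<in> L" for v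
  proof -
    have "(norm (star x * v))^2 = norm (star v * (x * (star x * v)))"
      using cstar_identity[of "star x * v"] by (simp add: star_simps mult.assoc)
    also have "\<dots> \<le> norm v * norm (x * (star x * v))"
      using norm_mult_ineq[of "star v" "x * (star x * v)"] by simp
    also have "\<dots> \<le> norm v * (s * norm (star x * v))"
      using le[of "star x * v"] Lx[OF alg_star[OF x] v] by (intro mult_left_mono) (auto simp: L_def)
    finally have *: "norm (star x * v) * norm (star x * v) \<le> (s * norm v) * norm (star x * v)"
      by (simp add: power2_eq_square mult_ac)
    show ?thesis
    proof (cases "norm (star x * v) = 0")
      case False then show ?thesis using * by (simp add: mult_le_cancel_right)
    qed (use s in simp)
  qed
  define h where "h k = ((\<lambda>z. z * z) ^^ k) (star x * x)" for k
  have hS: "h (Suc k) = h k * h k" for k by (simp add: h_def)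
  have h0: "h 0 = star x * x" by (simp add: h_def)
  have ha: "h k \<in> alg" for k
    by (induction k) (auto simp: hS h0 alg_mult alg_star x)
  have hs: "star (h k) = h k" for k
    by (induction k) (auto simp: hS h0 star_simps)
  have nh: "norm (h k) = norm x ^ (2 ^ Suc k)" for k
  proof (induction k)
    case 0 show ?case by (simp add: h0 cstar_identity)
  next
    case (Suc k)
    have "norm (h (Suc k)) = (norm (h k))^2" using cstar_identity[of "h k"] by (simp add: hs hS)
    then show ?case using Suc by (simp add: power_mult[symmetric] mult.commute)
  qed
  have hv: "norm (h k * v) \<le> s ^ (2 ^ Suc k) * norm v" if "v \<in> L" for k v
    using that
  proof (induction k arbitrary: v)
    case 0
    have "norm (star x * (x * v)) \<le> s * (s * norm v)"
      using sx[OF Lx[OF x 0]] le[of v] 0 s unfolding L_def by (meson mult_left_mono order.trans)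
    then show ?case by (simp add: h0 mult.assoc power2_eq_square)
  next
    case (Suc k)
    have "norm (h k * (h k * v)) \<le> s ^ (2 ^ Suc k) * (s ^ (2 ^ Suc k) * norm v)"
      using Suc.IH[OF Lx[OF ha Suc.prems]] Suc.IH[OF Suc.prems] s by (meson mult_left_mono order.trans zero_le_power)
    also have "\<dots> = s ^ (2 ^ Suc (Suc k)) * norm v" by (simp add: power_add[symmetric])
    finally show ?case by (simp add: hS mult.assoc)
  qed
  define S where "S = cols \<union> Y"
  have nS: "norm v = 1" if "v \<in> S" for v
  proof -
    have "norm (star v * v) = 1" using that orthonormal_cols orthonormal_Y projectionD(4)[OF q] projectionD(4)[OF r]
      by (auto simp: S_def orthonormal_def)
    then show ?thesis using cstar_identity[of v] by (simp add: power2_eq_1_iff) (smt (verit) norm_ge_zero)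
  qed
  have SL: "v \<in> L" if "v \<in> S" for v using that by (auto simp: S_def L_def intro: complex_vector.span_base)
  have bound: "norm x ^ (2 ^ Suc k) \<le> (real (card H) * 2 + real (card Y)) * s ^ (2 ^ Suc k)" for k
  proof -
    have 1: "norm (h k * (v * star v)) \<le> s ^ (2 ^ Suc k)" if "v \<in> S" for v
      using norm_mult_ineq[of "h k * v" "star v"] hv[OF SL[OF that], of k] nS[OF that] by (simp add: mult.assoc)
    have "h k = h k * one" using ha one_right by simp
    also have "\<dots> = (\<Sum>c\<in>H. h k * block c) + (\<Sum>y\<in>Y. h k * (y * star y))"
      unfolding total[symmetric] by (simp add: ring_distribs sum_distrib_left)
    finally have eq: "h k = (\<Sum>c\<in>H. h k * block c) + (\<Sum>y\<in>Y. h k * (y * star y))" .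
    have "norm (h k) \<le> norm (\<Sum>c\<in>H. h k * block c) + norm (\<Sum>y\<in>Y. h k * (y * star y))"
      by (subst eq) (rule norm_triangle_ineq)
    also have "\<dots> \<le> (\<Sum>c\<in>H. norm (h k * block c)) + (\<Sum>y\<in>Y. norm (h k * (y * star y)))"
      by (intro add_mono norm_sum)
    also have "\<dots> \<le> (\<Sum>c\<in>H. 2 * s ^ (2 ^ Suc k)) + (\<Sum>y\<in>Y. s ^ (2 ^ Suc k))"
    proof (intro add_mono sum_mono)
      fix c assume "c \<in> H"
      then have "c b \<in> S" for b by (auto simp: S_def cols_def)
      then show "norm (h k * block c) \<le> 2 * s ^ (2 ^ Suc k)"
        using norm_triangle_mono[OF 1[of "c False"] 1[of "c True"]] by (simp add: block_def UNIV_bool ring_distribs add.commute)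
    qed (use 1 S_def in auto)
    finally show ?thesis by (simp add: nh algebra_simps)
  qed
  show ?thesis by (rule le_if_power_le[OF bound s]) simp
qed

lemma norm_c: "c \<in> H \<Longrightarrow> norm (c b) = 1"
  using cstar_identity[of "c b"] projectionD(4)[OF q] by (simp add: HH power2_eq_1_iff) (smt (verit) norm_ge_zero)

lemma norm_y: "y \<in> Y \<Longrightarrow> norm y = 1"
  using cstar_identity[of y] projectionD(4)[OF r] by (simp add: YY power2_eq_1_iff) (smt (verit) norm_ge_zero)

lemma c_nz: "c \<in> H \<Longrightarrow> c b \<noteq> 0" using norm_c[of c b] by auto

lemma y_nz: "y \<in> Y \<Longrightarrow> y \<noteq> 0" using norm_y[of y] by auto

section \<open>Minimal projections of the commutative subalgebra\<close>

definition projs where "projs = block ` H \<union> (\<lambda>y. y * star y) ` Y"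

lemma finite_projs: "finite projs" using finH finY by (simp add: projs_def)

lemma yy_y: "y \<in> Y \<Longrightarrow> y' \<in> Y \<Longrightarrow> (y * star y) * y' = (if y = y' then y' else 0)"
  by (simp add: rules)

lemma inj_block: "inj_on block H"
proof (rule inj_onI, rule ccontr)
  fix c c' assume *: "c \<in> H" "c' \<in> H" "block c = block c'" "c \<noteq> c'"
  have "c' True = 0" using block_c[OF *(1,2), of True] block_c[OF *(2,2), of True] * by simp
  then show False using c_nz[OF *(2)] by blast
qed

lemma inj_yy: "inj_on (\<lambda>y. y * star y) Y"
proof (rule inj_onI, rule ccontr)
  fix y y' assume *: "y \<in> Y" "y' \<in> Y" "y * star y = y' * star y'" "y \<noteq> y'"
  have "y' = 0" using yy_y[OF *(1,2)] yy_y[OF *(2,2)] * by simp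
  then show False using y_nz[OF *(2)] by blast
qed

lemma disj_projs: "block ` H \<inter> (\<lambda>y. y * star y) ` Y = {}"
proof (rule ccontr)
  assume "block ` H \<inter> (\<lambda>y. y * star y) ` Y \<noteq> {}"
  then obtain c y where *: "c \<in> H" "y \<in> Y" "block c = y * star y" by auto
  have "y = 0" using block_y[OF *(1,2)] yy_y[OF *(2,2)] * by simp
  then show False using y_nz[OF *(2)] by blast
qed

lemma sum_projs: "(\<Sum>p\<in>projs. f p) = (\<Sum>c\<in>H. f (block c)) + (\<Sum>y\<in>Y. f (y * star y))"
  unfolding projs_def using finH finY disj_projs
  by (simp add: sum.union_disjoint sum.reindex[OF inj_block] sum.reindex[OF inj_yy])

lemma total_projs: "(\<Sum>p\<in>projs. p) = one"
  by (simp add: sum_projs total)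

lemma block_block: "c \<in> H \<Longrightarrow> c' \<in> H \<Longrightarrow> block c * block c' = (if c = c' then block c else 0)"
  by (auto simp: rules)

lemma projs_mult: "p \<in> projs \<Longrightarrow> p' \<in> projs \<Longrightarrow> p * p' = (if p = p' then p else 0)"
  unfolding projs_def using disj_projs inj_block inj_yy
  by (auto simp: block_block inj_on_eq_iff) (auto simp: rules inj_on_eq_iff[OF inj_yy, symmetric])

lemma projection_projs: "p \<in> projs \<Longrightarrow> projection p"
  unfolding projection_def
proof (intro conjI)
  assume p: "p \<in> projs"
  then show "p * p = p" by (simp add: projs_mult)
  show "star p = p" using p by (auto simp: projs_def star_block star_simps)
  show "p \<noteq> 0"
  proof
    assume p0: "p = 0"
    from p consider c where "c \<in> H" "p = block c" | y where "y \<in> Y" "p = y * star y" by (auto simp: projs_def)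
    then show False
    proof cases
      case 1 then show ?thesis using block_c[of c c True] c_nz[of c True] p0 by simp
    next
      case 2 then show ?thesis using yy_y[of y y] y_nz[of y] p0 by simp
    qed
  qed
qed

text \<open>As \<open>z\<close> commutes with the projections, the pieces \<open>p * z\<close> are
  orthogonal on both sides, and \<open>norm_sum_orthogonal\<close> applies.\<close>

lemma norm_le_projs:
  assumes "0 \<le> K" and z: "one * z = z" and p: "\<And>p. p \<in> projs \<Longrightarrow> p * z = z * p" "\<And>p. p \<in> projs \<Longrightarrow> norm (p * z) \<le> K"
  shows "norm z \<le> K"
proof -
  have "z = (\<Sum>p\<in>projs. p * z)" by (simp add: sum_distrib_right[symmetric] total_projs z)
  moreover have "norm (\<Sum>p\<in>projs. p * z) \<le> K"
  proof (rule norm_sum_orthogonal[OF finite_projs assms(1) p(2)])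
    fix p p' assume *: "p \<in> projs" "p' \<in> projs" "p \<noteq> p'"
    have s: "star p = p" "star p' = p'" using projectionD(1) projection_projs * by auto
    have 1: "star (p * z) * (p' * z) = star z * (p * p') * z" by (simp add: star_simps s mult.assoc)
    have "(p * z) * star (p' * z) = p * (z * star z) * p'" by (simp add: star_simps s mult.assoc)
    also have "\<dots> = p * p' * (z * star z)"
    proof -
      have "star z * p' = p' * star z" using arg_cong[OF p(1)[OF *(2)], of star] by (simp add: star_simps s)
      then have "z * star z * p' = p' * (z * star z)" using p(1)[OF *(2)] by (metis mult.assoc)
      then show ?thesis by (simp add: mult.assoc)
    qed
    finally show "star (p * z) * (p' * z) = 0 \<and> p * z * star (p' * z) = 0"
      using 1 * by (simp add: projs_mult)
  qed
  ultimately show ?thesis by simp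
qed

definition diag where "diag = cspan projs"

lemma csubspace_diag: "csubspace diag" by (simp add: diag_def complex_vector.subspace_span)

lemma projs_diag: "p \<in> projs \<Longrightarrow> p \<in> diag" by (simp add: diag_def complex_vector.span_base)

lemma diag_iff: "x \<in> diag \<longleftrightarrow> (\<exists>f. x = (\<Sum>p\<in>projs. f p *\<^sub>C p))"
  unfolding diag_def complex_vector.span_finite[OF finite_projs] by auto

lemma projs_sum: "p \<in> projs \<Longrightarrow> p * (\<Sum>p\<in>projs. f p *\<^sub>C p) = f p *\<^sub>C p"
  using finite_projs by (simp add: sum_distrib_left scaleC_mult projs_mult if_distrib[of "scaleC _"] cong: if_cong)

lemma sum_projs_right: "p \<in> projs \<Longrightarrow> (\<Sum>p\<in>projs. f p *\<^sub>C p) * p = f p *\<^sub>C p"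
  using finite_projs by (simp add: sum_distrib_right scaleC_mult projs_mult if_distrib[of "scaleC _"] cong: if_cong)

lemma sum_projs_mult: "(\<Sum>p\<in>projs. f p *\<^sub>C p) * (\<Sum>p\<in>projs. g p *\<^sub>C p) = (\<Sum>p\<in>projs. (f p * g p) *\<^sub>C p)"
  by (simp add: sum_distrib_right[of _ projs] projs_sum scaleC_mult scaleC_scaleC cong: sum.cong)
    
lemma star_sum_projs: "star (\<Sum>p\<in>projs. f p *\<^sub>C p) = (\<Sum>p\<in>projs. cnj (f p) *\<^sub>C p)"
  using projection_projs by (auto simp: star_simps projectionD intro!: sum.cong)

lemma norm_sum_projs: 
  assumes "0 \<le> K" "\<And>p. p \<in> projs \<Longrightarrow> cmod (f p) \<le> K" shows "norm (\<Sum>p\<in>projs. f p *\<^sub>C p) \<le> K"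
proof (rule norm_le_projs[OF assms(1)])
  show "one * (\<Sum>p\<in>projs. f p *\<^sub>C p) = (\<Sum>p\<in>projs. f p *\<^sub>C p)"
    by (simp add: total_projs[symmetric] sum_distrib_right[of _ projs] projs_sum cong: sum.cong)
  fix p assume p: "p \<in> projs"
  then show "p * (\<Sum>p\<in>projs. f p *\<^sub>C p) = (\<Sum>p\<in>projs. f p *\<^sub>C p) * p" by (simp add: projs_sum sum_projs_right)
  show "norm (p * (\<Sum>p\<in>projs. f p *\<^sub>C p)) \<le> K"
    using assms(2)[OF p] by (simp add: projs_sum p norm_scaleC projectionD(4)[OF projection_projs[OF p]])
qed

lemma coeff_le_norm: "p \<in> projs \<Longrightarrow> cmod (f p) \<le> norm (\<Sum>p\<in>projs. f p *\<^sub>C p)"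
  using norm_mult_ineq[of p "\<Sum>p\<in>projs. f p *\<^sub>C p"] projectionD(4)[OF projection_projs[of p]]
  by (simp add: projs_sum norm_scaleC)

lemma diag_alg: "d \<in> diag \<Longrightarrow> d \<in> alg"
  unfolding diag_iff
  by (auto simp: sum_projs block_def intro!: complex_vector.subspace_add[OF csubspace_alg]
      complex_vector.subspace_sum[OF csubspace_alg] complex_vector.subspace_scale[OF csubspace_alg])
    (simp_all add: algH algY)

text \<open>
  On \<open>alg\<close>, the map \<open>T\<close> is the expectation onto \<open>diag\<close> that is the normalized trace on every factor
  \<open>M\<^sub>2\<close>. The formula is written so that it is a contraction on the whole ambient algebra.
\<close>

definition blk where "blk c x = (1/2) *\<^sub>R (\<Sum>b\<in>UNIV. \<Sum>b'\<in>UNIV. c b' * (star (c b) * x * c b) * star (c b'))"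

definition T where "T x = (\<Sum>c\<in>H. blk c x) + (\<Sum>y\<in>Y. (y * star y) * x * (y * star y))"

lemma T_add: "T (x + z) = T x + T z"
  by (simp add: T_def blk_def ring_distribs sum.distrib scaleR_add_right)

lemma T_scaleC: "T (a *\<^sub>C x) = a *\<^sub>C T x"
  by (simp add: T_def blk_def scaleC_mult scaleC_add_right complex_vector.scale_sum_right
      scaleC_of_real[symmetric] scaleC_scaleC mult.commute)

lemma T_diff: "T (x - z) = T x - T z"
  using T_add[of "x - z" z] by simp

lemma T_sum: "T (\<Sum>i\<in>I. f i) = (\<Sum>i\<in>I. T (f i))"
proof -
  have "T 0 = 0" using T_add[of 0 0] by simp
  then show ?thesis by (induction I rule: infinite_finite_induct) (auto simp: T_add)
qed

lemma blk_left: "c \<in> H \<Longrightarrow> c' \<in> H \<Longrightarrow> block c * blk c' x = (if c = c' then blk c x else 0)"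
  by (auto simp: blk_def rules scaleR_add_right)

lemma blk_right: "c \<in> H \<Longrightarrow> c' \<in> H \<Longrightarrow> blk c' x * block c = (if c = c' then blk c x else 0)"
  by (auto simp: blk_def rules scaleR_add_right)

lemma block_T: "c \<in> H \<Longrightarrow> block c * T x = blk c x"
  using finH by (simp add: T_def ring_distribs sum_distrib_left blk_left mult.assoc[symmetric] block_y)

lemma y_block: "c \<in> H \<Longrightarrow> y \<in> Y \<Longrightarrow> star y * block c = 0"
  using arg_cong[OF block_y, of c y star] by (simp add: star_simps star_block)

lemma T_block: "c \<in> H \<Longrightarrow> T x * block c = blk c x"
  using finH by (simp add: T_def ring_distribs sum_distrib_right blk_right mult.assoc y_block)

lemma yy_blk: "c \<in> H \<Longrightarrow> y \<in> Y \<Longrightarrow> y * star y * blk c x = 0 \<and> blk c x * (y * star y) = 0"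
  by (simp add: blk_def rules)

lemma yy_T: "y \<in> Y \<Longrightarrow> (y * star y) * T x = (y * star y) * x * (y * star y)"
  using finY by (simp add: T_def ring_distribs sum_distrib_left yy_blk)
    (simp add: rules if_distrib[of "(*) _"] cong: if_cong)

lemma T_yy: "y \<in> Y \<Longrightarrow> T x * (y * star y) = (y * star y) * x * (y * star y)"
  using finY by (simp add: T_def ring_distribs sum_distrib_right yy_blk)
    (simp add: rules if_distrib[of "(*) _"] cong: if_cong)

lemma T_comm: "p \<in> projs \<Longrightarrow> p * T x = T x * p"
  by (auto simp: projs_def block_T T_block yy_T T_yy)

lemma T_proj_left: assumes "p \<in> projs" shows "T (p * x) = p * T x"
proof -
  from assms consider c where "c \<in> H" "p = block c" | y where "y \<in> Y" "p = y * star y" by (auto simp: projs_def)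
  then show ?thesis
  proof cases
    case 1
    have "blk c' (block c * x) = (if c = c' then blk c x else 0)" if "c' \<in> H" for c'
      using that 1 by (auto simp: blk_def rules scaleR_add_right)
    moreover have "y * star y * (block c * x) * (y * star y) = 0" if "y \<in> Y" for y
      using that 1 y_block[of c y] by (simp add: mult.assoc[symmetric]) (simp add: mult.assoc)
    ultimately show ?thesis using 1 finH by (simp add: block_T) (simp add: T_def)
  next
    case 2
    have "blk c' (y * star y * x) = 0" if "c' \<in> H" for c'
      using that 2 by (auto simp: blk_def rules scaleR_add_right)
    moreover have "y' * star y' * (y * star y * x) * (y' * star y') = (if y = y' then (y * star y) * x * (y * star y) else 0)" if "y' \<in> Y" for y'
      using that 2 by (simp add: rules)
    ultimately show ?thesis using 2 finY by (simp add: yy_T) (simp add: T_def)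
  qed
qed

lemma T_star: "T (star x) = star (T x)"
  by (simp add: T_def blk_def star_simps UNIV_bool mult.assoc)

lemma T_proj_right: assumes "p \<in> projs" shows "T (x * p) = T x * p"
proof -
  have "T (x * p) = star (T (p * star x))"
    by (simp add: T_star[symmetric] star_simps projectionD(1)[OF projection_projs[OF assms]])
  then show ?thesis
    by (simp add: T_proj_left[OF assms] T_star star_simps projectionD(1)[OF projection_projs[OF assms]])
qed

lemma T_left: "d \<in> diag \<Longrightarrow> T (d * x) = d * T x"
  by (auto simp: diag_iff sum_distrib_right scaleC_mult T_sum T_scaleC T_proj_left)

lemma T_right: "d \<in> diag \<Longrightarrow> T (x * d) = T x * d"
  by (auto simp: diag_iff sum_distrib_left scaleC_mult T_sum T_scaleC T_proj_right)

lemma one_T: "one * T x = T x"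
proof -
  have "one * T x = (\<Sum>p\<in>projs. p * T x)" by (simp add: total_projs[symmetric] sum_distrib_right)
  also have "\<dots> = (\<Sum>c\<in>H. blk c x) + (\<Sum>y\<in>Y. (y * star y) * x * (y * star y))"
    by (simp add: sum_projs block_T yy_T)
  finally show ?thesis by (simp add: T_def)
qed

lemma T_one: "T one = one"
proof -
  have "blk c one = block c" if "c \<in> H" for c
    using that by (simp add: blk_def one_c mult.assoc HH cq) (simp add: mult.assoc[symmetric] cq block_def UNIV_bool scaleR_2[symmetric])
  moreover have "(y * star y) * one * (y * star y) = y * star y" if "y \<in> Y" for y
    using that by (simp add: mult.assoc) (simp add: mult.assoc[of one, symmetric] one_y rules)
  ultimately show ?thesis by (simp add: T_def total)
qed

lemma T_diag: "d \<in> diag \<Longrightarrow> T d = d"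
  using T_left[of d one] one_right[OF diag_alg, of d] by (simp add: T_one)

text \<open>\<open>blk c x\<close> is the average over \<open>b\<close> of two elements, each the
  sum of two orthogonal copies of the compression \<open>star (c b) * x * c b\<close>.\<close>

lemma norm_blk: assumes c: "c \<in> H" shows "norm (blk c x) \<le> norm x"
proof -
  have z: "norm (star (c b) * x * c b) \<le> norm x" for b
    using norm_mult_ineq[of "star (c b) * x" "c b"] norm_mult_ineq[of "star (c b)" x] norm_c[OF c] by simp
  have "norm (\<Sum>b'\<in>UNIV. c b' * z * star (c b')) \<le> norm z" for z
  proof (rule norm_sum_orthogonal)
    show "norm (c b * z * star (c b)) \<le> norm z" for b
      using norm_mult_ineq[of "c b * z" "star (c b)"] norm_mult_ineq[of "c b" z] norm_c[OF c] by simp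
  qed (use c in \<open>auto simp: star_simps rules\<close>)
  from norm_triangle_mono[OF order.trans[OF this z[of False]] order.trans[OF this z[of True]]]
  show ?thesis by (simp add: blk_def UNIV_bool add_ac)
qed

lemma norm_yy: assumes y: "y \<in> Y" shows "norm (y * star y * x * (y * star y)) \<le> norm x"
proof -
  have 1: "norm (y * star y) = 1" using projectionD(4)[OF projection_projs, of "y * star y"] y by (auto simp: projs_def)
  show ?thesis using norm_mult_ineq[of "y * star y * x" "y * star y"] norm_mult_ineq[of "y * star y" x] 1 by simp
qed

lemma norm_T: "norm (T x) \<le> norm x"
proof (rule norm_le_projs[OF norm_ge_zero one_T T_comm])
  fix p assume "p \<in> projs"
  then show "norm (p * T x) \<le> norm x"
    by (auto simp: projs_def block_T norm_blk yy_T norm_yy)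
qed

text \<open>Compression to the commutant of \<open>diag\<close>. It keeps each factor
  \<open>M\<^sub>2\<close> entirely, so on \<open>alg\<close> it differs from \<open>T\<close> by
  the trace-zero parts of these factors.\<close>

definition pinch where "pinch x = (\<Sum>p\<in>projs. p * x * p)"

lemma proj_pinch: assumes "p \<in> projs" shows "p * pinch x = p * x * p" "pinch x * p = p * x * p"
proof -
  have "p * pinch x = (\<Sum>p'\<in>projs. (p * p') * x * p')" by (simp add: pinch_def sum_distrib_left mult.assoc)
  also have "\<dots> = (\<Sum>p'\<in>projs. if p = p' then p * x * p else 0)" using assms by (intro sum.cong) (auto simp: projs_mult)
  finally show "p * pinch x = p * x * p" using assms finite_projs by simp
  have "pinch x * p = (\<Sum>p'\<in>projs. p' * x * (p' * p))" by (simp add: pinch_def sum_distrib_right mult.assoc)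
  also have "\<dots> = (\<Sum>p'\<in>projs. if p' = p then p * x * p else 0)" using assms by (intro sum.cong) (auto simp: projs_mult mult.assoc)
  finally show "pinch x * p = p * x * p" using assms finite_projs by simp
qed

lemma norm_pinch: "norm (pinch x) \<le> norm x"
proof (rule norm_le_projs[OF norm_ge_zero])
  have "one * pinch x = (\<Sum>p\<in>projs. p * pinch x)" by (simp add: total_projs[symmetric] sum_distrib_right)
  also have "\<dots> = (\<Sum>p\<in>projs. p * x * p)" by (intro sum.cong refl proj_pinch)
  finally show "one * pinch x = pinch x" by (simp add: pinch_def)
  fix p assume p: "p \<in> projs"
  then show "p * pinch x = pinch x * p" by (simp add: proj_pinch)
  show "norm (p * pinch x) \<le> norm x"
    using norm_mult_ineq[of "p * x" p] norm_mult_ineq[of p x] projectionD(4)[OF projection_projs[OF p]]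
    by (simp add: proj_pinch p)
qed

lemma pinch_diff: "pinch (x - z) = pinch x - pinch z"
  by (simp add: pinch_def algebra_simps sum_subtractf)

lemma pinch_fix: 
  assumes "one * x = x" "\<And>p. p \<in> projs \<Longrightarrow> p * x = x * p" shows "pinch x = x"
proof -
  have "pinch x = (\<Sum>p\<in>projs. p * x)"
    unfolding pinch_def
  proof (intro sum.cong refl)
    fix p assume p: "p \<in> projs"
    have "p * x * p = p * (x * p)" by (simp add: mult.assoc)
    also have "\<dots> = p * p * x" by (simp only: assms(2)[OF p, symmetric] mult.assoc)
    finally show "p * x * p = p * x" using p by (simp add: projs_mult)
  qed
  then show ?thesis by (simp add: sum_distrib_right[symmetric] total_projs assms(1))
qed

lemma c_one: "c \<in> H \<Longrightarrow> star (c b) * one = star (c b)"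
  using one_c[of c b] star_mult[of one "c b"] by (simp add: star_one)

lemma y_one: "y \<in> Y \<Longrightarrow> star y * one = star y"
  using one_y[of y] star_mult[of one y] by (simp add: star_one)

lemma one_rules:
  "c \<in> H \<Longrightarrow> one * c b = c b" "c \<in> H \<Longrightarrow> one * (c b * z) = c b * z"
  "y \<in> Y \<Longrightarrow> one * y = y" "y \<in> Y \<Longrightarrow> one * (y * z) = y * z"
  "c \<in> H \<Longrightarrow> star (c b) * one = star (c b)" "c \<in> H \<Longrightarrow> star (c b) * (one * z) = star (c b) * z"
  "y \<in> Y \<Longrightarrow> star y * one = star y" "y \<in> Y \<Longrightarrow> star y * (one * z) = star y * z"
  by (simp_all add: one_c one_y c_one y_one mult.assoc[symmetric])

text \<open>The elements of \<open>mono\<close> normalize the diagonals of this and of all later stages.\<close>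

definition mono where
  "mono = {a *\<^sub>C pauli i s c c' | a i s c c'. c \<in> H \<and> c' \<in> H} \<union> {a *\<^sub>C (y * star y') | a y y'. y \<in> Y \<and> y' \<in> Y}"

lemma mono_cases [consumes 1, case_names pauli Y]:
  assumes "w \<in> mono"
  obtains a i s c c' where "c \<in> H" "c' \<in> H" "w = a *\<^sub>C pauli i s c c'"
  | a y y' where "y \<in> Y" "y' \<in> Y" "w = a *\<^sub>C (y * star y')"
  using assms unfolding mono_def by blast

lemma pauli_mono: "c \<in> H \<Longrightarrow> c' \<in> H \<Longrightarrow> a *\<^sub>C pauli i s c c' \<in> mono"
  unfolding mono_def by blast

lemma Y_mono: "y \<in> Y \<Longrightarrow> y' \<in> Y \<Longrightarrow> a *\<^sub>C (y * star y') \<in> mono"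
  unfolding mono_def by blast

lemma pauli_mono1: "c \<in> H \<Longrightarrow> c' \<in> H \<Longrightarrow> pauli i s c c' \<in> mono"
  using pauli_mono[of c c' 1] by simp

lemma Y_mono1: "y \<in> Y \<Longrightarrow> y' \<in> Y \<Longrightarrow> y * star y' \<in> mono"
  using Y_mono[of y y' 1] by simp

lemma pauli_alg: "c \<in> H \<Longrightarrow> c' \<in> H \<Longrightarrow> pauli i s c c' \<in> alg"
  unfolding pauli_def
  by (intro complex_vector.subspace_add[OF csubspace_alg] csubspace_scaleR[OF csubspace_alg] algH)

lemma mono_alg: "w \<in> mono \<Longrightarrow> w \<in> alg"
  by (auto elim!: mono_cases intro!: complex_vector.subspace_scale[OF csubspace_alg] pauli_alg algY)

text \<open>The four Pauli matrices form a basis of \<open>M\<^sub>2\<close>: a single matrix unit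
  is half the sum or half the difference over the phase \<open>s\<close>. Statements about
  \<open>alg\<close> thereby reduce to its normalizing elements.\<close>

lemma alg_mono: "alg = cspan mono"
proof (rule antisym)
  have "c b * star (c' b') \<in> cspan mono" if "c \<in> H" "c' \<in> H" for c b c' b'
  proof -
    have "pauli i s c c' \<in> cspan mono" for i s using that by (simp add: pauli_mono1 complex_vector.span_base)
    note 1 = this
    have "c i * star (c' False) = (1/2) *\<^sub>R (pauli i False c c' + pauli i True c c')"
      and "c i * star (c' True) = (1/2) *\<^sub>R (pauli (\<not> i) False c c' - pauli (\<not> i) True c c')" for i
      by (auto simp: pauli_def algebra_simps scaleR_2[symmetric])
    then have "c i * star (c' False) \<in> cspan mono" "c i * star (c' True) \<in> cspan mono" for i
      using 1 by (auto intro!: cspan_scaleR complex_vector.span_add complex_vector.span_diff)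
    then show ?thesis by (cases b') auto
  qed
  then have "gens \<subseteq> cspan mono" by (auto simp: gens_def Y_mono1 complex_vector.span_base)
  then show "alg \<subseteq> cspan mono" unfolding alg_def by (rule complex_vector.span_minimal) simp
  show "cspan mono \<subseteq> alg" using mono_alg csubspace_alg by (intro complex_vector.span_minimal) auto
qed

lemma star_pauli: "star (pauli i s c c') = (if i \<and> s then -1 else 1) *\<^sub>C pauli i s c' c"
  by (cases i; cases s) (auto simp: pauli_def star_simps)

lemma star_mono: assumes "w \<in> mono" shows "star w \<in> mono"
  using assms
proof (cases rule: mono_cases)
  case (pauli a i s c c')
  then show ?thesis by (simp add: star_simps star_pauli scaleC_scaleC pauli_mono)
next
  case (Y a y y')
  then show ?thesis by (simp add: star_simps Y_mono)
qed

lemma block_projs: "c \<in> H \<Longrightarrow> block c \<in> projs" and yy_projs: "y \<in> Y \<Longrightarrow> y * star y \<in> projs"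
  by (auto simp: projs_def)

lemma mono_square: assumes "w \<in> mono" shows "\<exists>a. \<exists>p\<in>projs. w * star w = a *\<^sub>C p"
  using assms
proof (cases rule: mono_cases)
  case (pauli a i s c c')
  have "pauli i s c c' * star (pauli i s c c') = block c"
    using pauli by (cases i; cases s) (simp_all add: pauli_def star_simps rules)
  then have "w * star w = (a * cnj a) *\<^sub>C block c" using pauli by (simp add: star_scaleC scaleC_mult scaleC_scaleC mult.commute)
  then show ?thesis using block_projs[OF pauli(1)] by blast
next
  case (Y a y y')
  then have "y * star y' * star (y * star y') = y * star y" by (simp add: star_simps rules)
  then have "w * star w = (a * cnj a) *\<^sub>C (y * star y)" using Y by (simp add: star_scaleC scaleC_mult scaleC_scaleC mult.commute)
  then show ?thesis using yy_projs[OF Y(1)] by blast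
qed

text \<open>A Pauli matrix carries the two columns of \<open>c'\<close> to those of \<open>c\<close>
  up to order and sign, and neither affects the average in \<open>blk\<close>.\<close>

lemma T_pauli:
  assumes "c \<in> H" "c' \<in> H"
  shows "T (star (pauli i s c c') * x * pauli i s c c') = star (pauli i s c c') * T x * pauli i s c c'"
proof -
  let ?w = "pauli i s c c'"
  have w: "block c * ?w = ?w" "?w * block c' = ?w" "star ?w * block c = star ?w" "block c' * star ?w = star ?w"
    using assms by (simp_all add: pauli_def star_simps rules)
  have "T (star ?w * x * ?w) = T (block c' * (star ?w * x * ?w))" by (simp add: w mult.assoc[symmetric])
  also have "\<dots> = blk c' (star ?w * x * ?w)" using assms by (simp add: T_proj_left block_projs block_T)
  also have "\<dots> = star ?w * blk c x * ?w"
    using assms by (cases i; cases s) (simp_all add: blk_def pauli_def star_simps rules scaleR_add_right)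
  also have "blk c x = block c * T x" using assms by (simp add: block_T)
  also have "star ?w * (block c * T x) * ?w = star ?w * T x * ?w" by (simp add: w mult.assoc[symmetric])
  finally show ?thesis .
qed

lemma T_Y_conj: 
  assumes "y \<in> Y" "y' \<in> Y"
  shows "T (star (y * star y') * x * (y * star y')) = star (y * star y') * T x * (y * star y')"
proof -
  let ?w = "y * star y'"
  have w: "(y * star y) * ?w = ?w" "(y' * star y') * star ?w = star ?w" "star ?w * (y * star y) = star ?w"
    using assms by (simp_all add: star_simps rules)
  have "T (star ?w * x * ?w) = T ((y' * star y') * (star ?w * x * ?w))" by (simp only: w mult.assoc[symmetric])
  also have "\<dots> = (y' * star y') * (star ?w * x * ?w) * (y' * star y')"
    using assms by (simp only: T_proj_left yy_projs yy_T)
  also have "\<dots> = star ?w * ((y * star y) * x * (y * star y)) * ?w"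
    using assms by (simp add: star_simps rules)
  also have "(y * star y) * x * (y * star y) = (y * star y) * T x" using assms by (simp only: yy_T)
  also have "star ?w * ((y * star y) * T x) * ?w = (star ?w * (y * star y)) * T x * ?w" by (simp only: mult.assoc)
  also have "\<dots> = star ?w * T x * ?w" by (simp only: w)
  finally show ?thesis .
qed

lemma T_mono: assumes "w \<in> mono" shows "T (star w * x * w) = star w * T x * w"
  using assms
proof (cases rule: mono_cases)
  case (pauli a i s c c')
  then show ?thesis using T_pauli[of c c' i s x] by (simp add: star_scaleC scaleC_mult T_scaleC)
next
  case (Y a y y')
  then show ?thesis using T_Y_conj[of y y' x] by (simp add: star_scaleC scaleC_mult T_scaleC)
qed

lemma blk_alg: 
  assumes "c \<in> H" "star (c False) * x * c False = m *\<^sub>C q" "star (c True) * x * c True = n *\<^sub>C q"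
  shows "blk c x = ((m + n) / 2) *\<^sub>C block c"
proof -
  have "c b' * (star (c b) * x * c b) * star (c b') = (if b then n else m) *\<^sub>C (c b' * star (c b'))" for b b'
    using assms by (cases b) (simp_all add: scaleC_mult cq)
  then show ?thesis
    by (simp only: blk_def) (simp add: UNIV_bool block_def scaleC_of_real[symmetric] scaleC_scaleC
        scaleC_add_right scaleC_add_left add_divide_distrib)
qed

lemma T_alg: assumes "x \<in> alg" shows "T x \<in> diag"
  unfolding T_def
proof (intro complex_vector.subspace_add[OF csubspace_diag] complex_vector.subspace_sum[OF csubspace_diag])
  fix c assume c: "c \<in> H"
  obtain m n where "star (c False) * x * c False = m *\<^sub>C q" "star (c True) * x * c True = n *\<^sub>C q"
    using alg_coeff[OF assms c c] by metis
  then have "blk c x = ((m + n) / 2) *\<^sub>C block c" by (rule blk_alg[OF c])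
  then show "blk c x \<in> diag"
    by (simp add: complex_vector.subspace_scale[OF csubspace_diag] projs_diag block_projs c)
next
  fix y assume y: "y \<in> Y"
  obtain m where "star y * x * y = m *\<^sub>C r" using alg_coeff_Y[OF assms y y] by blast
  then have "y * (star y * x * y) * star y = m *\<^sub>C (y * star y)" using y by (simp add: scaleC_mult yr)
  then show "y * star y * x * (y * star y) \<in> diag"
    using y by (simp add: mult.assoc[of y "star y" x] mult.assoc complex_vector.subspace_scale[OF csubspace_diag] projs_diag yy_projs)
qed

text \<open>The vectors \<open>x * c b\<close> and \<open>x * y\<close> stay in a column space,
  where \<open>star v * v\<close> is a nonnegative multiple of \<open>q\<close> or \<open>r\<close>;
  averaging over \<open>b\<close> preserves the sign.\<close>

lemma T_square: assumes x: "x \<in> alg"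
  shows "\<exists>g. (\<forall>p\<in>projs. 0 \<le> g p) \<and> T (star x * x) = (\<Sum>p\<in>projs. complex_of_real (g p) *\<^sub>C p)"
proof -
  have m: "\<exists>m\<ge>0. star (c b) * (star x * x) * c b = complex_of_real m *\<^sub>C q" if "c \<in> H" for c b
  proof -
    have "c b \<in> cspan cols" using that by (auto simp: cols_def intro!: complex_vector.span_base)
    from orthonormal_square[OF orthonormal_cols alg_cols[OF x this]] show ?thesis
      by (simp add: star_simps mult.assoc)
  qed
  have 1: "\<exists>m\<ge>0. p * T (star x * x) = complex_of_real m *\<^sub>C p" if "p \<in> projs" for p
  proof -
    from that consider c where "c \<in> H" "p = block c" | y where "y \<in> Y" "p = y * star y" by (auto simp: projs_def)
    then show ?thesis
    proof cases
      case 1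
      obtain m n where mn: "m \<ge> 0" "n \<ge> 0" "star (c False) * (star x * x) * c False = complex_of_real m *\<^sub>C q"
         "star (c True) * (star x * x) * c True = complex_of_real n *\<^sub>C q" using m[OF 1(1)] by metis
      show ?thesis using mn(1,2) blk_alg[OF 1(1) mn(3,4)] 1
        by (intro exI[of _ "(m + n) / 2"]) (simp add: block_T)
    next
      case 2
      obtain m where mn: "m \<ge> 0" "star y * (star x * x) * y = complex_of_real m *\<^sub>C r"
        using orthonormal_square[OF orthonormal_Y alg_Y[OF x], of y] 2
        by (auto simp: complex_vector.span_base star_simps mult.assoc)
      have "y * (star y * (star x * x) * y) * star y = complex_of_real m *\<^sub>C (y * star y)"
        using 2 unfolding mn by (simp add: scaleC_mult yr)
      then have "p * T (star x * x) = complex_of_real m *\<^sub>C p"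
        unfolding 2(2) yy_T[OF 2(1)] by (simp add: mult.assoc)
      then show ?thesis using mn(1) by blast
    qed
  qed
  then obtain g where g: "\<And>p. p \<in> projs \<Longrightarrow> g p \<ge> 0 \<and> p * T (star x * x) = complex_of_real (g p) *\<^sub>C p" by metis
  have "T (star x * x) = (\<Sum>p\<in>projs. p * T (star x * x))"
    by (simp add: sum_distrib_right[symmetric] total_projs one_T)
  also have "\<dots> = (\<Sum>p\<in>projs. complex_of_real (g p) *\<^sub>C p)" using g by (intro sum.cong) auto
  finally show ?thesis using g by blast
qed

section \<open>Values and lower bounds of the expectation\<close>

lemma projs_eqI:
  assumes "\<And>p. p \<in> projs \<Longrightarrow> p * x = p * z" "one * x = x" "one * z = z" shows "x = z"
proof -
  have "one * x = (\<Sum>p\<in>projs. p * x)" by (simp add: total_projs[symmetric] sum_distrib_right)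
  also have "\<dots> = (\<Sum>p\<in>projs. p * z)" using assms(1) by simp
  also have "\<dots> = one * z" by (simp add: total_projs[symmetric] sum_distrib_right)
  finally show ?thesis using assms by simp
qed

lemma one_pinch: "one * pinch x = pinch x"
proof -
  have "one * pinch x = (\<Sum>p\<in>projs. p * pinch x)" by (simp add: total_projs[symmetric] sum_distrib_right)
  also have "\<dots> = (\<Sum>p\<in>projs. p * x * p)" by (intro sum.cong refl proj_pinch)
  finally show ?thesis by (simp add: pinch_def)
qed

lemma T_cols:
  assumes "c \<in> H" "c' \<in> H"
  shows "T (c b * star (c' b')) = (if c = c' \<and> b = b' then (1/2) *\<^sub>R block c else 0)"
proof (rule projs_eqI[OF _ one_T])
  fix p assume "p \<in> projs"
  then consider d where "d \<in> H" "p = block d" | y where "y \<in> Y" "p = y * star y" by (auto simp: projs_def)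
  then show "p * T (c b * star (c' b')) = p * (if c = c' \<and> b = b' then (1/2) *\<^sub>R block c else 0)"
  proof cases
    case 1
    then show ?thesis unfolding 1(2) block_T[OF 1(1)] using assms
      by (cases b; cases b') (auto simp: blk_def rules scaleR_add_right)
  next
    case 2
    then show ?thesis unfolding 2(2) yy_T[OF 2(1)] using assms by (auto simp: rules)
  qed
qed (use assms in \<open>auto simp: one_rules block_def UNIV_bool ring_distribs\<close>)

lemma T_Y:
  assumes "y \<in> Y" "y' \<in> Y"
  shows "T (y * star y') = (if y = y' then y * star y else 0)"
proof (rule projs_eqI[OF _ one_T])
  fix p assume "p \<in> projs"
  then consider c where "c \<in> H" "p = block c" | y where "y \<in> Y" "p = y * star y" by (auto simp: projs_def)
  then show "p * T (y * star y') = p * (if y = y' then y * star y else 0)"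
  proof cases
    case 1
    then show ?thesis unfolding 1(2) block_T[OF 1(1)] using assms by (auto simp: blk_def rules)
  next
    case 2
    then show ?thesis unfolding 2(2) yy_T[OF 2(1)] using assms by (auto simp: rules)
  qed
qed (use assms in \<open>auto simp: one_rules\<close>)

lemma T_square_add:
  assumes "x \<in> alg" "z \<in> alg"
  shows "norm (T (star (x + z) * (x + z))) \<le> 2 * norm (T (star x * x)) + 2 * norm (T (star z * z))"
proof -
  have xz: "x + z \<in> alg" "x - z \<in> alg"
    using assms csubspace_alg complex_vector.subspace_add complex_vector.subspace_diff by blast+
  obtain g1 where g1: "\<forall>p\<in>projs. 0 \<le> g1 p" "T (star (x + z) * (x + z)) = (\<Sum>p\<in>projs. complex_of_real (g1 p) *\<^sub>C p)"
    using T_square[OF xz(1)] by blast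
  obtain g2 where g2: "\<forall>p\<in>projs. 0 \<le> g2 p" "T (star (x - z) * (x - z)) = (\<Sum>p\<in>projs. complex_of_real (g2 p) *\<^sub>C p)"
    using T_square[OF xz(2)] by blast
  obtain g3 where g3: "\<forall>p\<in>projs. 0 \<le> g3 p" "T (star x * x) = (\<Sum>p\<in>projs. complex_of_real (g3 p) *\<^sub>C p)"
    using T_square[OF assms(1)] by blast
  obtain g4 where g4: "\<forall>p\<in>projs. 0 \<le> g4 p" "T (star z * z) = (\<Sum>p\<in>projs. complex_of_real (g4 p) *\<^sub>C p)"
    using T_square[OF assms(2)] by blast
  have "star (x + z) * (x + z) + star (x - z) * (x - z) = star x * x + star x * x + (star z * z + star z * z)"
    by (simp add: star_add star_diff algebra_simps)
  then have eq: "T (star (x + z) * (x + z)) + T (star (x - z) * (x - z))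
      = T (star x * x) + T (star x * x) + (T (star z * z) + T (star z * z))"
    by (simp only: T_add[symmetric])
  have le: "g1 p \<le> 2 * norm (T (star x * x)) + 2 * norm (T (star z * z))" if p: "p \<in> projs" for p
  proof -
    have "p * (T (star (x + z) * (x + z)) + T (star (x - z) * (x - z)))
        = p * (T (star x * x) + T (star x * x) + (T (star z * z) + T (star z * z)))"
      by (simp only: eq)
    then have "complex_of_real (g1 p + g2 p) *\<^sub>C p = complex_of_real (2 * g3 p + 2 * g4 p) *\<^sub>C p"
      unfolding g1(2) g2(2) g3(2) g4(2)
      by (simp only: distrib_left projs_sum[OF p] scaleC_add_left[symmetric] of_real_add[symmetric] mult_2)
    then have "complex_of_real (g1 p + g2 p) = complex_of_real (2 * g3 p + 2 * g4 p)"
      by (rule complex_vector.scale_right_imp_eq[OF projectionD(3)[OF projection_projs[OF p]]])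
    then have "g1 p + g2 p = 2 * g3 p + 2 * g4 p" by (simp only: of_real_eq_iff)
    moreover have "g3 p \<le> norm (T (star x * x))" "g4 p \<le> norm (T (star z * z))"
      using coeff_le_norm[OF p, of "\<lambda>p. complex_of_real (g3 p)"] coeff_le_norm[OF p, of "\<lambda>p. complex_of_real (g4 p)"]
      unfolding g3 g4 by auto
    ultimately show ?thesis using g2(1) p by force
  qed
  show ?thesis
    using le g1(1) unfolding g1(2) by (intro norm_sum_projs) auto
qed

text \<open>For a column \<open>v\<close>, take \<open>f = v * star c\<close>. Then
  \<open>star (y * f) * (y * f)\<close> is \<open>c * star c\<close> times the square of
  \<open>norm (y * v)\<close>. The expectation of \<open>c * star c\<close> has norm 1/2 in the
  first summand and 1 in the second, which explains the factor 2; \<open>norm_le_columns\<close>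
  turns the bound on columns into one on \<open>y\<close>.\<close>

lemma column_bound:
  assumes y: "y \<in> alg" and K: "0 \<le> K" and H: "H \<noteq> {}"
    and le: "\<And>f. f \<in> alg \<Longrightarrow> norm (T (star (y * f) * (y * f))) \<le> K * (norm f)\<^sup>2"
  shows "(norm y)\<^sup>2 \<le> 2 * K"
proof -
  have aux: "(norm (y * v))\<^sup>2 \<le> 2 * K * (norm v)\<^sup>2"
    if S: "orthonormal S p" "c \<in> S" "projection p" and v: "v \<in> cspan S" "y * v \<in> cspan S"
      and f: "v * star c \<in> alg" and c: "c * p = c" "norm (T (c * star c)) \<ge> 1 / 2" for S p c v
  proof -
    obtain m where m: "m \<ge> 0" "star (y * v) * (y * v) = complex_of_real m *\<^sub>C p"
      using orthonormal_square[OF S(1) v(2)] by blast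
    have nm: "(norm (y * v))\<^sup>2 = m" using cstar_identity[of "y * v"] m by (simp add: norm_scaleC projectionD(4)[OF S(3)])
    have "star c * c = p" using S(1,2) by (simp add: orthonormal_def)
    then have "norm c = 1" using cstar_identity[of c] projectionD(4)[OF S(3)]
      by (simp add: power2_eq_1_iff) (smt (verit) norm_ge_zero)
    then have nf: "norm (v * star c) \<le> norm v" using norm_mult_ineq[of v "star c"] by simp
    have "star (y * (v * star c)) * (y * (v * star c)) = c * (star (y * v) * (y * v)) * star c"
      by (simp add: star_simps mult.assoc)
    also have "\<dots> = complex_of_real m *\<^sub>C (c * star c)"
      unfolding m by (simp add: scaleC_mult c)
    finally have "norm (T (star (y * (v * star c)) * (y * (v * star c)))) = m * norm (T (c * star c))"
      using m(1) by (simp add: T_scaleC norm_scaleC)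
    moreover have "m * (1 / 2) \<le> m * norm (T (c * star c))" by (rule mult_left_mono[OF c(2) m(1)])
    moreover have "K * (norm (v * star c))\<^sup>2 \<le> K * (norm v)\<^sup>2" using nf K by (intro mult_left_mono power_mono) auto
    ultimately show ?thesis using le[OF f] nm by simp
  qed
  have "norm y \<le> sqrt (2 * K)"
  proof (rule norm_le_columns[OF y])
    fix v assume "v \<in> cspan cols \<union> cspan Y"
    then consider "v \<in> cspan cols" | "v \<in> cspan Y" "Y = {}" | "v \<in> cspan Y" "Y \<noteq> {}" by blast
    then have "(norm (y * v))\<^sup>2 \<le> 2 * K * (norm v)\<^sup>2"
    proof cases
      case 1
      obtain c where c: "c \<in> H" using H by auto
      have cc: "c True \<in> cols" using c by (auto simp: cols_def)
      have "norm (T (c True * star (c True))) = 1 / 2"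
        using c projectionD(4)[OF projection_projs[OF block_projs[OF c]]] by (simp add: T_cols)
      then show ?thesis
        using aux[OF orthonormal_cols cc q 1 alg_cols[OF y 1] cols_cols_alg[OF 1] cq[OF c]] cc
        by (simp add: complex_vector.span_base)
    next
      case 3
      then obtain z where z: "z \<in> Y" by auto
      have "norm (T (z * star z)) = 1" using z projectionD(4)[OF projection_projs[OF yy_projs[OF z]]] by (simp add: T_Y)
      then show ?thesis
        using aux[OF orthonormal_Y z r 3(1) alg_Y[OF y 3(1)] Y_Y_alg[OF 3(1)] yr[OF z]] z
        by (simp add: complex_vector.span_base)
    qed simp
    then have "norm (y * v) \<le> sqrt (2 * K * (norm v)\<^sup>2)" by (rule real_le_rsqrt)
    then show "norm (y * v) \<le> sqrt (2 * K) * norm v" by (simp add: real_sqrt_mult)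
  qed (use K in simp)
  then show ?thesis using K by (metis mult_nonneg_nonneg norm_ge_zero power_mono real_sqrt_pow2 zero_le_numeral)
qed

end

text \<open>Orthogonality can be checked on indices: since \<open>q\<close> and \<open>r\<close> are
  nonzero, different indices give different columns, so no sum collapses when passing to the
  images.\<close>

lemma frame_image:
  fixes f :: "'i \<Rightarrow> bool \<Rightarrow> 'a::cstar_algebra" and g :: "'j \<Rightarrow> 'a"
  assumes "finite I" "finite J" and q: "projection q" "projection r"
    and ff: "\<And>i i' b b'. i \<in> I \<Longrightarrow> i' \<in> I \<Longrightarrow> star (f i b) * f i' b' = (if i = i' \<and> b = b' then q else 0)"
    and gg: "\<And>j j'. j \<in> J \<Longrightarrow> j' \<in> J \<Longrightarrow> star (g j) * g j' = (if j = j' then r else 0)"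
    and fg: "\<And>i b j. i \<in> I \<Longrightarrow> j \<in> J \<Longrightarrow> star (f i b) * g j = 0"
    and total: "(\<Sum>i\<in>I. block (f i)) + (\<Sum>j\<in>J. g j * star (g j)) = one"
  shows "frame one (f ` I) (g ` J) q r"
proof -
  have nz: "q \<noteq> 0" "r \<noteq> 0" using q projectionD(3) by auto
  have fi: "f i = f i' \<longleftrightarrow> i = i'" if "i \<in> I" "i' \<in> I" for i i'
    using ff[OF that, of True True] ff[OF that(1,1), of True True] nz by (auto split: if_splits)
  have gi: "g j = g j' \<longleftrightarrow> j = j'" if "j \<in> J" "j' \<in> J" for j j'
    using gg[OF that] gg[OF that(1,1)] nz by (auto split: if_splits)
  have inj: "inj_on f I" "inj_on g J" using fi gi by (auto simp: inj_on_def)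
  show ?thesis
    by unfold_locales
      (use assms(1,2) q total in \<open>auto simp: ff gg fg fi gi sum.reindex[OF inj(1)] sum.reindex[OF inj(2)]\<close>)
qed

section \<open>Refinements\<close>

text \<open>
  The projection \<open>q\<close> is resolved into copies \<open>UA\<close> of the first new minimal projection \<open>q'\<close> and pairs
  \<open>UC\<close> of copies of \<open>r'\<close>, while \<open>r\<close> is resolved into pairs \<open>UB\<close> of copies of \<open>q'\<close> and copies \<open>UD\<close> of \<open>r'\<close>.
\<close>

locale refinement = F: frame one H Y q r + QU: frame q UC UA r' q' + RU: frame r UB UD q' r'
  for one :: "'a::cstar_algebra" and H Y q r UA UB UC UD q' r'
begin

definition H' where "H' = case_sum (\<lambda>(c, u) b. c b * u) (\<lambda>(y, u) b. y * u b) ` (H \<times> UA <+> Y \<times> UB)"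

definition Y' where "Y' = case_sum (\<lambda>(i, s, c, u). bell i s c u) (\<lambda>(y, u). y * u) ` (UNIV \<times> UNIV \<times> H \<times> UC <+> Y \<times> UD)"

lemmas rules = F.rules QU.rules RU.rules QU.one_rules RU.one_rules

lemma bell_bell:
  assumes "c \<in> H" "u \<in> UC" "c' \<in> H" "u' \<in> UC"
  shows "star (bell i s c u) * bell i' s' c' u' = (if (i, s, c, u) = (i', s', c', u') then r' else 0)"
  using assms
  by (cases i; cases s; cases i'; cases s')
    (simp_all add: bell_def star_simps rules scaleR_2[symmetric])

lemma H'_bell:
  assumes "c \<in> H" "u \<in> UA" "c' \<in> H" "u' \<in> UC"
  shows "star (c b * u) * bell i s c' u' = 0"
  using assms by (cases i; cases s) (simp_all add: bell_def star_simps rules)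

text \<open>Completeness of the Bell basis: mixed terms cancel in the sum over the phase, and the
  doubled remaining terms absorb the factor 1/2.\<close>

lemma bell_sum:
  "bell False False c u * star (bell False False c u) + bell False True c u * star (bell False True c u)
   + bell True False c u * star (bell True False c u) + bell True True c u * star (bell True True c u)
   = c False * block u * star (c False) + c True * block u * star (c True)"
  by (simp add: bell_def star_simps block_def UNIV_bool algebra_simps scaleR_2[symmetric])

sublocale N: frame one H' Y' q' r'
  unfolding H'_def Y'_def
proof (rule frame_image)
  show "finite (H \<times> UA <+> Y \<times> UB)" "finite ((UNIV :: bool set) \<times> (UNIV :: bool set) \<times> H \<times> UC <+> Y \<times> UD)"
    using F.finH F.finY QU.finH QU.finY RU.finH RU.finY by (auto intro!: finite_cartesian_product)
  show "projection q'" "projection r'" by (rule QU.r, rule QU.q)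
  show "star (case_sum (\<lambda>(c, u) b. c b * u) (\<lambda>(y, u) b. y * u b) i b)
      * case_sum (\<lambda>(c, u) b. c b * u) (\<lambda>(y, u) b. y * u b) i' b' = (if i = i' \<and> b = b' then q' else 0)"
    if "i \<in> H \<times> UA <+> Y \<times> UB" "i' \<in> H \<times> UA <+> Y \<times> UB" for i i' b b'
    using that by (auto simp: star_simps rules split: if_splits)
  show "star (case_sum (\<lambda>(i, s, c, u). bell i s c u) (\<lambda>(y, u). y * u) j)
      * case_sum (\<lambda>(i, s, c, u). bell i s c u) (\<lambda>(y, u). y * u) j' = (if j = j' then r' else 0)"
    if "j \<in> UNIV \<times> UNIV \<times> H \<times> UC <+> Y \<times> UD" "j' \<in> UNIV \<times> UNIV \<times> H \<times> UC <+> Y \<times> UD" for j j'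
    using that
    by (auto simp: bell_bell split: if_splits) (auto simp: bell_def star_simps rules split: if_splits)
  show "star (case_sum (\<lambda>(c, u) b. c b * u) (\<lambda>(y, u) b. y * u b) i b)
      * case_sum (\<lambda>(i, s, c, u). bell i s c u) (\<lambda>(y, u). y * u) j = 0"
    if "i \<in> H \<times> UA <+> Y \<times> UB" "j \<in> UNIV \<times> UNIV \<times> H \<times> UC <+> Y \<times> UD" for i b j
    using that
    by (auto simp: H'_bell) (auto simp: bell_def star_simps rules)
  have UA: "(\<Sum>u\<in>UC. block u) + (\<Sum>u\<in>UA. u * star u) = q" by (rule QU.total)
  have UB: "(\<Sum>u\<in>UB. block u) + (\<Sum>u\<in>UD. u * star u) = r" by (rule RU.total)
  \<comment> \<open>Each old block is resolved separately: the identity is the resolution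
    \<open>UA\<close> of \<open>q\<close>, transported by \<open>c False\<close> and by
    \<open>c True\<close>.\<close>
  have C: "(\<Sum>u\<in>UA. block (\<lambda>b. c b * u)) + (\<Sum>u\<in>UC. \<Sum>i\<in>UNIV. \<Sum>s\<in>UNIV. bell i s c u * star (bell i s c u)) = block c"
    if "c \<in> H" for c
  proof -
    have "(\<Sum>u\<in>UC. \<Sum>i\<in>UNIV. \<Sum>s\<in>UNIV. bell i s c u * star (bell i s c u))
      = (\<Sum>u\<in>UC. c False * block u * star (c False) + c True * block u * star (c True))"
      by (intro sum.cong refl) (simp add: UNIV_bool bell_sum[symmetric] add_ac)
    moreover have "(\<Sum>u\<in>UA. block (\<lambda>b. c b * u))
      = c False * (\<Sum>u\<in>UA. u * star u) * star (c False) + c True * (\<Sum>u\<in>UA. u * star u) * star (c True)"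
      by (simp add: block_def UNIV_bool star_simps sum.distrib sum_distrib_left sum_distrib_right mult.assoc add_ac)
    ultimately have "?thesis \<longleftrightarrow> c False * ((\<Sum>u\<in>UC. block u) + (\<Sum>u\<in>UA. u * star u)) * star (c False)
      + c True * ((\<Sum>u\<in>UC. block u) + (\<Sum>u\<in>UA. u * star u)) * star (c True) = block c"
      by (simp add: sum.distrib sum_distrib_left sum_distrib_right ring_distribs add_ac)
    then show ?thesis using that by (simp add: UA F.cq) (simp add: block_def UNIV_bool add_ac)
  qed
  have D: "(\<Sum>u\<in>UB. block (\<lambda>b. y * u b)) + (\<Sum>u\<in>UD. y * u * star (y * u)) = y * star y" if "y \<in> Y" for y
  proof -
    have "(\<Sum>u\<in>UB. block (\<lambda>b. y * u b)) = y * (\<Sum>u\<in>UB. block u) * star y"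
      by (simp add: block_def UNIV_bool star_simps sum.distrib sum_distrib_left sum_distrib_right mult.assoc ring_distribs)
    moreover have "(\<Sum>u\<in>UD. y * u * star (y * u)) = y * (\<Sum>u\<in>UD. u * star u) * star y"
      by (simp add: star_simps sum_distrib_left sum_distrib_right mult.assoc)
    ultimately have "?thesis \<longleftrightarrow> y * ((\<Sum>u\<in>UB. block u) + (\<Sum>u\<in>UD. u * star u)) * star y = y * star y"
      by (simp add: ring_distribs)
    then show ?thesis using that by (simp add: UB F.yr)
  qed
  have fin: "finite H" "finite Y" "finite UA" "finite UB" "finite UC" "finite UD"
    using F.finH F.finY QU.finH QU.finY RU.finH RU.finY by auto
  have P1: "(\<Sum>i\<in>H \<times> UA <+> Y \<times> UB. block (case_sum (\<lambda>(c, u) b. c b * u) (\<lambda>(y, u) b. y * u b) i))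
    = (\<Sum>c\<in>H. \<Sum>u\<in>UA. block (\<lambda>b. c b * u)) + (\<Sum>y\<in>Y. \<Sum>u\<in>UB. block (\<lambda>b. y * u b))"
    using fin by (simp add: sum.Plus sum.cartesian_product case_prod_unfold)
  have P2: "(\<Sum>j\<in>UNIV \<times> UNIV \<times> H \<times> UC <+> Y \<times> UD. case_sum (\<lambda>(i, s, c, u). bell i s c u) (\<lambda>(y, u). y * u) j
        * star (case_sum (\<lambda>(i, s, c, u). bell i s c u) (\<lambda>(y, u). y * u) j))
    = (\<Sum>i\<in>UNIV. \<Sum>s\<in>UNIV. \<Sum>c\<in>H. \<Sum>u\<in>UC. bell i s c u * star (bell i s c u)) + (\<Sum>y\<in>Y. \<Sum>u\<in>UD. y * u * star (y * u))"
    using fin by (simp add: sum.Plus sum.cartesian_product case_prod_unfold)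
  have P3: "(\<Sum>i\<in>UNIV. \<Sum>s\<in>UNIV. \<Sum>c\<in>H. \<Sum>u\<in>UC. bell i s c u * star (bell i s c u))
    = (\<Sum>c\<in>H. \<Sum>u\<in>UC. \<Sum>i\<in>UNIV. \<Sum>s\<in>UNIV. bell i s c u * star (bell i s c u))"
    by (simp add: UNIV_bool sum.distrib)
  show "(\<Sum>i\<in>H \<times> UA <+> Y \<times> UB. block (case_sum (\<lambda>(c, u) b. c b * u) (\<lambda>(y, u) b. y * u b) i))
    + (\<Sum>j\<in>UNIV \<times> UNIV \<times> H \<times> UC <+> Y \<times> UD. case_sum (\<lambda>(i, s, c, u). bell i s c u) (\<lambda>(y, u). y * u) j
        * star (case_sum (\<lambda>(i, s, c, u). bell i s c u) (\<lambda>(y, u). y * u) j)) = one"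
  proof -
    have "one = (\<Sum>c\<in>H. block c) + (\<Sum>y\<in>Y. y * star y)" by (rule F.total[symmetric])
    also have "(\<Sum>c\<in>H. block c) = (\<Sum>c\<in>H. (\<Sum>u\<in>UA. block (\<lambda>b. c b * u)) + (\<Sum>u\<in>UC. \<Sum>i\<in>UNIV. \<Sum>s\<in>UNIV. bell i s c u * star (bell i s c u)))"
      by (intro sum.cong refl C[symmetric])
    also have "(\<Sum>y\<in>Y. y * star y) = (\<Sum>y\<in>Y. (\<Sum>u\<in>UB. block (\<lambda>b. y * u b)) + (\<Sum>u\<in>UD. y * u * star (y * u)))"
      by (intro sum.cong refl D[symmetric])
    finally show ?thesis unfolding P1 P2 P3 by (simp add: sum.distrib add_ac)
  qed
qed

lemma H'_cases [consumes 1, case_names H Y]: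
  assumes "d \<in> H'"
  obtains c u where "c \<in> H" "u \<in> UA" "d = (\<lambda>b. c b * u)" | y u where "y \<in> Y" "u \<in> UB" "d = (\<lambda>b. y * u b)"
  using assms unfolding H'_def by auto

lemma Y'_cases [consumes 1, case_names H Y]:
  assumes "d \<in> Y'"
  obtains i s c u where "c \<in> H" "u \<in> UC" "d = bell i s c u" | y u where "y \<in> Y" "u \<in> UD" "d = y * u"
  using assms unfolding Y'_def by auto

lemma H'_H: "c \<in> H \<Longrightarrow> u \<in> UA \<Longrightarrow> (\<lambda>b. c b * u) \<in> H'"
  unfolding H'_def by (force intro!: image_eqI[of _ _ "Inl (c, u)"])

lemma H'_Y: "y \<in> Y \<Longrightarrow> u \<in> UB \<Longrightarrow> (\<lambda>b. y * u b) \<in> H'"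
  unfolding H'_def by (force intro!: image_eqI[of _ _ "Inr (y, u)"])

lemma Y'_H: "c \<in> H \<Longrightarrow> u \<in> UC \<Longrightarrow> bell i s c u \<in> Y'"
  unfolding Y'_def by (force intro!: image_eqI[of _ _ "Inl (i, s, c, u)"])

lemma Y'_Y: "y \<in> Y \<Longrightarrow> u \<in> UD \<Longrightarrow> y * u \<in> Y'"
  unfolding Y'_def by (force intro!: image_eqI[of _ _ "Inr (y, u)"])

text \<open>Since Bell vectors arise from one of them by Pauli matrices on the first factor, this is
  the multiplication rule of the Pauli matrices; the sign comes from
  \<open>Z X = - X Z\<close>.\<close>

lemma pauli_bell: "c \<in> H \<Longrightarrow> c' \<in> H \<Longrightarrow> d \<in> H \<Longrightarrow> u \<in> UC \<Longrightarrow>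
    pauli i s c c' * bell i' s' d u = (if c' = d then (if s \<and> i' then -1 else 1) *\<^sub>C bell (i \<noteq> i') (s \<noteq> s') c u else 0)"
  by (cases i; cases s; cases i'; cases s')
    (simp_all add: bell_def pauli_def rules scaleR_right_distrib scaleR_right_diff_distrib)

lemma zero_mono: "0 \<in> N.mono" if "N.mono \<noteq> {}"
proof -
  from that obtain w where "w \<in> N.mono" by auto
  then show ?thesis
    by (cases rule: N.mono_cases) (use N.pauli_mono[of _ _ 0] N.Y_mono[of _ _ 0] in auto)
qed

lemma projs_mono: "p \<in> N.projs \<Longrightarrow> p \<in> N.mono"
proof -
  assume "p \<in> N.projs"
  then consider c where "c \<in> H'" "p = block c" | y where "y \<in> Y'" "p = y * star y" unfolding N.projs_def by auto
  then show ?thesis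
  proof cases
    case 1
    have "block c = pauli False False c c" by (simp add: block_def pauli_def UNIV_bool add.commute)
    then show ?thesis using 1 N.pauli_mono1 by simp
  qed (simp add: N.Y_mono1)
qed

lemma mono_scale: "w \<in> N.mono \<Longrightarrow> a *\<^sub>C w \<in> N.mono"
  by (cases rule: N.mono_cases, assumption) (auto simp: scaleC_scaleC N.pauli_mono N.Y_mono)

lemma mono_minus: "w \<in> N.mono \<Longrightarrow> - w \<in> N.mono"
  using mono_scale[of w "-1"] by simp

text \<open>The origin of all normalizers of the limit. Below a new pair coming from
  \<open>UA\<close> an old Pauli matrix is again one; on a Bell projection it becomes a multiple of
  a matrix unit between Bell vectors; on a new pair coming from \<open>UB\<close> an old matrix unit
  becomes the Pauli matrix with trivial shift and phase.\<close>

lemma mono_projs: assumes w: "w \<in> F.mono" and p: "p \<in> N.projs" shows "w * p \<in> N.mono"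
proof -
  have z: "0 \<in> N.mono" using zero_mono projs_mono[OF p] by auto
  from p consider (H) c u where "c \<in> H" "u \<in> UA" "p = block (\<lambda>b. c b * u)"
    | (Y) y u where "y \<in> Y" "u \<in> UB" "p = block (\<lambda>b. y * u b)"
    | (bell) i s c u where "c \<in> H" "u \<in> UC" "p = bell i s c u * star (bell i s c u)"
    | (Y2) y u where "y \<in> Y" "u \<in> UD" "p = (y * u) * star (y * u)"
    unfolding N.projs_def by (auto elim!: H'_cases Y'_cases)
  note p_cases = this
  from w show ?thesis
  proof (cases rule: F.mono_cases)
    case (pauli a i s c1 c2)
    have "pauli i s c1 c2 * p \<in> N.mono"
    proof (cases rule: p_cases)
      case (H c u)
      have "pauli i s c1 c2 * p = (if c = c2 then pauli i s (\<lambda>b. c1 b * u) (\<lambda>b. c2 b * u) else 0)"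
        using H pauli by (cases i; cases s) (auto simp: pauli_def star_simps rules)
      then show ?thesis using H pauli z by (simp add: N.pauli_mono1 H'_H)
    next
      case (Y y u)
      then have "pauli i s c1 c2 * p = 0"
        using pauli by (simp add: pauli_def star_simps rules)
      then show ?thesis using z by simp
    next
      case (bell i' s' c u)
      have "pauli i s c1 c2 * p = (pauli i s c1 c2 * bell i' s' c u) * star (bell i' s' c u)"
        by (simp only: bell mult.assoc)
      then show ?thesis using bell pauli z
        by (simp only: pauli_bell) (auto simp: scaleC_mult intro!: N.Y_mono1 N.Y_mono Y'_H mono_scale mono_minus)
    next
      case (Y2 y u)
      then have "pauli i s c1 c2 * p = 0"
        using pauli by (simp add: pauli_def star_simps rules)
      then show ?thesis using z by simp
    qed
    then show ?thesis using pauli by (simp add: scaleC_mult mono_scale)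
  next
    case (Y a y1 y2)
    have "(y1 * star y2) * p \<in> N.mono"
    proof (cases rule: p_cases)
      case (H c u)
      then have "(y1 * star y2) * p = 0" using Y by (simp add: star_simps rules)
      then show ?thesis using z by simp
    next
      case Y': (Y y u)
      have "(y1 * star y2) * p = (if y2 = y then pauli False False (\<lambda>b. y1 * u b) (\<lambda>b. y2 * u b) else 0)"
        using Y Y' by (simp add: pauli_def star_simps rules add_ac)
      then show ?thesis using Y Y' z by (simp add: N.pauli_mono1 H'_Y)
    next
      case (bell i' s' c u)
      then have "(y1 * star y2) * p = 0" using Y by (simp add: bell_def star_simps rules)
      then show ?thesis using z by simp
    next
      case (Y2 y u)
      have "(y1 * star y2) * p = (if y2 = y then (y1 * u) * star (y2 * u) else 0)"
        using Y Y2 by (simp add: star_simps rules)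
      then show ?thesis using Y Y2 z by (simp only: N.Y_mono1 Y'_Y if_True if_False simp_thms split: if_split)
    qed
    then show ?thesis using Y by (simp add: scaleC_mult mono_scale)
  qed
qed

lemma projs_projs: assumes w: "w \<in> F.projs" and p: "p \<in> N.projs" shows "w * p = 0 \<or> w * p = p"
proof -
  from p consider (H) c u where "c \<in> H" "u \<in> UA" "p = block (\<lambda>b. c b * u)"
    | (Y) y u where "y \<in> Y" "u \<in> UB" "p = block (\<lambda>b. y * u b)"
    | (bell) i s c u where "c \<in> H" "u \<in> UC" "p = bell i s c u * star (bell i s c u)"
    | (Y2) y u where "y \<in> Y" "u \<in> UD" "p = (y * u) * star (y * u)"
    unfolding N.projs_def by (auto elim!: H'_cases Y'_cases)
  note p_cases = this
  from w consider (H) c where "c \<in> H" "w = block c" | (Y) y where "y \<in> Y" "w = y * star y"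
    unfolding F.projs_def by auto
  then show ?thesis
  proof cases
    case wH: (H c1)
    show ?thesis
    proof (cases rule: p_cases)
      case (bell i s c u)
      have "block c1 * bell i s c u = (if c1 = c then bell i s c u else 0)"
        using wH bell by (cases s; cases i) (auto simp: bell_def rules)
      then show ?thesis unfolding bell wH(2) by (simp add: mult.assoc[symmetric])
    qed (use wH in \<open>auto simp: star_simps rules\<close>)
  next
    case wY: (Y y1)
    show ?thesis
    proof (cases rule: p_cases)
      case (bell i s c u)
      have "y1 * star y1 * bell i s c u = 0"
        using wY bell by (cases s; cases i) (auto simp: bell_def rules)
      then show ?thesis unfolding bell wY(2) by (simp add: mult.assoc[symmetric])
    qed (use wY in \<open>auto simp: star_simps rules\<close>)
  qed
qed

text \<open>
  The expectations are compatible because the vectors of the Bell basis induce the trace on the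
  first tensor factor of \<open>M\<^sub>2 \<otimes> M\<^sub>2\<close>.
\<close>

lemma T_refine: assumes "x \<in> F.alg" shows "N.T x = F.T x"
  using assms
proof (induction rule: F.alg_induct)
  case zero
  then show ?case using F.T_add[of 0 0] N.T_add[of 0 0] by simp
next
  case (add a x y)
  then show ?case by (simp add: F.T_add N.T_add F.T_scaleC N.T_scaleC)
next
  case (H c b c' b')
  show ?case
  proof (rule N.projs_eqI)
    fix p assume "p \<in> N.projs"
    then consider d where "d \<in> H'" "p = block d" | d where "d \<in> Y'" "p = d * star d" unfolding N.projs_def by auto
    then show "p * N.T (c b * star (c' b')) = p * F.T (c b * star (c' b'))"
    proof cases
      case 1
      from 1(1) show ?thesis
      proof (cases rule: H'_cases)
        case (H c1 u)
        show ?thesis unfolding 1(2) N.block_T[OF 1(1)] F.T_cols[OF \<open>c \<in> H\<close> \<open>c' \<in> H\<close>]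
          using H \<open>c \<in> H\<close> \<open>c' \<in> H\<close>
          by (cases b; cases b') (auto simp: F.blk_def star_simps rules scaleR_add_right)
      next
        case (Y y u)
        show ?thesis unfolding 1(2) N.block_T[OF 1(1)] F.T_cols[OF \<open>c \<in> H\<close> \<open>c' \<in> H\<close>]
          using Y \<open>c \<in> H\<close> \<open>c' \<in> H\<close>
          by (cases b; cases b') (auto simp: F.blk_def star_simps rules)
      qed
    next
      case 2
      from 2(1) show ?thesis
      proof (cases rule: Y'_cases)
        case (H i s c1 u)
        have "star d * (c b * star (c' b')) * d = (if c = c1 \<and> c' = c1 \<and> b = b' then (1/2) *\<^sub>R r' else 0)"
          using H \<open>c \<in> H\<close> \<open>c' \<in> H\<close>
          by (cases b; cases b'; cases i; cases s) (auto simp: bell_def star_simps rules)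
        then have "d * (star d * (c b * star (c' b')) * d) * star d = (if c = c1 \<and> c' = c1 \<and> b = b' then (1/2) *\<^sub>R (d * star d) else 0)"
          using 2(1) by (simp add: N.yr)
        moreover have "star d * block c = (if c = c1 then star d else 0)"
          using H \<open>c \<in> H\<close> by (cases i; cases s) (auto simp: bell_def star_simps rules scaleR_right_distrib scaleR_right_diff_distrib)
        then have "d * (star d * block c) = (if c = c1 then d * star d else 0)" by simp
        ultimately show ?thesis unfolding 2(2) N.yy_T[OF 2(1)] F.T_cols[OF \<open>c \<in> H\<close> \<open>c' \<in> H\<close>]
          by (auto simp: mult.assoc)
      next
        case (Y y u)
        show ?thesis unfolding 2(2) N.yy_T[OF 2(1)] F.T_cols[OF \<open>c \<in> H\<close> \<open>c' \<in> H\<close>]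
          using Y \<open>c \<in> H\<close> \<open>c' \<in> H\<close>
          by (cases b; cases b') (auto simp: star_simps rules)
      qed
    qed
  qed (simp_all add: N.one_T F.one_T)
next
  case (Y y1 y2)
  show ?case
  proof (rule N.projs_eqI)
    fix p assume "p \<in> N.projs"
    then consider d where "d \<in> H'" "p = block d" | d where "d \<in> Y'" "p = d * star d" unfolding N.projs_def by auto
    then show "p * N.T (y1 * star y2) = p * F.T (y1 * star y2)"
    proof cases
      case 1
      from 1(1) show ?thesis
        unfolding 1(2) N.block_T[OF 1(1)] F.T_Y[OF Y]
        by (cases rule: H'_cases) (use Y in \<open>auto simp: F.blk_def star_simps rules scaleR_add_right scaleR_2[symmetric]\<close>)
    next
      case 2
      from 2(1) show ?thesis
        unfolding 2(2) N.yy_T[OF 2(1)] F.T_Y[OF Y]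
        by (cases rule: Y'_cases) (use Y in \<open>auto simp: bell_def star_simps rules\<close>)
    qed
  qed (simp_all add: N.one_T F.one_T)
qed

text \<open>
  The part of \<open>x\<close> in a factor \<open>M\<^sub>2\<close> that has trace zero is removed by pinching with the Bell
  projections of the next stage, but its norm is already attained on the range of these projections.
  Hence an element that is almost fixed by the second pinching is almost diagonal.
\<close>

lemma off_diagonal:
  assumes x: "x \<in> F.alg" and UC: "UC \<noteq> {}" and le: "norm (N.pinch (F.pinch x) - F.pinch x) \<le> \<delta>"
  shows "norm (F.pinch x - F.T x) \<le> 8 * \<delta>"
proof (rule F.norm_le_projs)
  have \<delta>: "0 \<le> \<delta>" using le norm_ge_zero order.trans by blast
  then show "0 \<le> 8 * \<delta>" by simp
  show "one * (F.pinch x - F.T x) = F.pinch x - F.T x"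
    by (simp add: right_diff_distrib F.one_T F.one_pinch)
  fix p assume p: "p \<in> F.projs"
  show "p * (F.pinch x - F.T x) = (F.pinch x - F.T x) * p"
    using p by (simp add: algebra_simps F.proj_pinch F.T_comm)
  from p consider c where "c \<in> H" "p = block c" | y where "y \<in> Y" "p = y * star y" unfolding F.projs_def by auto
  then show "norm (p * (F.pinch x - F.T x)) \<le> 8 * \<delta>"
  proof cases
    case 2
    have "p * (F.pinch x - F.T x) = 0"
      unfolding right_diff_distrib F.proj_pinch(1)[OF p] unfolding 2 F.yy_T[OF 2(1)] by simp
    then show ?thesis using \<delta> by simp
  next
    case 1
    note c = 1(1)
    have "\<forall>b b'. \<exists>m. star (c b) * x * c b' = m *\<^sub>C q" using F.alg_coeff[OF x c c] by blast
    then obtain M where M: "\<And>b b'. star (c b) * x * c b' = M b b' *\<^sub>C q" by metis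
    \<comment> \<open>\<open>t\<close> is the normalized trace of the block of \<open>x\<close> at
      \<open>c\<close>, \<open>V\<close> the trace-zero rest of its matrix, and \<open>m\<close>
      that rest as an element of the algebra.\<close>
    define t where "t = (M False False + M True True) / 2"
    define V where "V b b' = M b b' - (if b = b' then t else 0)" for b b'
    define m where "m = (\<Sum>b\<in>UNIV. \<Sum>b'\<in>UNIV. V b b' *\<^sub>C (c b * star (c b')))"
    have s2: "complex_of_real (sqrt 2) * complex_of_real (sqrt 2) = 2"
      by (simp flip: of_real_mult)
    have tr: "V False False + V True True = 0" by (simp add: V_def t_def field_simps)
    have blk: "F.blk c x = t *\<^sub>C block c" unfolding t_def by (rule F.blk_alg[OF c M M])
    have "block c * x * block c = (\<Sum>b\<in>UNIV. \<Sum>b'\<in>UNIV. c b * (star (c b) * x * c b') * star (c b'))"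
      by (simp add: block_def UNIV_bool ring_distribs mult.assoc add_ac)
    also have "\<dots> = (\<Sum>b\<in>UNIV. \<Sum>b'\<in>UNIV. M b b' *\<^sub>C (c b * star (c b')))"
      unfolding M using c by (simp add: scaleC_mult F.cq)
    also have "\<dots> = m + t *\<^sub>C block c"
      by (simp add: m_def V_def block_def UNIV_bool complex_vector.scale_left_diff_distrib scaleC_add_right)
    finally have xm: "block c * x * block c = m + t *\<^sub>C block c" .
    have pm: "p * (F.pinch x - F.T x) = m"
      unfolding right_diff_distrib F.proj_pinch(1)[OF p] unfolding 1 F.block_T[OF c] xm blk by simp
    obtain u where u: "u \<in> UC" using UC by auto
    have mb: "norm (m * bell i s c u) \<le> \<delta>" for i s
    proof -
      define \<beta> where "\<beta> = bell i s c u"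
      have \<beta>Y: "\<beta> \<in> Y'" using Y'_H c u by (simp add: \<beta>_def)
      have c\<beta>: "block c * \<beta> = \<beta>"
        using c u by (cases i; cases s) (auto simp: \<beta>_def bell_def rules)
      have z: "F.pinch x * \<beta> = m * \<beta> + t *\<^sub>C \<beta>"
      proof -
        have "F.pinch x * \<beta> = (F.pinch x * block c) * \<beta>" by (simp only: mult.assoc c\<beta>)
        also have "F.pinch x * block c = m + t *\<^sub>C block c" using F.proj_pinch(2)[OF p] by (simp add: 1 xm)
        finally show ?thesis by (simp add: ring_distribs scaleC_mult c\<beta>)
      qed
      \<comment> \<open>The vector state of a Bell vector on the first factor is the trace, so it
        vanishes on \<open>m\<close>. Hence the second pinching removes \<open>m\<close> on the
        range of \<open>\<beta>\<close>, and \<open>norm (m * \<beta>)\<close> is bounded by the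
        defect \<open>\<delta>\<close>.\<close>
      have "star \<beta> * (m * \<beta>) = ((V False False + V True True) / 2) *\<^sub>C r'"
        using c u by (cases i; cases s) (simp_all add: \<beta>_def bell_def m_def star_simps rules scaleC_mult
          scaleC_of_real[symmetric] scaleC_scaleC scaleC_add_right scaleC_add_left add_divide_distrib s2)
      then have bmb: "star \<beta> * (m * \<beta>) = 0" by (simp add: tr)
      have bb: "\<beta> * star \<beta> \<in> N.projs" by (rule N.yy_projs[OF \<beta>Y])
      have "N.pinch (F.pinch x) * \<beta> = (N.pinch (F.pinch x) * (\<beta> * star \<beta>)) * \<beta>"
        using \<beta>Y by (simp add: mult.assoc N.YY N.yr)
      also have "\<dots> = \<beta> * (star \<beta> * (F.pinch x * \<beta>)) * (star \<beta> * \<beta>)"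
        unfolding N.proj_pinch(2)[OF bb] by (simp only: mult.assoc)
      also have "\<dots> = t *\<^sub>C \<beta>"
        using \<beta>Y by (simp add: z ring_distribs bmb scaleC_mult N.YY N.yr)
      finally have "(N.pinch (F.pinch x) - F.pinch x) * \<beta> = - (m * \<beta>)" by (simp add: z left_diff_distrib)
      then have "norm (m * \<beta>) \<le> norm (N.pinch (F.pinch x) - F.pinch x) * norm \<beta>"
        using norm_mult_ineq[of "N.pinch (F.pinch x) - F.pinch x" \<beta>] by simp
      then show ?thesis using le N.norm_y[OF \<beta>Y] by (simp add: \<beta>_def)
    qed
    \<comment> \<open>A product vector is a combination of two Bell vectors, whence
      \<open>2 * \<delta>\<close> for every entry; the four entries give the constant 8.\<close>
    have V: "cmod (V b i) \<le> 2 * \<delta>" for b i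
    proof -
      have "star (c b * u False) * (m * (c i * u False)) = V b i *\<^sub>C r'"
        using c u by (cases b; cases i) (simp_all add: m_def star_simps rules scaleC_mult)
      then have "cmod (V b i) = norm (star (c b * u False) * (m * (c i * u False)))"
        by (simp add: norm_scaleC projectionD(4)[OF QU.q])
      also have "\<dots> \<le> norm (m * (c i * u False))"
        using norm_mult_ineq[of "star (c b * u False)" "m * (c i * u False)"] norm_mult_ineq[of "c b" "u False"]
          F.norm_c[OF c] QU.norm_c[OF u] mult_right_mono[of "norm (c b * u False)" 1 "norm (m * (c i * u False))"] by simp
      also have "c i * u False = (1 / sqrt 2) *\<^sub>R (bell i False c u + bell i True c u)"
        by (simp add: bell_def algebra_simps scaleR_2[symmetric])
      also have "norm (m * \<dots>) = (1 / sqrt 2) * norm (m * bell i False c u + m * bell i True c u)"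
        by (simp add: ring_distribs)
      also have "\<dots> \<le> 1 * (\<delta> + \<delta>)"
        using norm_triangle_mono[OF mb mb, of i False i True] by (intro mult_mono) auto
      finally show ?thesis by simp
    qed
    have "norm (V b b' *\<^sub>C (c b * star (c b'))) \<le> 2 * \<delta>" for b b'
      using norm_mult_ineq[of "c b" "star (c b')"] F.norm_c[OF c] V[of b b'] mult_mono[OF V[of b b'], of "norm (c b * star (c b'))" 1] \<delta>
      by (simp add: norm_scaleC)
    from norm_triangle_mono[OF norm_triangle_mono[OF this this] norm_triangle_mono[OF this this]]
    have "norm m \<le> 8 * \<delta>" by (simp add: m_def UNIV_bool add_ac)
    then show ?thesis by (simp add: pm)
  qed
qed

end

section \<open>The Cartan subalgebra\<close>

lemma cstar_subalgebra_closure: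
  fixes S :: "nat \<Rightarrow> 'a::cstar_algebra set"
  assumes mono: "\<And>i. S i \<subseteq> S (Suc i)" and sub: "\<And>i. csubspace (S i)"
    and mult: "\<And>i x y. x \<in> S i \<Longrightarrow> y \<in> S i \<Longrightarrow> x * y \<in> S i" and st: "\<And>i x. x \<in> S i \<Longrightarrow> star x \<in> S i"
  shows "cstar_subalgebra (closure (\<Union>i. S i))"
proof -
  have le: "S i \<subseteq> S j" if "i \<le> j" for i j using lift_Suc_mono_le[of S, OF mono that] .
  define U where "U = (\<Union>i. S i)"
  have two: "\<exists>k. x \<in> S k \<and> y \<in> S k" if xy: "x \<in> U" "y \<in> U" for x y
  proof -
    obtain i j where "x \<in> S i" "y \<in> S j" using xy unfolding U_def by auto
    then show ?thesis using le[of i "max i j"] le[of j "max i j"] by (auto intro!: exI[of _ "max i j"])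
  qed
  have add: "x + y \<in> U" if xy: "x \<in> U" "y \<in> U" for x y
    using two[OF xy] complex_vector.subspace_add[OF sub] unfolding U_def by blast
  have mul: "x * y \<in> U" if xy: "x \<in> U" "y \<in> U" for x y
    using two[OF xy] mult unfolding U_def by blast
  have sc: "c *\<^sub>C x \<in> U" if "x \<in> U" for c x
    using that complex_vector.subspace_scale[OF sub] unfolding U_def by blast
  have sts: "star x \<in> U" if "x \<in> U" for x
    using that st unfolding U_def by blast
  have zero: "0 \<in> U" using complex_vector.subspace_0[OF sub[of 0]] unfolding U_def by blast
  show ?thesis
    unfolding cstar_subalgebra_def complex_vector.subspace_def U_def[symmetric]
  proof (intro conjI allI ballI)
    show "0 \<in> closure U" using zero closure_subset by blast
    fix x assume "x \<in> closure U"
    then obtain f where f: "\<And>n. f n \<in> U" "f \<longlonglongrightarrow> x" unfolding closure_sequential by blast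
    show "c *\<^sub>C x \<in> closure U" for c
      unfolding closure_sequential using f sc by (intro exI[of _ "\<lambda>n. c *\<^sub>C f n"]) (auto intro: tendsto_scaleC)
    show "star x \<in> closure U"
      unfolding closure_sequential using f sts by (intro exI[of _ "\<lambda>n. star (f n)"]) (auto intro: tendsto_star)
    fix y assume "y \<in> closure U"
    then obtain g where g: "\<And>n. g n \<in> U" "g \<longlonglongrightarrow> y" unfolding closure_sequential by blast
    show "x + y \<in> closure U"
      unfolding closure_sequential using f g add by (intro exI[of _ "\<lambda>n. f n + g n"]) (auto intro: tendsto_add)
    show "x * y \<in> closure U"
      unfolding closure_sequential using f g mul by (intro exI[of _ "\<lambda>n. f n * g n"]) (auto intro: tendsto_mult)
  qed simp
qed

text \<open>The sets \<open>UC j\<close> must be nonempty to supply the Bell vectors used for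
  maximal commutativity. Nonempty \<open>UA j\<close> and \<open>H 0\<close> keep the first summand
  present at all stages, which serves both faithfulness and the path on which extensions fail to be
  unique.\<close>

locale tower =
  fixes one :: "'a::cstar_algebra" and H :: "nat \<Rightarrow> (bool \<Rightarrow> 'a) set" and Y :: "nat \<Rightarrow> 'a set" and q r :: "nat \<Rightarrow> 'a"
    and UA UD :: "nat \<Rightarrow> 'a set" and UB UC :: "nat \<Rightarrow> (bool \<Rightarrow> 'a) set"
  assumes ref: "refinement one (H j) (Y j) (q j) (r j) (UA j) (UB j) (UC j) (UD j) (q (Suc j)) (r (Suc j))"
    and H_Suc: "H (Suc j) = refinement.H' (H j) (Y j) (UA j) (UB j)"
    and Y_Suc: "Y (Suc j) = refinement.Y' (H j) (Y j) (UC j) (UD j)"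
    and UC_ne: "UC j \<noteq> {}" and UA_ne: "UA j \<noteq> {}" and H_ne: "H 0 \<noteq> {}"
begin

abbreviation "P j \<equiv> frame.projs (H j) (Y j)"
abbreviation "W j \<equiv> frame.mono (H j) (Y j)"
abbreviation "F j \<equiv> frame.alg (H j) (Y j)"
abbreviation "D j \<equiv> frame.diag (H j) (Y j)"
abbreviation "T j \<equiv> frame.T (H j) (Y j)"
abbreviation "pinch j \<equiv> frame.pinch (H j) (Y j)"

lemma fr: "frame one (H j) (Y j) (q j) (r j)"
  using ref[of j] by (simp add: refinement_def)

lemmas ref_rules =
  refinement.mono_projs[OF ref, folded H_Suc Y_Suc] refinement.projs_projs[OF ref, folded H_Suc Y_Suc]
  refinement.T_refine[OF ref, folded H_Suc Y_Suc] refinement.off_diagonal[OF ref, folded H_Suc Y_Suc]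

definition A where "A = closure (\<Union>j. F j)"
definition B where "B = closure (\<Union>j. D j)"

lemma F_Suc: "F j \<subseteq> F (Suc j)"
proof -
  have "w \<in> F (Suc j)" if w: "w \<in> W j" for w
  proof -
    have "w = w * one" using frame.one_right[OF fr frame.mono_alg[OF fr w]] by simp
    also have "\<dots> = (\<Sum>p\<in>P (Suc j). w * p)"
      by (simp add: frame.total_projs[OF fr, of "Suc j", symmetric] sum_distrib_left)
    also have "\<dots> \<in> F (Suc j)"
      by (intro complex_vector.subspace_sum[OF frame.csubspace_alg[OF fr]] frame.mono_alg[OF fr] ref_rules(1) w)
    finally show ?thesis .
  qed
  then show ?thesis
    unfolding frame.alg_mono[OF fr, of j]
    by (intro complex_vector.span_minimal frame.csubspace_alg[OF fr]) auto
qed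

lemma F_le: "i \<le> j \<Longrightarrow> F i \<subseteq> F j"
  by (rule lift_Suc_mono_le[of F]) (rule F_Suc)

lemma one_left: "x \<in> D j \<Longrightarrow> one * x = x"
  using frame.one_left[OF fr frame.diag_alg[OF fr]] .

lemma proj_sum: "p \<in> P j \<Longrightarrow> p = (\<Sum>p'\<in>P (Suc j). if p * p' = p' then p' else 0)"
proof -
  assume p: "p \<in> P j"
  have "p = p * one" using frame.one_right[OF fr frame.diag_alg[OF fr frame.projs_diag[OF fr p]]] by simp
  also have "\<dots> = (\<Sum>p'\<in>P (Suc j). p * p')"
    by (simp add: frame.total_projs[OF fr, of "Suc j", symmetric] sum_distrib_left)
  also have "\<dots> = (\<Sum>p'\<in>P (Suc j). if p * p' = p' then p' else 0)"
    using ref_rules(2)[OF p] by (intro sum.cong) auto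
  finally show ?thesis .
qed

lemma D_Suc: "D j \<subseteq> D (Suc j)"
  unfolding frame.diag_def[OF fr, of j]
proof (intro complex_vector.span_minimal frame.csubspace_diag[OF fr] subsetI)
  fix p assume "p \<in> P j"
  from proj_sum[OF this] show "p \<in> D (Suc j)"
    by (rule ssubst) (intro complex_vector.subspace_sum[OF frame.csubspace_diag[OF fr]],
        auto simp: frame.projs_diag[OF fr] complex_vector.subspace_0[OF frame.csubspace_diag[OF fr]])
qed

lemma D_le: "i \<le> j \<Longrightarrow> D i \<subseteq> D j"
  by (rule lift_Suc_mono_le[of D]) (rule D_Suc)

lemma D_mult: assumes "x \<in> D j" "y \<in> D j" shows "x * y \<in> D j"
proof -
  obtain f g where "x = (\<Sum>p\<in>P j. f p *\<^sub>C p)" "y = (\<Sum>p\<in>P j. g p *\<^sub>C p)"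
    using assms unfolding frame.diag_iff[OF fr] by blast
  then have "x * y = (\<Sum>p\<in>P j. (f p * g p) *\<^sub>C p)" by (simp only: frame.sum_projs_mult[OF fr])
  then show ?thesis unfolding frame.diag_iff[OF fr] by (rule exI[of _ "\<lambda>p. f p * g p"])
qed

lemma D_star: assumes "x \<in> D j" shows "star x \<in> D j"
proof -
  obtain f where "x = (\<Sum>p\<in>P j. f p *\<^sub>C p)"
    using assms unfolding frame.diag_iff[OF fr] by blast
  then have "star x = (\<Sum>p\<in>P j. cnj (f p) *\<^sub>C p)" by (simp only: frame.star_sum_projs[OF fr])
  then show ?thesis unfolding frame.diag_iff[OF fr] by (rule exI[of _ "\<lambda>p. cnj (f p)"])
qed

lemma D_comm: "x \<in> D j \<Longrightarrow> y \<in> D j \<Longrightarrow> x * y = y * x"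
  unfolding frame.diag_iff[OF fr] by (auto simp: frame.sum_projs_mult[OF fr] mult.commute)

lemma cstar_A: "cstar_subalgebra A"
  unfolding A_def by (intro cstar_subalgebra_closure F_Suc frame.csubspace_alg[OF fr] frame.alg_mult[OF fr] frame.alg_star[OF fr])

lemma cstar_B: "cstar_subalgebra B"
  unfolding B_def by (intro cstar_subalgebra_closure D_Suc frame.csubspace_diag[OF fr] D_mult D_star)

lemma closed_B: "closed B" by (simp add: B_def)

lemma D_F: "D j \<subseteq> F j" using frame.diag_alg[OF fr] by auto

lemma D_B: "x \<in> D j \<Longrightarrow> x \<in> B" unfolding B_def by (rule subsetD[OF closure_subset]) (rule UN_I[OF UNIV_I])

lemma F_A: "x \<in> F j \<Longrightarrow> x \<in> A" unfolding A_def by (rule subsetD[OF closure_subset]) (rule UN_I[OF UNIV_I])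

lemma B_A: "B \<subseteq> A" unfolding A_def B_def by (intro closure_mono UN_mono D_F subset_refl)

lemma A_approx: assumes "x \<in> A" "0 < e" obtains j y where "y \<in> F j" "norm (x - y) < e"
  using assms unfolding A_def closure_approachable by (auto simp: dist_norm norm_minus_commute)

lemma B_approx: assumes "x \<in> B" "0 < e" obtains j y where "y \<in> D j" "norm (x - y) < e"
  using assms unfolding B_def closure_approachable by (auto simp: dist_norm norm_minus_commute)

lemma B_induct:
  assumes "b \<in> B" "closed {b. Q b}" "\<And>j b. b \<in> D j \<Longrightarrow> Q b" shows "Q b"
proof -
  have "B \<subseteq> {b. Q b}" unfolding B_def using assms(2,3) by (intro closure_minimal) auto
  then show ?thesis using assms(1) by auto
qed

lemma A_induct:
  assumes "b \<in> A" "closed {b. Q b}" "\<And>j b. b \<in> F j \<Longrightarrow> Q b" shows "Q b"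
proof -
  have "A \<subseteq> {b. Q b}" unfolding A_def using assms(2,3) by (intro closure_minimal) auto
  then show ?thesis using assms(1) by auto
qed

lemma abelian_B: assumes "x \<in> B" "y \<in> B" shows "x * y = y * x"
proof -
  have 1: "x * y = y * x" if x: "x \<in> D i" for x i
    using assms(2)
  proof (rule B_induct)
    show "closed {y. x * y = y * x}" by (intro closed_Collect_eq continuous_intros)
    fix j b assume "b \<in> D j"
    then show "x * b = b * x"
      using x D_le[of i "max i j"] D_le[of j "max i j"] by (intro D_comm[of _ "max i j"]) auto
  qed
  show ?thesis using assms(1)
    by (rule B_induct) (auto intro!: closed_Collect_eq continuous_intros 1)
qed

lemma one_D: "one \<in> D j"
  unfolding frame.total_projs[OF fr, of j, symmetric]
  by (intro complex_vector.subspace_sum[OF frame.csubspace_diag[OF fr]] frame.projs_diag[OF fr])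

lemma one_A: "x \<in> A \<Longrightarrow> one * x = x" "x \<in> A \<Longrightarrow> x * one = x"
  by (erule A_induct, intro closed_Collect_eq continuous_intros, erule frame.one_left[OF fr] frame.one_right[OF fr])+

lemma norm_one: "norm one \<le> 1"
proof -
  have "star one * one = one" using frame.star_one[OF fr] one_A(1)[OF F_A[OF frame.one_alg[OF fr, of 0]]] by simp
  then have "norm one = norm one * norm one" using cstar_identity[of one] by (simp add: power2_eq_square)
  then show ?thesis by (cases "norm one = 0") auto
qed

lemma approximate_unit: "contains_approximate_unit A B"
  unfolding contains_approximate_unit_def
proof (intro exI[of _ "principal {one}"] conjI ballI)
  have "star one * one = one" using frame.star_one[OF fr] one_A(1)[OF F_A[OF frame.one_alg[OF fr, of 0]]] by simp
  then have "positive_in B one" unfolding positive_in_def using D_B[OF one_D[of 0]] by metis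
  then show "\<forall>\<^sub>F u in principal {one}. u \<in> B \<and> positive_in B u \<and> norm u \<le> 1"
    using D_B[OF one_D[of 0]] norm_one by (simp add: eventually_principal)
  fix a assume "a \<in> A"
  then show "((\<lambda>u. u * a) \<longlongrightarrow> a) (principal {one})" "((\<lambda>u. a * u) \<longlongrightarrow> a) (principal {one})"
    using tendsto_principal_singleton[of "\<lambda>u. u * a" one] tendsto_principal_singleton[of "\<lambda>u. a * u" one]
    by (simp_all add: one_A)
qed (simp add: principal_eq_bot_iff)

section \<open>Normalizers and regularity\<close>

lemma proj_below: assumes "p \<in> P (Suc j)" obtains p0 where "p0 \<in> P j" "p0 * p = p"
proof -
  have "p = one * p" using one_left[OF frame.projs_diag[OF fr assms]] by simp
  also have "\<dots> = (\<Sum>p0\<in>P j. p0 * p)" by (simp add: frame.total_projs[OF fr, of j, symmetric] sum_distrib_right)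
  finally have "\<exists>p0\<in>P j. p0 * p \<noteq> 0"
    using projectionD(3)[OF frame.projection_projs[OF fr assms]] by (metis sum.neutral)
  then show ?thesis using ref_rules(2)[OF _ assms] that by blast
qed

text \<open>A projection of stage \<open>Suc n\<close> lies below some \<open>p0\<close> of stage
  \<open>n\<close>, so that \<open>w * p = (w * p0) * p\<close> and one more refinement applies to
  the monomial \<open>w * p0\<close>.\<close>

lemma W_P: assumes "w \<in> W j" "Suc j \<le> i" "p \<in> P i" shows "w * p \<in> W i"
  using assms(2,3)
proof (induction i arbitrary: p rule: dec_induct)
  case base
  then show ?case by (rule ref_rules(1)[OF assms(1)])
next
  case (step n)
  obtain p0 where p0: "p0 \<in> P n" "p0 * p = p" using proj_below[OF step.prems] .
  have "w * p0 * p \<in> W (Suc n)" by (intro ref_rules(1) step.IH p0 step.prems)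
  then show ?case by (simp add: mult.assoc p0)
qed

lemma W_conj_D: assumes w: "w \<in> W j" and "Suc j \<le> i" and d: "d \<in> D i" shows "w * d * star w \<in> D i"
proof -
  obtain f where f: "d = (\<Sum>p\<in>P i. f p *\<^sub>C p)" using d unfolding frame.diag_iff[OF fr] by blast
  have "w * p * star w \<in> D i" if p: "p \<in> P i" for p
  proof -
    have "w * p * star w = (w * p) * star (w * p)"
      using projectionD(1,2)[OF frame.projection_projs[OF fr p]] by (simp add: star_mult mult.assoc[of _ p p, symmetric] mult.assoc)
       (simp add: mult.assoc[symmetric])
    then show ?thesis
      using frame.mono_square[OF fr W_P[OF w assms(2) p]] frame.csubspace_diag[OF fr] frame.projs_diag[OF fr]
      by (metis complex_vector.subspace_scale)
  qed
  then show ?thesis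
    by (auto simp: f sum_distrib_left sum_distrib_right scaleC_mult intro!: complex_vector.subspace_sum[OF frame.csubspace_diag[OF fr]]
        complex_vector.subspace_scale[OF frame.csubspace_diag[OF fr]])
qed

lemma W_conj_B: assumes w: "w \<in> W j" and b: "b \<in> B" shows "w * b * star w \<in> B"
  using b
proof (rule B_induct)
  show "closed {b. w * b * star w \<in> B}"
    using closed_B by (intro closed_vimage[of B "\<lambda>b. w * b * star w", unfolded vimage_def] continuous_intros)
  fix i b assume "b \<in> D i"
  then show "w * b * star w \<in> B"
    using W_conj_D[OF w, of "max i (Suc j)" b] D_le[of i "max i (Suc j)"] D_B by auto
qed

lemma regular: "regular_in A B"
  unfolding regular_in_def
proof (rule antisym)
  have N: "normalizers A B \<subseteq> A" by (auto simp: normalizers_def)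
  then show "cstar_subalgebra hull (normalizers A B) \<subseteq> A" by (rule hull_minimal) (rule cstar_A)
  show "A \<subseteq> cstar_subalgebra hull (normalizers A B)"
    unfolding hull_def
  proof (rule Inter_greatest)
    fix S assume "S \<in> {t. cstar_subalgebra t \<and> normalizers A B \<subseteq> t}"
    then have S: "cstar_subalgebra S" "normalizers A B \<subseteq> S" by auto
    have "W j \<subseteq> S" for j
    proof
      fix w assume w: "w \<in> W j"
      have "w \<in> normalizers A B"
        using W_conj_B[OF w] W_conj_B[OF frame.star_mono[OF fr w]] F_A[OF frame.mono_alg[OF fr w]]
        by (auto simp: normalizers_def star_star)
      then show "w \<in> S" using S(2) by blast
    qed
    then have "F j \<subseteq> S" for j
      unfolding frame.alg_mono[OF fr] using S(1) by (intro complex_vector.span_minimal) (auto simp: cstar_subalgebra_def)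
    then show "A \<subseteq> S" unfolding A_def using S(1) by (intro closure_minimal) (auto simp: cstar_subalgebra_def)
  qed
qed

text \<open>An element commuting with \<open>B\<close> is fixed by the pinchings of all stages. An
  approximant from stage \<open>j\<close> is then almost fixed by the pinchings of stages
  \<open>j\<close> and \<open>Suc j\<close>, and \<open>off_diagonal\<close> puts it close to
  \<open>D j\<close>.\<close>

lemma commutant:
  assumes x: "x \<in> A" and comm: "\<And>b. b \<in> B \<Longrightarrow> b * x = x * b" shows "x \<in> B"
proof -
  have "\<exists>y\<in>(\<Union>j. D j). dist y x < e" if e: "e > 0" for e :: real
  proof -
    \<comment> \<open>The total error is \<open>17 * d\<close>: one \<open>d\<close> from the first
      pinching, and \<open>8 * (2 * d)\<close> from \<open>off_diagonal\<close>.\<close>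
    define d where "d = e / 20"
    have d: "d > 0" using e by (simp add: d_def)
    obtain j y where y: "y \<in> F j" "norm (x - y) < d" using A_approx[OF x d] .
    have fix_x: "pinch i x = x" for i
      by (rule frame.pinch_fix[OF fr one_A(1)[OF x]]) (rule comm[OF D_B[OF frame.projs_diag[OF fr]]])
    let ?z = "pinch j y"
    have zx: "norm (x - ?z) \<le> d"
      using frame.norm_pinch[OF fr, of j "x - y"] y(2) by (simp add: frame.pinch_diff[OF fr] fix_x)
    have "norm (x - pinch (Suc j) ?z) \<le> d"
      using frame.norm_pinch[OF fr, of "Suc j" "x - ?z"] zx by (simp add: frame.pinch_diff[OF fr] fix_x)
    then have "norm (pinch (Suc j) ?z - ?z) \<le> 2 * d"
      using norm_triangle_sub[of "x - ?z" "x - pinch (Suc j) ?z"] zx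
        norm_triangle_ineq4[of "x - ?z" "x - pinch (Suc j) ?z"] by (simp add: algebra_simps)
    from ref_rules(4)[OF y(1) UC_ne this] have "norm (?z - T j y) \<le> 16 * d" by simp
    then have "norm (x - T j y) \<le> 17 * d"
      using zx norm_triangle_ineq[of "x - ?z" "?z - T j y"] by simp
    then have "norm (x - T j y) < e" using e by (simp add: d_def)
    moreover have "T j y \<in> D j" by (rule frame.T_alg[OF fr y(1)])
    ultimately show ?thesis unfolding dist_norm norm_minus_commute[of _ x] by blast
  qed
  then show ?thesis unfolding B_def closure_approachable by blast
qed

lemma masa: "maximal_abelian A B"
  unfolding maximal_abelian_def abelian_def
  using cstar_B B_A abelian_B commutant by blast

section \<open>The conditional expectation as a limit\<close>

lemma T_stable: assumes "x \<in> F j" "j \<le> i" shows "T i x = T j x"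
  using assms(2)
proof (induction i rule: dec_induct)
  case (step n)
  have "x \<in> F n" using assms(1) F_le[OF step.hyps(1)] by auto
  then show ?case using ref_rules(3) step.IH by simp
qed simp

lemma T_convergent: assumes x: "x \<in> A" shows "convergent (\<lambda>i. T i x)"
  unfolding Cauchy_convergent_iff[symmetric]
proof (rule CauchyI)
  fix e :: real assume e: "0 < e"
  obtain j y where y: "y \<in> F j" "norm (x - y) < e / 2" using A_approx[OF x half_gt_zero[OF e]] .
  have *: "norm (T i x - T j y) < e / 2" if "j \<le> i" for i
    using frame.norm_T[OF fr, of i "x - y"] T_stable[OF y(1) that] y(2) by (simp add: frame.T_diff[OF fr])
  show "\<exists>M. \<forall>m\<ge>M. \<forall>n\<ge>M. norm (T m x - T n x) < e"
  proof (intro exI[of _ j] allI impI)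
    fix m n assume mn: "j \<le> m" "j \<le> n"
    show "norm (T m x - T n x) < e"
      using norm_diff_triangle_less[OF *[OF mn(1)], of "T n x" "e / 2"] *[OF mn(2)] by (simp add: norm_minus_commute)
  qed
qed

definition E where "E x = lim (\<lambda>i. T i x)"

lemma E_lim: "x \<in> A \<Longrightarrow> (\<lambda>i. T i x) \<longlonglongrightarrow> E x"
  using T_convergent unfolding E_def by (simp add: convergent_LIMSEQ_iff)

lemma E_eqI:
  assumes "x \<in> A" and eq: "\<And>i. j \<le> i \<Longrightarrow> T i x = f i" and "f \<longlonglongrightarrow> z" shows "E x = z"
proof -
  have "\<forall>\<^sub>F i in sequentially. f i = T i x" by (rule eventually_sequentiallyI[of j]) (simp add: eq)
  then have "(\<lambda>i. T i x) \<longlonglongrightarrow> z" by (rule Lim_transform_eventually[OF assms(3)])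
  then show ?thesis using LIMSEQ_unique E_lim[OF assms(1)] by blast
qed

lemma E_F: "x \<in> F j \<Longrightarrow> E x = T j x"
  by (rule E_eqI[OF F_A, of _ _ j "\<lambda>_. T j x"]) (auto intro: T_stable)

lemma E_D: "d \<in> D j \<Longrightarrow> E d = d"
  using E_F[of d j] D_F frame.T_diag[OF fr] by fastforce

lemma A_closed: "x \<in> A \<Longrightarrow> y \<in> A \<Longrightarrow> x + y \<in> A" "x \<in> A \<Longrightarrow> c *\<^sub>C x \<in> A" "x \<in> A \<Longrightarrow> y \<in> A \<Longrightarrow> x * y \<in> A"
    "x \<in> A \<Longrightarrow> star x \<in> A" "x \<in> A \<Longrightarrow> y \<in> A \<Longrightarrow> x - y \<in> A"
  using cstar_A complex_vector.subspace_add complex_vector.subspace_scale complex_vector.subspace_diff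
  unfolding cstar_subalgebra_def by blast+

lemma E_add: "x \<in> A \<Longrightarrow> y \<in> A \<Longrightarrow> E (x + y) = E x + E y"
  by (rule E_eqI[of _ 0 "\<lambda>i. T i x + T i y"]) (auto simp: A_closed frame.T_add[OF fr] intro!: tendsto_add E_lim)

lemma E_scaleC: "x \<in> A \<Longrightarrow> E (c *\<^sub>C x) = c *\<^sub>C E x"
  by (rule E_eqI[of _ 0 "\<lambda>i. c *\<^sub>C T i x"]) (auto simp: A_closed frame.T_scaleC[OF fr] intro!: tendsto_scaleC E_lim)

lemma E_diff: "x \<in> A \<Longrightarrow> y \<in> A \<Longrightarrow> E (x - y) = E x - E y"
  by (rule E_eqI[of _ 0 "\<lambda>i. T i x - T i y"]) (auto simp: A_closed frame.T_diff[OF fr] intro!: tendsto_diff E_lim)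

lemma norm_E: "x \<in> A \<Longrightarrow> norm (E x) \<le> norm x"
  by (rule LIMSEQ_le_const2[OF tendsto_norm[OF E_lim]]) (auto intro: frame.norm_T[OF fr])

lemma E_cont: assumes "\<And>n. y n \<in> A" "x \<in> A" "y \<longlonglongrightarrow> x" shows "(\<lambda>n. E (y n)) \<longlonglongrightarrow> E x"
proof (rule metric_tendsto_imp_tendsto[OF assms(3)])
  show "\<forall>\<^sub>F n in sequentially. dist (E (y n)) (E x) \<le> dist (y n) x"
    using norm_E[OF A_closed(5)[OF assms(1,2)]] by (simp add: dist_norm E_diff assms(1,2))
qed

lemma A_seq: assumes "x \<in> A" obtains y j where "\<forall>n. y n \<in> F (j n)" "y \<longlonglongrightarrow> x"
proof -
  obtain y where "\<forall>n. y n \<in> (\<Union>j. F j)" "y \<longlonglongrightarrow> x" using assms unfolding A_def closure_sequential by blast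
  moreover from this(1) have "\<exists>j. \<forall>n. y n \<in> F (j n)" by (intro choice) auto
  ultimately show ?thesis using that by blast
qed

lemma B_seq: assumes "x \<in> B" obtains y j where "\<forall>n. y n \<in> D (j n)" "y \<longlonglongrightarrow> x"
proof -
  obtain y where "\<forall>n. y n \<in> (\<Union>j. D j)" "y \<longlonglongrightarrow> x" using assms unfolding B_def closure_sequential by blast
  moreover from this(1) have "\<exists>j. \<forall>n. y n \<in> D (j n)" by (intro choice) auto
  ultimately show ?thesis using that by blast
qed

lemma B_in_A: "x \<in> B \<Longrightarrow> x \<in> A" using B_A by blast

lemma E_B: assumes "x \<in> A" shows "E x \<in> B"
proof -
  obtain y j where y: "\<forall>n. y n \<in> F (j n)" "y \<longlonglongrightarrow> x" using A_seq[OF assms] .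
  note y = y(1)[rule_format] y(2)
  have "E (y n) \<in> B" for n using D_B[OF frame.T_alg[OF fr y(1)]] E_F[OF y(1)] by simp
  then show ?thesis using closed_sequentially[OF closed_B _ E_cont[OF F_A[OF y(1)] assms y(2)]] by blast
qed

lemma E_id: assumes "b \<in> B" shows "E b = b"
proof -
  obtain y j where y: "\<forall>n. y n \<in> D (j n)" "y \<longlonglongrightarrow> b" using B_seq[OF assms] .
  note y = y(1)[rule_format] y(2)
  have "(\<lambda>n. E (y n)) \<longlonglongrightarrow> E b" by (rule E_cont[OF B_in_A[OF D_B[OF y(1)]] B_in_A[OF assms] y(2)])
  then have "y \<longlonglongrightarrow> E b" using E_D[OF y(1)] by simp
  then show ?thesis using y(2) LIMSEQ_unique by blast
qed

lemma E_left: assumes "b \<in> B" "x \<in> A" shows "E (b * x) = b * E x"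
proof -
  have 1: "E (d * x) = d * E x" if "d \<in> D j" for d j
    by (rule E_eqI[of _ j "\<lambda>i. d * T i x"])
      (use that D_le[of j] assms(2) in \<open>auto simp: A_closed B_in_A[OF D_B] intro!: frame.T_left[OF fr] tendsto_mult E_lim\<close>)
  obtain y j where y: "\<forall>n. y n \<in> D (j n)" "y \<longlonglongrightarrow> b" using B_seq[OF assms(1)] .
  note y = y(1)[rule_format] y(2)
  have "(\<lambda>n. E (y n * x)) \<longlonglongrightarrow> E (b * x)"
    by (rule E_cont[OF A_closed(3)[OF B_in_A[OF D_B[OF y(1)]] assms(2)] A_closed(3)[OF B_in_A[OF assms(1)] assms(2)]
          tendsto_mult[OF y(2) tendsto_const]])
  moreover have "(\<lambda>n. E (y n * x)) \<longlonglongrightarrow> b * E x"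
    unfolding 1[OF y(1)] by (intro tendsto_mult y(2) tendsto_const)
  ultimately show ?thesis using LIMSEQ_unique by blast
qed

lemma E_right: assumes "b \<in> B" "x \<in> A" shows "E (x * b) = E x * b"
proof -
  have 1: "E (x * d) = E x * d" if "d \<in> D j" for d j
    by (rule E_eqI[of _ j "\<lambda>i. T i x * d"])
      (use that D_le[of j] assms(2) in \<open>auto simp: A_closed B_in_A[OF D_B] intro!: frame.T_right[OF fr] tendsto_mult E_lim\<close>)
  obtain y j where y: "\<forall>n. y n \<in> D (j n)" "y \<longlonglongrightarrow> b" using B_seq[OF assms(1)] .
  note y = y(1)[rule_format] y(2)
  have "(\<lambda>n. E (x * y n)) \<longlonglongrightarrow> E (x * b)"
    by (rule E_cont[OF A_closed(3)[OF assms(2) B_in_A[OF D_B[OF y(1)]]] A_closed(3)[OF assms(2) B_in_A[OF assms(1)]]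
          tendsto_mult[OF tendsto_const y(2)]])
  moreover have "(\<lambda>n. E (x * y n)) \<longlonglongrightarrow> E x * b"
    unfolding 1[OF y(1)] by (intro tendsto_mult y(2) tendsto_const)
  ultimately show ?thesis using LIMSEQ_unique by blast
qed

section \<open>Positive diagonal elements and their square roots\<close>

definition pos where
  "pos j = {d. \<exists>g. (\<forall>p\<in>P j. 0 \<le> g p) \<and> d = (\<Sum>p\<in>P j. complex_of_real (g p) *\<^sub>C p)}"

lemma pos_Suc: "pos j \<subseteq> pos (Suc j)"
proof
  fix d assume "d \<in> pos j"
  then obtain g where g: "\<forall>p\<in>P j. 0 \<le> g p" "d = (\<Sum>p\<in>P j. complex_of_real (g p) *\<^sub>C p)" unfolding pos_def by blast
  have "d = (\<Sum>p\<in>P j. \<Sum>p'\<in>P (Suc j). (if p * p' = p' then complex_of_real (g p) else 0) *\<^sub>C p')"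
    unfolding g(2)
  proof (rule sum.cong[OF refl])
    fix p assume p: "p \<in> P j"
    show "complex_of_real (g p) *\<^sub>C p = (\<Sum>p'\<in>P (Suc j). (if p * p' = p' then complex_of_real (g p) else 0) *\<^sub>C p')"
      by (subst proj_sum[OF p]) (auto simp: complex_vector.scale_sum_right intro!: sum.cong)
  qed
  also have "\<dots> = (\<Sum>p'\<in>P (Suc j). \<Sum>p\<in>P j. (if p * p' = p' then complex_of_real (g p) else 0) *\<^sub>C p')" by (rule sum.swap)
  also have "\<dots> = (\<Sum>p'\<in>P (Suc j). complex_of_real (\<Sum>p\<in>P j. if p * p' = p' then g p else 0) *\<^sub>C p')"
    by (auto simp: complex_vector.scale_sum_left[symmetric] of_real_sum intro!: sum.cong arg_cong[of _ _ "\<lambda>x. x *\<^sub>C _"])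
  finally show "d \<in> pos (Suc j)"
    unfolding pos_def using g(1) by (auto intro!: exI[of _ "\<lambda>p'. \<Sum>p\<in>P j. if p * p' = p' then g p else 0"] sum_nonneg)
qed

lemma pos_le: "i \<le> j \<Longrightarrow> pos i \<subseteq> pos j"
  by (rule lift_Suc_mono_le[of pos]) (rule pos_Suc)

lemma pos_D: "d \<in> pos j \<Longrightarrow> d \<in> D j"
  unfolding pos_def frame.diag_iff[OF fr] by (auto intro: exI[of _ "\<lambda>p. complex_of_real (_ p)"])

lemma pos_star: "d \<in> pos j \<Longrightarrow> star d = d"
  unfolding pos_def by (auto simp: frame.star_sum_projs[OF fr])

text \<open>Makes the square roots of a convergent sequence of positive diagonal elements converge.\<close>

lemma pos_diff:
  assumes "a \<in> pos j" "b \<in> pos j" shows "(norm (a - b))\<^sup>2 \<le> norm (a * a - b * b)"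
proof -
  obtain g where g: "\<forall>p\<in>P j. 0 \<le> g p" "a = (\<Sum>p\<in>P j. complex_of_real (g p) *\<^sub>C p)" using assms(1) unfolding pos_def by blast
  obtain h where h: "\<forall>p\<in>P j. 0 \<le> h p" "b = (\<Sum>p\<in>P j. complex_of_real (h p) *\<^sub>C p)" using assms(2) unfolding pos_def by blast
  have 1: "a - b = (\<Sum>p\<in>P j. complex_of_real (g p - h p) *\<^sub>C p)"
    unfolding g h by (simp add: sum_subtractf complex_vector.scale_left_diff_distrib)
  have 2: "a * a - b * b = (\<Sum>p\<in>P j. complex_of_real (g p * g p - h p * h p) *\<^sub>C p)"
    unfolding g h frame.sum_projs_mult[OF fr] by (simp add: sum_subtractf complex_vector.scale_left_diff_distrib)
  have "norm (a - b) \<le> sqrt (norm (a * a - b * b))"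
    unfolding 1
  proof (rule frame.norm_sum_projs[OF fr])
    fix p assume p: "p \<in> P j"
    have "(g p - h p)\<^sup>2 \<le> \<bar>g p * g p - h p * h p\<bar>"
    proof -
      have "\<bar>g p - h p\<bar> * \<bar>g p - h p\<bar> \<le> \<bar>g p - h p\<bar> * \<bar>g p + h p\<bar>"
        using g(1) h(1) p by (intro mult_left_mono) (auto simp: abs_le_iff)
      then show ?thesis by (simp add: power2_eq_square abs_mult[symmetric] algebra_simps)
    qed
    also have "\<dots> \<le> norm (a * a - b * b)"
      using frame.coeff_le_norm[OF fr p, of "\<lambda>p. complex_of_real (g p * g p - h p * h p)"] unfolding 2 norm_of_real .
    finally show "cmod (complex_of_real (g p - h p)) \<le> sqrt (norm (a * a - b * b))"
      using real_le_rsqrt[of "\<bar>g p - h p\<bar>"] unfolding norm_of_real by simp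
  qed simp
  then show ?thesis by (metis norm_ge_zero power_mono real_sqrt_pow2)
qed

lemma square_root: assumes "y \<in> F j" shows "\<exists>s\<in>pos j. s * s = E (star y * y)"
proof -
  obtain g where g: "\<forall>p\<in>P j. 0 \<le> g p" "T j (star y * y) = (\<Sum>p\<in>P j. complex_of_real (g p) *\<^sub>C p)"
    using frame.T_square[OF fr assms] by blast
  define s where "s = (\<Sum>p\<in>P j. complex_of_real (sqrt (g p)) *\<^sub>C p)"
  have "s \<in> pos j" unfolding pos_def s_def using g(1) by (auto intro!: exI[of _ "\<lambda>p. sqrt (g p)"])
  moreover have "s * s = T j (star y * y)"
    unfolding s_def frame.sum_projs_mult[OF fr] g using g(1)
    by (intro sum.cong refl) (simp flip: of_real_mult)
  moreover have "star y * y \<in> F j" by (intro frame.alg_mult[OF fr] frame.alg_star[OF fr] assms)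
  ultimately show ?thesis using E_F by auto
qed

text \<open>\<open>positive_in B\<close> asks for a factorization inside \<open>B\<close>. It is
  obtained as the limit of the square roots belonging to approximants of \<open>y\<close>, which
  form a Cauchy sequence by \<open>pos_diff\<close>.\<close>

lemma E_positive: assumes "positive_in A x" shows "positive_in B (E x)"
proof -
  obtain y where y: "y \<in> A" "x = star y * y" using assms unfolding positive_in_def by blast
  obtain z j where z: "\<forall>n. z n \<in> F (j n)" "z \<longlonglongrightarrow> y" using A_seq[OF y(1)] .
  note z = z(1)[rule_format] z(2)
  have "\<forall>n. \<exists>s\<in>pos (j n). s * s = E (star (z n) * z n)" using square_root[OF z(1)] by blast
  then obtain s where s: "\<And>n. s n \<in> pos (j n)" "\<And>n. s n * s n = E (star (z n) * z n)" by metis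
  have lim: "(\<lambda>n. s n * s n) \<longlonglongrightarrow> E x"
    unfolding s(2) y(2)
    by (rule E_cont) (auto intro!: A_closed F_A[OF z(1)] y(1) tendsto_mult tendsto_star z(2))
  have "Cauchy s"
  proof (rule CauchyI)
    fix e :: real assume e: "0 < e"
    obtain M where M: "\<And>m n. m \<ge> M \<Longrightarrow> n \<ge> M \<Longrightarrow> norm (s m * s m - s n * s n) < e\<^sup>2"
      using CauchyD[OF LIMSEQ_imp_Cauchy[OF lim], of "e\<^sup>2"] e by auto
    have "norm (s m - s n) < e" if "m \<ge> M" "n \<ge> M" for m n
    proof -
      have "(norm (s m - s n))\<^sup>2 \<le> norm (s m * s m - s n * s n)"
        using s(1)[of m] s(1)[of n] pos_le[of "j m" "max (j m) (j n)"] pos_le[of "j n" "max (j m) (j n)"]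
        by (intro pos_diff[of _ "max (j m) (j n)"]) auto
      then have "(norm (s m - s n))\<^sup>2 < e\<^sup>2" using M[OF that] by simp
      then show ?thesis using e by (simp add: power2_less_imp_less)
    qed
    then show "\<exists>M. \<forall>m\<ge>M. \<forall>n\<ge>M. norm (s m - s n) < e" by blast
  qed
  then obtain t where t: "s \<longlonglongrightarrow> t" using Cauchy_convergent_iff convergent_def by blast
  have "t \<in> B" using closed_sequentially[OF closed_B _ t] D_B[OF pos_D[OF s(1)]] by blast
  moreover have "star t = t"
    using LIMSEQ_unique[OF tendsto_star[OF t]] t pos_star[OF s(1)] by simp
  moreover have "t * t = E x" using LIMSEQ_unique[OF tendsto_mult[OF t t] lim] .
  ultimately show ?thesis unfolding positive_in_def by metis
qed

text \<open>At a later stage \<open>w\<close> need not be a monomial, but each \<open>w * p\<close>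
  is. This gives the equivariance of \<open>T i\<close> only after pinching; in the limit the
  pinching has no effect, because it is contractive and \<open>star w * E y * w\<close> already lies
  in the commutative algebra \<open>B\<close>.\<close>

lemma E_conj: assumes w: "w \<in> W j" and y: "y \<in> A" shows "E (star w * y * w) = star w * E y * w"
proof -
  have wA: "w \<in> A" by (rule F_A[OF frame.mono_alg[OF fr w]])
  have eq: "T i (star w * y * w) = pinch i (star w * T i y * w)" if "Suc j \<le> i" for i
  proof -
    have "T i (star w * y * w) = one * T i (star w * y * w)" by (simp add: frame.one_T[OF fr])
    also have "\<dots> = (\<Sum>p\<in>P i. p * T i (star w * y * w))"
      by (simp add: frame.total_projs[OF fr, of i, symmetric] sum_distrib_right)
    also have "\<dots> = (\<Sum>p\<in>P i. p * (star w * T i y * w) * p)"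
    proof (intro sum.cong refl)
      fix p assume p: "p \<in> P i"
      note pr = projectionD(1,2)[OF frame.projection_projs[OF fr p]]
      have "p * T i (star w * y * w) = p * p * T i (star w * y * w)" by (simp only: pr)
      also have "\<dots> = p * T i (star w * y * w) * p" by (subst mult.assoc, subst frame.T_comm[OF fr p], rule mult.assoc[symmetric])
      also have "\<dots> = T i (p * (star w * y * w) * p)"
        by (simp only: frame.T_proj_left[OF fr p] frame.T_proj_right[OF fr p])
      also have "p * (star w * y * w) * p = star (w * p) * y * (w * p)"
        by (simp only: star_mult pr mult.assoc)
      also have "T i \<dots> = star (w * p) * T i y * (w * p)"
        by (rule frame.T_mono[OF fr W_P[OF w that p]])
      also have "\<dots> = p * (star w * T i y * w) * p" by (simp only: star_mult pr mult.assoc)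
      finally show "p * T i (star w * y * w) = p * (star w * T i y * w) * p" .
    qed
    finally show ?thesis by (simp add: frame.pinch_def[OF fr])
  qed
  have B: "star w * E y * w \<in> B"
    using W_conj_B[OF frame.star_mono[OF fr w] E_B[OF y]] by (simp add: star_star)
  have fixB: "pinch i (star w * E y * w) = star w * E y * w" for i
    by (rule frame.pinch_fix[OF fr one_A(1)[OF B_in_A[OF B]]]) (rule abelian_B[OF D_B[OF frame.projs_diag[OF fr]] B])
  show ?thesis
  proof (rule E_eqI[of _ "Suc j" "\<lambda>i. pinch i (star w * T i y * w)"])
    show "star w * y * w \<in> A" by (intro A_closed wA y)
    have "(\<lambda>i. star w * T i y * w) \<longlonglongrightarrow> star w * E y * w" by (intro tendsto_mult tendsto_const E_lim y)
    then show "(\<lambda>i. pinch i (star w * T i y * w)) \<longlonglongrightarrow> star w * E y * w"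
    proof (rule metric_tendsto_imp_tendsto)
      show "\<forall>\<^sub>F i in sequentially. dist (pinch i (star w * T i y * w)) (star w * E y * w)
          \<le> dist (star w * T i y * w) (star w * E y * w)"
      proof (rule always_eventually, rule allI)
        fix i
        have "norm (pinch i (star w * T i y * w) - pinch i (star w * E y * w)) \<le> norm (star w * T i y * w - star w * E y * w)"
          unfolding frame.pinch_diff[OF fr, symmetric] by (rule frame.norm_pinch[OF fr])
        then show "dist (pinch i (star w * T i y * w)) (star w * E y * w) \<le> dist (star w * T i y * w) (star w * E y * w)"
          unfolding fixB dist_norm .
      qed
    qed
  qed (rule eq)
qed

text \<open>
  By this estimate the left kernel of \<open>E\<close> is closed under addition; with \<open>E_conj\<close> it is a right
  ideal, so that an element of it can be compressed to a single column.
\<close>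

lemma E_square_add:
  assumes "x \<in> A" "z \<in> A"
  shows "norm (E (star (x + z) * (x + z))) \<le> 2 * norm (E (star x * x)) + 2 * norm (E (star z * z))"
proof -
  obtain f i where f: "\<forall>n. f n \<in> F (i n)" "f \<longlonglongrightarrow> x" using A_seq[OF assms(1)] .
  note f = f(1)[rule_format] f(2)
  obtain g j where g: "\<forall>n. g n \<in> F (j n)" "g \<longlonglongrightarrow> z" using A_seq[OF assms(2)] .
  note g = g(1)[rule_format] g(2)
  have le: "norm (E (star (f n + g n) * (f n + g n))) \<le> 2 * norm (E (star (f n) * f n)) + 2 * norm (E (star (g n) * g n))" for n
  proof -
    define k where "k = max (i n) (j n)"
    have fg: "f n \<in> F k" "g n \<in> F k"
      using f(1)[of n] g(1)[of n] F_le[of "i n" k] F_le[of "j n" k] by (auto simp: k_def)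
    then have s: "f n + g n \<in> F k" by (rule complex_vector.subspace_add[OF frame.csubspace_alg[OF fr]])
    have "E (star v * v) = T k (star v * v)" if "v \<in> F k" for v
      by (intro E_F frame.alg_mult[OF fr] frame.alg_star[OF fr] that)
    then show ?thesis using frame.T_square_add[OF fr fg] fg s by simp
  qed
  have lim: "(\<lambda>n. norm (E (star (f n) * f n))) \<longlonglongrightarrow> norm (E (star x * x))"
    if "\<And>n. f n \<in> A" "f \<longlonglongrightarrow> x" "x \<in> A" for f x
    by (intro tendsto_norm E_cont) (auto intro!: A_closed that tendsto_mult tendsto_star)
  show ?thesis
  proof (rule LIMSEQ_le)
    show "(\<lambda>n. norm (E (star (f n + g n) * (f n + g n)))) \<longlonglongrightarrow> norm (E (star (x + z) * (x + z)))"
      by (rule lim) (auto intro!: A_closed F_A[OF f(1)] F_A[OF g(1)] assms tendsto_add f(2) g(2))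
    show "(\<lambda>n. 2 * norm (E (star (f n) * f n)) + 2 * norm (E (star (g n) * g n))) \<longlonglongrightarrow> 2 * norm (E (star x * x)) + 2 * norm (E (star z * z))"
      by (intro tendsto_add tendsto_mult tendsto_const lim F_A[OF f(1)] F_A[OF g(1)] assms f(2) g(2))
  qed (use le in blast)
qed

lemma H_nonempty: "H j \<noteq> {}"
proof (induction j)
  case (Suc j)
  then obtain c u where "c \<in> H j" "u \<in> UA j" using UA_ne by blast
  from refinement.H'_H[OF ref this] show ?case unfolding H_Suc by blast
qed (rule H_ne)

text \<open>All \<open>x * f\<close> with \<open>f \<in> F j\<close> lie in the left kernel.
  Replacing \<open>x\<close> by an approximant \<open>y\<close> turns the vanishing of these
  expectations into a bound by \<open>K * (norm f)\<^sup>2\<close>, and \<open>column_bound\<close>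
  then makes \<open>y\<close> too small to be near \<open>x\<close>.\<close>

lemma E_faithful: assumes x: "x \<in> A" and E0: "E (star x * x) = 0" shows "x = 0"
proof (rule ccontr)
  assume nz: "x \<noteq> 0"
  have Ew: "E (star (x * w) * (x * w)) = 0" if "w \<in> W j" for w j
  proof -
    have "E (star w * (star x * x) * w) = star w * E (star x * x) * w"
      by (rule E_conj[OF that]) (intro A_closed x)
    then show ?thesis by (simp add: star_mult mult.assoc E0)
  qed
  have Ef: "E (star (x * f) * (x * f)) = 0" if "f \<in> F j" for f j
  proof -
    have "f \<in> F j \<and> E (star (x * f) * (x * f)) = 0"
      using that unfolding frame.alg_mono[OF fr]
    proof (induction rule: complex_vector.span_induct_alt)
      case base
      have "E 0 = 0" using E_diff[OF x x] by simp
      then show ?case by (simp add: complex_vector.span_zero)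
    next
      case (step c w f)
      have fA: "f \<in> A" "w \<in> A" using step F_A frame.mono_alg[OF fr] unfolding frame.alg_mono[OF fr] by blast+
      have "E (star (x * (c *\<^sub>C w)) * (x * (c *\<^sub>C w))) = (c * cnj c) *\<^sub>C E (star (x * w) * (x * w))"
        using E_scaleC[of "star (x * w) * (x * w)" "c * cnj c"] fA x
        by (simp add: scaleC_mult star_scaleC scaleC_scaleC A_closed)
      then have "norm (E (star (x * (c *\<^sub>C w + f)) * (x * (c *\<^sub>C w + f)))) \<le> 2 * 0 + 2 * 0"
        using E_square_add[of "x * (c *\<^sub>C w)" "x * f"] x fA Ew[OF step(1)] step.IH
        by (simp add: ring_distribs A_closed)
      then show ?case using step by (simp add: complex_vector.span_add complex_vector.span_scale complex_vector.span_base)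
    qed
    then show ?thesis by blast
  qed
  define n where "n = norm x"
  have n: "n > 0" using nz by (simp add: n_def)
  \<comment> \<open>With 1/20 the two bounds for the square of \<open>norm y\<close> are at most
    41/200 and at least 361/400 of the square of \<open>n\<close>.\<close>
  have "0 < n / 20" using n by simp
  then obtain j y where y: "y \<in> F j" "norm (x - y) < n / 20" using A_approx[OF x] by blast
  have ny: "norm y \<le> n + n / 20" "norm y \<ge> n - n / 20"
    using norm_triangle_ineq2[of y x] norm_triangle_ineq2[of x y] y(2) by (auto simp: n_def norm_minus_commute)
  define K where "K = n / 20 * (n + norm y)"
  have "(norm y)\<^sup>2 \<le> 2 * K"
  proof (rule frame.column_bound[OF fr y(1) _ H_nonempty])
    show "0 \<le> K" using n by (simp add: K_def)
    fix f assume f: "f \<in> F j"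
    have fA: "f \<in> A" "y \<in> A" by (rule F_A[OF f], rule F_A[OF y(1)])
    have "star y * y - star x * x = star y * (y - x) + star (y - x) * x" by (simp add: star_diff algebra_simps)
    then have "norm (star y * y - star x * x) \<le> norm (star y * (y - x)) + norm (star (y - x) * x)"
      by (simp only: norm_triangle_ineq)
    also have "\<dots> \<le> norm y * norm (y - x) + norm (y - x) * norm x"
      using norm_mult_ineq[of "star y" "y - x"] norm_mult_ineq[of "star (y - x)" x] by simp
    also have "\<dots> \<le> norm y * (n / 20) + n / 20 * norm x"
      using y(2) by (intro add_mono mult_left_mono mult_right_mono) (auto simp: norm_minus_commute)
    finally have yx: "norm (star y * y - star x * x) \<le> K" by (simp add: K_def n_def algebra_simps)
    have "T j (star (y * f) * (y * f)) = E (star (y * f) * (y * f))"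
      by (intro E_F[symmetric] frame.alg_mult[OF fr] frame.alg_star[OF fr] f y(1))
    also have "\<dots> = E (star (y * f) * (y * f) - star (x * f) * (x * f))"
      using fA x by (simp add: E_diff A_closed Ef[OF f])
    also have "norm \<dots> \<le> norm (star (y * f) * (y * f) - star (x * f) * (x * f))"
      by (rule norm_E) (intro A_closed fA x)
    also have "star (y * f) * (y * f) - star (x * f) * (x * f) = star f * (star y * y - star x * x) * f"
      by (simp add: star_mult algebra_simps)
    also have "norm \<dots> \<le> norm f * K * norm f"
      using norm_mult_ineq[of "star f * (star y * y - star x * x)" f] norm_mult_ineq[of "star f" "star y * y - star x * x"]
        mult_left_mono[OF yx, of "norm f"] mult_right_mono[of "norm (star f * (star y * y - star x * x))" "norm f * K" "norm f"]
      by simp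
    finally show "norm (T j (star (y * f) * (y * f))) \<le> K * (norm f)\<^sup>2" by (simp add: power2_eq_square mult_ac)
  qed
  also have "\<dots> \<le> 2 * (n / 20 * (n + (n + n / 20)))" unfolding K_def using ny n by (intro mult_left_mono add_left_mono) auto
  finally have 1: "(norm y)\<^sup>2 \<le> 41 / 200 * n\<^sup>2" by (simp add: power2_eq_square algebra_simps)
  have "(n - n / 20)\<^sup>2 \<le> (norm y)\<^sup>2" using ny n by (intro power_mono) auto
  then have "361 / 400 * n\<^sup>2 \<le> 41 / 200 * n\<^sup>2" using 1 by (simp add: power2_eq_square algebra_simps)
  then show False using n by simp
qed

theorem cartan: "cartan_subalgebra A B"
proof -
  have "conditional_expectation A B E"
    unfolding conditional_expectation_def
    using E_B E_id B_in_A E_add E_scaleC norm_E E_positive E_left E_right by (auto intro!: image_eqI)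
  moreover have "faithful_on A E" unfolding faithful_on_def using E_faithful by blast
  ultimately show ?thesis unfolding cartan_subalgebra_def using masa approximate_unit regular by blast
qed

end

section \<open>Failure of unique extension\<close>

lemma (in refinement) pauli_block: "c \<in> H \<Longrightarrow> u \<in> UA \<Longrightarrow>
    pauli i s c c * block (\<lambda>b. c b * u) = pauli i s (\<lambda>b. c b * u) (\<lambda>b. c b * u)"
  by (cases i; cases s) (auto simp: pauli_def star_simps rules)

lemma (in refinement) block_refine: "c \<in> H \<Longrightarrow> u \<in> UA \<Longrightarrow> block c * block (\<lambda>b. c b * u) = block (\<lambda>b. c b * u)"
  by (auto simp: star_simps rules)

lemma (in frame) pauli_X:
  assumes "c \<in> H"
  shows "block c * pauli True False c c = pauli True False c c" "pauli True False c c * block c = pauli True False c c"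
    "pauli True False c c * pauli True False c c = block c" "block c + pauli True False c c \<noteq> 0" "block c - pauli True False c c \<noteq> 0"
proof -
  show "block c * pauli True False c c = pauli True False c c" "pauli True False c c * block c = pauli True False c c"
    "pauli True False c c * pauli True False c c = block c"
    using assms by (simp_all add: pauli_def rules add_ac)
  have "star (c True) * (block c + pauli True False c c) * c True = q" "star (c True) * (block c - pauli True False c c) * c True = q"
    using assms by (simp_all add: pauli_def rules projectionD[OF q])
  then show "block c + pauli True False c c \<noteq> 0" "block c - pauli True False c c \<noteq> 0"
    using projectionD(3)[OF q] by auto
qed

text \<open>If both \<open>f\<close> and \<open>p - f\<close> were nonzero, multiplying the
  difference by them would show that the scalar \<open>m\<close> is within 1/4 of 1 and of
  0.\<close>

lemma idempotent_near_scalar: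
  fixes f p :: "'a::cstar_algebra"
  assumes f: "f * f = f" "p * f = f" "f * p = f" "p * p = p" and le: "norm (f - m *\<^sub>C p) \<le> 1 / 4"
  shows "f = 0 \<or> f = p"
proof (rule ccontr)
  assume "\<not> (f = 0 \<or> f = p)"
  then have nz: "norm f > 0" "norm (p - f) > 0" by auto
  have "f * (f - m *\<^sub>C p) = (1 - m) *\<^sub>C f" by (simp add: right_diff_distrib f scaleC_mult complex_vector.scale_left_diff_distrib)
  then have "cmod (1 - m) * norm f \<le> norm f * (1 / 4)"
    using norm_mult_ineq[of f "f - m *\<^sub>C p"] mult_left_mono[OF le, of "norm f"] by (simp add: norm_scaleC)
  then have 1: "cmod (1 - m) \<le> 1 / 4" using nz(1) by (simp add: mult.commute)
  have "(p - f) * (f - m *\<^sub>C p) = (- m) *\<^sub>C (p - f)" by (simp add: algebra_simps f scaleC_mult complex_vector.scale_right_diff_distrib)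
  then have "cmod m * norm (p - f) \<le> norm (p - f) * (1 / 4)"
    using norm_mult_ineq[of "p - f" "f - m *\<^sub>C p"] mult_left_mono[OF le, of "norm (p - f)"] by (simp add: norm_scaleC)
  then have 2: "cmod m \<le> 1 / 4" using nz(2) by (simp add: mult.commute)
  show False using norm_triangle_ineq[of "1 - m" m] 1 2 by simp
qed

context tower
begin

text \<open>A path that never leaves the first summand. The same \<open>u\<close> multiplies both
  columns of the pair, so the factor \<open>M\<^sub>2\<close> at stage 0 survives undiminished below
  every \<open>tp j\<close>.\<close>

primrec thread :: "nat \<Rightarrow> bool \<Rightarrow> 'a" where
  "thread 0 = (SOME c. c \<in> H 0)"
| "thread (Suc j) = (\<lambda>b. thread j b * (SOME u. u \<in> UA j))"

lemma thread_H: "thread j \<in> H j"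
proof (induction j)
  case 0
  show ?case using H_ne by (simp add: some_in_eq)
next
  case (Suc j)
  have "(SOME u. u \<in> UA j) \<in> UA j" using UA_ne[of j] by (simp add: some_in_eq)
  from refinement.H'_H[OF ref Suc this] show ?case by (simp add: H_Suc)
qed

abbreviation "tp j \<equiv> block (thread j)"
abbreviation "ts j \<equiv> pauli True False (thread j) (thread j)"

lemma tp_P: "tp j \<in> P j"
  by (rule frame.block_projs[OF fr thread_H])

lemma tp_ts_Suc: "tp j * tp (Suc j) = tp (Suc j)" "ts j * tp (Suc j) = ts (Suc j)"
proof -
  have "(SOME u. u \<in> UA j) \<in> UA j" using UA_ne[of j] by (simp add: some_in_eq)
  then show "tp j * tp (Suc j) = tp (Suc j)" "ts j * tp (Suc j) = ts (Suc j)"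
    using refinement.pauli_block[OF ref thread_H] refinement.block_refine[OF ref thread_H] by auto
qed

lemma tp_le: "i \<le> j \<Longrightarrow> tp i * tp j = tp j"
proof (induction j rule: dec_induct)
  case base then show ?case using frame.block_block[OF fr thread_H thread_H] by simp
next
  case (step n)
  have "tp i * tp (Suc n) = tp i * tp n * tp (Suc n)" by (simp only: tp_ts_Suc mult.assoc)
  then show ?case by (simp only: step.IH tp_ts_Suc)
qed

lemma ts_0: "ts 0 * tp j = ts j"
proof (induction j)
  case 0 show ?case by (rule frame.pauli_X(2)[OF fr thread_H])
next
  case (Suc n)
  have "ts 0 * tp (Suc n) = ts 0 * tp n * tp (Suc n)" by (simp only: tp_ts_Suc mult.assoc)
  then show ?case by (simp only: Suc.IH tp_ts_Suc)
qed

text \<open>\<open>b\<close> is close to some \<open>d \<in> D J\<close>, and \<open>d\<close> acts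
  on \<open>tp J\<close>, hence on all later \<open>tp j\<close>, as one scalar. An idempotent that
  close to a scalar is trivial.\<close>

lemma thread_projection:
  assumes b: "b \<in> B" "b * b = b"
  shows "\<exists>J. \<forall>j\<ge>J. b * tp j = 0 \<or> b * tp j = tp j"
proof -
  have "(0::real) < 1 / 4" by simp
  then obtain J d where d: "d \<in> D J" "norm (b - d) < 1 / 4" using B_approx[OF b(1)] by blast
  obtain f where "d = (\<Sum>p\<in>P J. f p *\<^sub>C p)" using d(1) unfolding frame.diag_iff[OF fr] by blast
  then have dJ: "d * tp J = f (tp J) *\<^sub>C tp J" using frame.sum_projs_right[OF fr tp_P, of f J] by simp
  show ?thesis
  proof (intro exI[of _ J] allI impI)
    fix j assume j: "J \<le> j"
    have "d * tp j = d * tp J * tp j" by (simp only: tp_le[OF j] mult.assoc)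
    then have dj: "d * tp j = f (tp J) *\<^sub>C tp j" by (simp add: dJ scaleC_mult tp_le[OF j])
    have pp: "tp j * tp j = tp j" by (rule tp_le) simp
    have comm: "b * tp j = tp j * b" by (rule abelian_B[OF b(1) D_B[OF frame.projs_diag[OF fr tp_P]]])
    have "norm (b * tp j - f (tp J) *\<^sub>C tp j) \<le> norm (b - d) * norm (tp j)"
      using norm_mult_ineq[of "b - d" "tp j"] by (simp add: left_diff_distrib dj)
    then have le: "norm (b * tp j - f (tp J) *\<^sub>C tp j) \<le> 1 / 4"
      using d(2) projectionD(4)[OF frame.projection_projs[OF fr tp_P]] by simp
    show "b * tp j = 0 \<or> b * tp j = tp j"
    proof (rule idempotent_near_scalar[OF _ _ _ pp le])
      show "b * tp j * tp j = b * tp j" by (simp only: mult.assoc pp)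
      show "tp j * (b * tp j) = b * tp j" by (simp only: comm mult.assoc[symmetric] pp)
      have "b * tp j * (b * tp j) = b * (tp j * b) * tp j" by (simp only: mult.assoc)
      also have "\<dots> = b * b * (tp j * tp j)" by (simp only: comm[symmetric] mult.assoc)
      finally show "b * tp j * (b * tp j) = b * tp j" by (simp only: b(2) pp)
    qed
  qed
qed

text \<open>
  The projections \<open>tp j\<close> define a character of \<open>B\<close>. If an automorphism maps \<open>B\<close> onto \<open>C\<close>, then by
  \<open>thread_projection\<close> the image of some \<open>tp j\<close> lies below one member of \<open>Q\<close>, where \<open>S'\<close> is a scalar;
  but for \<open>S\<close> take the image of a Pauli matrix, which has the eigenvalues 1 and -1 on this image.
\<close>

lemma not_conjugate:
  assumes ex: "\<And>S e. S \<in> A \<Longrightarrow> 0 < e \<Longrightarrow> \<exists>S' Q. norm (S - S') < e \<and> finite Q \<and> Q \<subseteq> C \<and> (\<Sum>q\<in>Q. q) = one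
      \<and> (\<forall>q\<in>Q. star q = q \<and> q * q = q \<and> (\<exists>m. q * S' * q = m *\<^sub>C q))"
  shows "\<not> conjugate_in A B C"
proof
  assume "conjugate_in A B C"
  then obtain \<alpha> where aut: "star_automorphism A \<alpha>" and BC: "\<alpha> ` B = C" unfolding conjugate_in_def by blast
  have inj: "inj_on \<alpha> A" and img: "\<alpha> ` A = A" and add: "x \<in> A \<Longrightarrow> y \<in> A \<Longrightarrow> \<alpha> (x + y) = \<alpha> x + \<alpha> y"
    and mul: "x \<in> A \<Longrightarrow> y \<in> A \<Longrightarrow> \<alpha> (x * y) = \<alpha> x * \<alpha> y"
    and st: "x \<in> A \<Longrightarrow> \<alpha> (star x) = star (\<alpha> x)" for x y
    using aut unfolding star_automorphism_def bij_betw_def by auto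
  have in_A: "\<alpha> x \<in> A" if "x \<in> A" for x using img that by blast
  have diff: "\<alpha> (x - y) = \<alpha> x - \<alpha> y" if "x \<in> A" "y \<in> A" for x y
    using add[OF A_closed(5)[OF that] that(2)] by simp
  have zero: "\<alpha> 0 = 0" using diff[of one one] F_A[OF frame.one_alg[OF fr]] by simp
  have nz: "\<alpha> x \<noteq> 0" if "x \<in> A" "x \<noteq> 0" for x
    using inj_onD[OF inj, of x 0] that zero A_closed(2)[OF that(1), of 0] by auto
  have pA: "tp j \<in> A" for j by (rule B_in_A[OF D_B[OF frame.projs_diag[OF fr tp_P]]])
  have sA: "ts j \<in> A" for j by (rule F_A[OF frame.pauli_alg[OF fr thread_H thread_H]])
  obtain S' Q where SQ: "norm (\<alpha> (ts 0) - S') < 1 / 2" "finite Q" "Q \<subseteq> C" "(\<Sum>q\<in>Q. q) = one"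
    and Q: "\<And>q. q \<in> Q \<Longrightarrow> star q = q \<and> q * q = q \<and> (\<exists>m. q * S' * q = m *\<^sub>C q)"
    using ex[OF in_A[OF sA], of "1 / 2" 0] by auto
  have "\<exists>b\<in>B. \<alpha> b = q \<and> (\<exists>J. \<forall>j\<ge>J. b * tp j = 0 \<or> b * tp j = tp j)" if q: "q \<in> Q" for q
  proof -
    obtain b where b: "b \<in> B" "\<alpha> b = q" using q SQ(3) BC by blast
    have "\<alpha> (b * b) = \<alpha> b" using mul[OF B_in_A[OF b(1)] B_in_A[OF b(1)]] b(2) Q[OF q] by simp
    then have "b * b = b" using inj_onD[OF inj] A_closed(3) B_in_A[OF b(1)] by blast
    then show ?thesis using thread_projection[OF b(1)] b by blast
  qed
  then obtain b J where b: "\<And>q. q \<in> Q \<Longrightarrow> b q \<in> B" "\<And>q. q \<in> Q \<Longrightarrow> \<alpha> (b q) = q"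
    "\<And>q j. q \<in> Q \<Longrightarrow> J q \<le> j \<Longrightarrow> b q * tp j = 0 \<or> b q * tp j = tp j" by metis
  define j where "j = (\<Sum>q\<in>Q. J q)"
  have j: "J q \<le> j" if "q \<in> Q" for q unfolding j_def using that SQ(2) by (simp add: member_le_sum)
  define p where "p = \<alpha> (tp j)"
  have tp: "tp j * tp j = tp j" "star (tp j) = tp j"
    using projectionD[OF frame.projection_projs[OF fr tp_P]] by auto
  have p: "star p = p" "p * p = p" "p \<noteq> 0"
    unfolding p_def using mul[OF pA pA] st[OF pA] nz[OF pA] tp projectionD(3)[OF frame.projection_projs[OF fr tp_P]] by metis+
  have np: "norm p = 1" using p projectionD(4)[of p] by (simp add: projection_def)
  have "p = (\<Sum>q\<in>Q. q * p)"
    using one_A(1)[OF in_A[OF pA], of j] by (simp add: p_def SQ(4)[symmetric] sum_distrib_right)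
  then obtain q where q: "q \<in> Q" "q * p \<noteq> 0" using p(3) by (metis sum.neutral)
  have "q * p = \<alpha> (b q * tp j)" using mul[OF B_in_A[OF b(1)[OF q(1)]] pA] b(2)[OF q(1)] by (simp add: p_def)
  then have qp: "q * p = p" using b(3)[OF q(1) j[OF q(1)]] q(2) zero by (auto simp: p_def)
  have "star (q * p) = star p" by (simp only: qp)
  then have pq: "p * q = p" using Q[OF q(1)] p(1) by (simp add: star_mult)
  obtain m where m: "q * S' * q = m *\<^sub>C q" using Q[OF q(1)] by blast
  have "p * S' * p = (p * q) * S' * (q * p)" by (simp only: qp pq)
  also have "\<dots> = p * (q * S' * q) * p" by (simp only: mult.assoc)
  finally have pS: "p * S' * p = m *\<^sub>C p" by (simp add: m scaleC_mult pq p)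
  define s where "s = \<alpha> (ts j)"
  have "\<alpha> (ts 0) * p = s" using mul[OF sA pA, of 0 j] unfolding ts_0 s_def p_def by (rule sym)
  moreover have ps: "p * s = s" using mul[OF pA sA, of j j] frame.pauli_X(1)[OF fr thread_H] by (simp add: s_def p_def)
  ultimately have "p * (\<alpha> (ts 0) - S') * p = s - m *\<^sub>C p" using pS by (simp add: algebra_simps)
  then have le: "norm (s - m *\<^sub>C p) \<le> 1 / 2"
    using norm_mult_ineq[of "p * (\<alpha> (ts 0) - S')" p] norm_mult_ineq[of p "\<alpha> (ts 0) - S'"] SQ(1) np by simp
  have sp: "s * p = s" using mul[OF sA pA, of j j] frame.pauli_X(2)[OF fr thread_H] by (simp add: s_def p_def)
  have ss: "s * s = p" using mul[OF sA sA, of j j] frame.pauli_X(3)[OF fr thread_H] by (simp add: s_def p_def)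
  have nz1: "p + s \<noteq> 0"
    using nz[OF A_closed(1)[OF pA sA] frame.pauli_X(4)[OF fr thread_H], of j] unfolding p_def s_def add[OF pA sA] .
  have nz2: "p - s \<noteq> 0"
    using nz[OF A_closed(5)[OF pA sA] frame.pauli_X(5)[OF fr thread_H], of j] unfolding p_def s_def diff[OF pA sA] .
  \<comment> \<open>Both \<open>p + s\<close> and \<open>p - s\<close> are nonzero and are
    eigenvectors of \<open>s\<close> for 1 and -1. So \<open>m\<close> would be within 1/2 of each,
    although these are at distance 2.\<close>
  have "(p + s) * (s - m *\<^sub>C p) = (1 - m) *\<^sub>C (p + s)"
    by (simp add: algebra_simps ps sp ss p scaleC_mult scaleC_add_right complex_vector.scale_left_diff_distrib)
  then have "cmod (1 - m) * norm (p + s) \<le> norm (p + s) * (1 / 2)"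
    using norm_mult_ineq[of "p + s" "s - m *\<^sub>C p"] mult_left_mono[OF le, of "norm (p + s)"] by (simp add: norm_scaleC)
  then have 1: "cmod (1 - m) \<le> 1 / 2" using nz1 by (simp add: mult.commute)
  have "(p - s) * (s - m *\<^sub>C p) = (- 1 - m) *\<^sub>C (p - s)"
    by (simp add: algebra_simps ps sp ss p scaleC_mult complex_vector.scale_right_diff_distrib complex_vector.scale_left_diff_distrib)
  then have "cmod (- 1 - m) * norm (p - s) \<le> norm (p - s) * (1 / 2)"
    using norm_mult_ineq[of "p - s" "s - m *\<^sub>C p"] mult_left_mono[OF le, of "norm (p - s)"] by (simp add: norm_scaleC)
  then have 2: "cmod (- 1 - m) \<le> 1 / 2" using nz2 by (simp add: mult.commute)
  show False using norm_triangle_ineq4[of "1 - m" "- 1 - m"] 1 2 by simp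
qed

end

section \<open>Parity of the multiplicities\<close>

text \<open>
  The sets \<open>C l\<close> resolve \<open>q\<close> into copies of the projections \<open>Q l\<close>; for the inclusion of one
  finite-dimensional algebra into another the number of copies is a partial multiplicity.
\<close>

definition decomp :: "'a::cstar_algebra \<Rightarrow> (bool \<Rightarrow> 'a set) \<Rightarrow> (bool \<Rightarrow> 'a) \<Rightarrow> bool" where
  "decomp q C Q \<longleftrightarrow> (\<forall>l. finite (C l)) \<and> (\<forall>l. projection (Q l)) \<and>
     (\<forall>l l'. \<forall>u\<in>C l. \<forall>v\<in>C l'. star u * v = (if l = l' \<and> u = v then Q l else 0)) \<and>
     (\<Sum>l\<in>UNIV. \<Sum>u\<in>C l. u * star u) = q"

definition colprod :: "(bool \<Rightarrow> 'a::cstar_algebra set) \<Rightarrow> (bool \<Rightarrow> bool \<Rightarrow> 'a set) \<Rightarrow> bool \<Rightarrow> 'a set" where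
  "colprod C U m = {u * v | u v l. u \<in> C l \<and> v \<in> U l m}"

lemma decompD:
  assumes "decomp q C Q"
  shows "finite (C l)" "projection (Q l)" "u \<in> C l \<Longrightarrow> v \<in> C l' \<Longrightarrow> star u * v = (if l = l' \<and> u = v then Q l else 0)"
    "(\<Sum>l\<in>UNIV. \<Sum>u\<in>C l. u * star u) = q" "u \<in> C l \<Longrightarrow> u * Q l = u" "u \<in> C l \<Longrightarrow> u \<noteq> 0" "u \<in> C l \<Longrightarrow> q * u = u"
proof -
  show 1: "finite (C l)" "projection (Q l)" "(\<Sum>l\<in>UNIV. \<Sum>u\<in>C l. u * star u) = q" for l
    using assms unfolding decomp_def by auto
  show 2: "star u * v = (if l = l' \<and> u = v then Q l else 0)" if "u \<in> C l" "v \<in> C l'" for u v l l'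
    using assms that unfolding decomp_def by auto
  show 3: "u * Q l = u" if "u \<in> C l" for u l by (rule right_support[OF _ 1(2)]) (simp add: 2[OF that that])
  show "u \<noteq> 0" if "u \<in> C l" using 2[OF that that] projectionD(3)[OF 1(2)[of l]] by auto
  assume u: "u \<in> C l"
  have "q * u = (\<Sum>l'\<in>UNIV. \<Sum>v\<in>C l'. v * (star v * u))" by (simp add: 1(3)[symmetric] sum_distrib_right mult.assoc)
  also have "\<dots> = (\<Sum>l'\<in>UNIV. \<Sum>v\<in>C l'. if l' = l \<and> v = u then u else 0)"
    using u by (intro sum.cong refl) (simp add: 2[OF _ u] 3)
  also have "\<dots> = u" using u 1(1) by (cases l) (simp_all add: UNIV_bool)
  finally show "q * u = u" .
qed

text \<open>Inner products of columns determine their factors, so products from different triples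
  \<open>(l, u, v)\<close> are different. Therefore the cardinalities multiply like matrices of
  partial multiplicities.\<close>

lemma decomp_colprod:
  assumes C: "decomp q C Q" and U: "\<And>l. decomp (Q l) (U l) Q'"
  shows "decomp q (colprod C U) Q'" "card (colprod C U m) = (\<Sum>l\<in>UNIV. card (C l) * card (U l m))"
proof -
  define I where "I m = Sigma UNIV (\<lambda>l. C l \<times> U l m)" for m
  define f where "f = (\<lambda>(l::bool, u, v). u * v :: 'a)"
  have colprod: "colprod C U m = f ` I m" for m by (force simp: colprod_def I_def f_def)
  have finI: "finite (I m)" for m unfolding I_def using decompD(1)[OF C] decompD(1)[OF U] by (intro finite_SigmaI) auto
  have ff: "star (f i) * f i' = (if m = m' \<and> i = i' then Q' m else 0)" if ii: "i \<in> I m" "i' \<in> I m'" for i i' m m'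
  proof -
    obtain l u v l' u' v' where i: "i = (l, u, v)" "i' = (l', u', v')" "u \<in> C l" "v \<in> U l m" "u' \<in> C l'" "v' \<in> U l' m'"
      using ii unfolding I_def by blast
    have "star (f i) * f i' = star v * (star u * u') * v'" by (simp add: i f_def star_mult mult.assoc)
    also have "star u * u' = (if l = l' \<and> u = u' then Q l else 0)" by (rule decompD(3)[OF C i(3,5)])
    finally show ?thesis using i decompD(3)[OF U i(4), of v' m'] decompD(7)[OF U[of l'] i(6)]
      by (auto simp: mult.assoc)
  qed
  have inj: "i = i' \<and> m = m'" if "i \<in> I m" "i' \<in> I m'" "f i = f i'" for i i' m m'
    using ff[OF that(1,2)] ff[OF that(1,1)] projectionD(3)[OF decompD(2)[OF U[of True]], of m] that(3) by (auto split: if_splits)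
  have inj': "inj_on f (I m)" for m using inj[of _ m _ m] by (auto simp: inj_on_def)
  have "card (colprod C U m) = card (I m)" unfolding colprod by (rule card_image[OF inj'])
  also have "\<dots> = (\<Sum>l\<in>UNIV. card (C l) * card (U l m))"
    unfolding I_def using decompD(1)[OF C] decompD(1)[OF U] by (subst card_SigmaI) (auto simp: card_cartesian_product)
  finally show "card (colprod C U m) = (\<Sum>l\<in>UNIV. card (C l) * card (U l m))" .
  have sumI: "(\<Sum>i\<in>I m. g i) = (\<Sum>l\<in>UNIV. \<Sum>u\<in>C l. \<Sum>v\<in>U l m. g (l, u, v))" for g :: "bool \<times> 'a \<times> 'a \<Rightarrow> 'a" and m
  proof -
    have "(\<Sum>l\<in>UNIV. \<Sum>u\<in>C l. \<Sum>v\<in>U l m. g (l, u, v)) = (\<Sum>l\<in>UNIV. \<Sum>x\<in>C l \<times> U l m. g (l, x))"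
      by (simp add: sum.cartesian_product case_prod_unfold)
    also have "\<dots> = (\<Sum>(l, x)\<in>I m. g (l, x))"
      unfolding I_def using decompD(1)[OF C] decompD(1)[OF U] by (intro sum.Sigma) auto
    finally show ?thesis by (simp add: case_prod_unfold)
  qed
  have "(\<Sum>m\<in>UNIV. \<Sum>x\<in>colprod C U m. x * star x) = (\<Sum>m\<in>UNIV. \<Sum>i\<in>I m. f i * star (f i))"
    unfolding colprod by (simp add: sum.reindex[OF inj'])
  also have "\<dots> = (\<Sum>m\<in>UNIV. \<Sum>l\<in>UNIV. \<Sum>u\<in>C l. \<Sum>v\<in>U l m. u * (v * star v) * star u)"
    by (simp add: sumI f_def star_mult mult.assoc)
  also have "\<dots> = (\<Sum>l\<in>UNIV. \<Sum>u\<in>C l. u * (\<Sum>m\<in>UNIV. \<Sum>v\<in>U l m. v * star v) * star u)"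
    by (simp add: sum_distrib_left sum_distrib_right UNIV_bool sum.distrib ring_distribs add_ac)
  also have "\<dots> = (\<Sum>l\<in>UNIV. \<Sum>u\<in>C l. u * star u)"
    by (intro sum.cong refl) (simp add: decompD(4)[OF U] decompD(5)[OF C])
  also have "\<dots> = q" by (rule decompD(4)[OF C])
  finally have total: "(\<Sum>m\<in>UNIV. \<Sum>x\<in>colprod C U m. x * star x) = q" .
  show "decomp q (colprod C U) Q'"
    unfolding decomp_def
  proof (intro conjI allI ballI)
    show "finite (colprod C U l)" "projection (Q' l)" for l using colprod finI decompD(2)[OF U[of True]] by auto
    fix l l' x y assume "x \<in> colprod C U l" "y \<in> colprod C U l'"
    then obtain i i' where i: "i \<in> I l" "i' \<in> I l'" "x = f i" "y = f i'" unfolding colprod by auto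
    then show "star x * y = (if l = l' \<and> x = y then Q' l else 0)" using ff[OF i(1,2)] inj[OF i(1,2)] by auto
  qed (rule total)
qed

lemma colprod_iff:
  "z \<in> colprod K V m \<longleftrightarrow> (\<exists>x\<in>K False. \<exists>s\<in>V False m. z = x * s) \<or> (\<exists>x\<in>K True. \<exists>s\<in>V True m. z = x * s)"
  unfolding colprod_def mem_Collect_eq ex_bool_eq by blast

lemma colprod_ex:
  "(\<exists>y\<in>colprod K V m. R y) \<longleftrightarrow> (\<exists>x\<in>K False. \<exists>s\<in>V False m. R (x * s)) \<or> (\<exists>x\<in>K True. \<exists>s\<in>V True m. R (x * s))"
  unfolding Bex_def colprod_iff by blast

lemma colprod_assoc: "colprod (colprod C U) V = colprod C (\<lambda>k. colprod (U k) V)"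
proof (rule ext, intro equalityI subsetI)
  fix m x assume "x \<in> colprod (colprod C U) V m"
  then obtain u v w k l where "u \<in> C k" "v \<in> U k l" "w \<in> V l m" "x = u * v * w" unfolding colprod_def by blast
  then show "x \<in> colprod C (\<lambda>k. colprod (U k) V) m" unfolding colprod_def mult.assoc by blast
next
  fix m x assume "x \<in> colprod C (\<lambda>k. colprod (U k) V) m"
  then obtain u v w k l where "u \<in> C k" "v \<in> U k l" "w \<in> V l m" "x = u * v * w"
    unfolding colprod_def mult.assoc by blast
  then show "x \<in> colprod (colprod C U) V m" unfolding colprod_def by blast
qed

lemma pairing:
  fixes S :: "'a set"
  assumes "finite S" "even (card S)"
  shows "\<exists>H :: (bool \<Rightarrow> 'a) set. finite H \<and> (\<Union>c\<in>H. range c) = S \<and> (\<forall>c\<in>H. \<forall>c'\<in>H. \<forall>b b'. c b = c' b' \<longrightarrow> c = c' \<and> b = b')"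
  using assms
proof (induction "card S" arbitrary: S rule: less_induct)
  case less
  show ?case
  proof (cases "S = {}")
    case True
    then show ?thesis by (intro exI[of _ "{}"]) auto
  next
    case False
    then obtain x where x: "x \<in> S" by auto
    have "S - {x} \<noteq> {}"
    proof
      assume "S - {x} = {}"
      then have "S = {x}" using x by auto
      then show False using less.prems by simp
    qed
    then obtain y where y: "y \<in> S" "y \<noteq> x" by auto
    define R where "R = S - {x, y}"
    have cS: "card S = card R + 2"
    proof -
      have "S = insert x (insert y R)" using x y by (auto simp: R_def)
      moreover have "finite R" "x \<notin> R" "y \<notin> R" using less.prems(1) by (auto simp: R_def)
      ultimately show ?thesis using y(2) by simp
    qed
    have "card R < card S" "finite R" "even (card R)" using cS less.prems by (auto simp: R_def)
    from less.hyps[OF this] obtain H :: "(bool \<Rightarrow> 'a) set" where H: "finite H" "(\<Union>c\<in>H. range c) = R"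
      "\<forall>c\<in>H. \<forall>c'\<in>H. \<forall>b b'. c b = c' b' \<longrightarrow> c = c' \<and> b = b'" by blast
    define d where "d = (\<lambda>b. if b then x else y)"
    have dR: "d b \<notin> R" for b by (auto simp: d_def R_def)
    have dd: "d b = d b' \<longleftrightarrow> b = b'" for b b' using y by (auto simp: d_def)
    have dH: "c b \<noteq> d b'" if "c \<in> H" for c b b' using dR[of b'] H(2) that rangeI[of c b] by (metis UN_I)
    have rd: "range d = {x, y}" by (auto simp: d_def UNIV_bool)
    show ?thesis
    proof (intro exI[of _ "insert d H"] conjI ballI allI impI)
      show "finite (insert d H)" using H by simp
      show "(\<Union>c\<in>insert d H. range c) = S" using H(2) rd x y by (auto simp: R_def)
      fix c c' b b' assume "c \<in> insert d H" "c' \<in> insert d H" "c b = c' b'"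
      then consider "c = d" "c' = d" | "c \<in> H" "c' \<in> H" | "c \<in> H" "c' = d" | "c = d" "c' \<in> H" by blast
      then have "c = c' \<and> b = b'"
      proof cases
        case 1 then show ?thesis using dd \<open>c b = c' b'\<close> by simp
      next
        case 2 then show ?thesis using H(3) \<open>c b = c' b'\<close> by blast
      next
        case 3 then show ?thesis using dH[of c b b'] \<open>c b = c' b'\<close> by simp
      next
        case 4 then show ?thesis using dH[of c' b' b] \<open>c b = c' b'\<close> by simp
      qed
      then show "c = c'" "b = b'" by auto
    qed
  qed
qed

text \<open>Any pairing of the copies will do: two orthogonal columns with the same source
  projection already span a copy of \<open>\<complex>\<^sup>2\<close>. The parameter
  \<open>l\<close> says which summand is paired.\<close>

lemma decomp_frame:
  assumes C: "decomp q C Q" and even: "even (card (C l))"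
  shows "\<exists>H. frame q H (C (\<not> l)) (Q l) (Q (\<not> l)) \<and> (\<Union>c\<in>H. range c) = C l"
proof -
  from pairing[OF decompD(1)[OF C] even] obtain H :: "(bool \<Rightarrow> 'a) set" where *: "finite H \<and> (\<Union>c\<in>H. range c) = C l
    \<and> (\<forall>c\<in>H. \<forall>c'\<in>H. \<forall>b b'. c b = c' b' \<longrightarrow> c = c' \<and> b = b')" by (rule exE)
  then have H: "finite H" "(\<Union>c\<in>H. range c) = C l"
    "\<forall>c\<in>H. \<forall>c'\<in>H. \<forall>b b'. c b = c' b' \<longrightarrow> c = c' \<and> b = b'" by auto
  have cC: "c b \<in> C l" if "c \<in> H" for c b using H(2) that by blast
  have inj: "inj_on (\<lambda>(c, b). c b) (H \<times> UNIV)" using H(3) by (auto simp: inj_on_def)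
  have img: "C l = (\<lambda>(c, b). c b) ` (H \<times> UNIV)"
  proof (intro equalityI subsetI)
    fix x assume "x \<in> C l"
    then obtain c b where "c \<in> H" "x = c b" using H(2) by blast
    then show "x \<in> (\<lambda>(c, b). c b) ` (H \<times> UNIV)" by (intro image_eqI[of _ _ "(c, b)"]) simp_all
  qed (use cC in auto)
  have "(\<Sum>u\<in>C l. u * star u) = (\<Sum>(c, b)\<in>H \<times> UNIV. c b * star (c b))"
    unfolding img sum.reindex[OF inj] by (simp add: case_prod_unfold)
  also have "\<dots> = (\<Sum>c\<in>H. block c)"
    unfolding block_def by (rule sum.cartesian_product[symmetric])
  finally have "(\<Sum>u\<in>C l. u * star u) = (\<Sum>c\<in>H. block c)" .
  moreover have "(\<Sum>l'\<in>UNIV. \<Sum>u\<in>C l'. u * star u) = (\<Sum>u\<in>C l. u * star u) + (\<Sum>u\<in>C (\<not> l). u * star u)"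
    by (cases l) (simp_all add: UNIV_bool add_ac)
  ultimately have tot: "(\<Sum>c\<in>H. block c) + (\<Sum>u\<in>C (\<not> l). u * star u) = q" using decompD(4)[OF C] by simp
  have "frame q H (C (\<not> l)) (Q l) (Q (\<not> l))"
  proof
    show "star (c b) * c' b' = (if c = c' \<and> b = b' then Q l else 0)" if "c \<in> H" "c' \<in> H" for c c' b b'
      using decompD(3)[OF C cC[OF that(1)] cC[OF that(2)], of b b'] H(3) that by auto
    show "star y * y' = (if y = y' then Q (\<not> l) else 0)" if "y \<in> C (\<not> l)" "y' \<in> C (\<not> l)" for y y'
      using decompD(3)[OF C that] by simp
    show "star (c b) * y = 0" if "c \<in> H" "y \<in> C (\<not> l)" for c b y
      using decompD(3)[OF C cC[OF that(1)] that(2), of b] by simp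
  qed (use H decompD[OF C] tot in auto)
  then show ?thesis using H(2) by blast
qed

section \<open>Column spaces are unchanged by the Bell basis\<close>

lemma cspan_mult_cong:
  assumes "cspan X = cspan X'"
  shows "cspan {x * u | x u. x \<in> X \<and> u \<in> V} = cspan {x * u | x u. x \<in> X' \<and> u \<in> (V :: 'a::cstar_algebra set)}"
proof -
  have "cspan {x * u | x u. x \<in> X \<and> u \<in> V} \<subseteq> cspan {x * u | x u. x \<in> X' \<and> u \<in> V}" if "cspan X = cspan X'" for X X' :: "'a set"
  proof (rule complex_vector.span_minimal)
    have "x * u \<in> cspan {x * u | x u. x \<in> X' \<and> u \<in> V}" if x: "x \<in> cspan X'" and u: "u \<in> V" for x u
      using x by (rule cspan_scaleC_left[of x X' "\<lambda>x. x * u"]) (use u in \<open>auto simp: ring_distribs scaleC_mult intro: complex_vector.span_base\<close>)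
    then show "{x * u | x u. x \<in> X \<and> u \<in> V} \<subseteq> cspan {x * u | x u. x \<in> X' \<and> u \<in> V}"
      using that complex_vector.span_base[of _ X] by blast
  qed simp
  then show ?thesis using assms by (intro antisym) auto
qed

lemma cspan_Un_cong: "cspan X = cspan X' \<Longrightarrow> cspan Z = cspan Z' \<Longrightarrow> cspan (X \<union> Z) = cspan (X' \<union> Z')"
  by (simp add: complex_vector.span_Un)

lemma (in refinement) span_cols: "cspan N.cols = cspan ({x * u | x u. x \<in> F.cols \<and> u \<in> UA} \<union> {x * u | x u. x \<in> Y \<and> u \<in> RU.cols})"
proof -
  have "N.cols = {x * u | x u. x \<in> F.cols \<and> u \<in> UA} \<union> {x * u | x u. x \<in> Y \<and> u \<in> RU.cols}"
  proof (intro equalityI subsetI)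
    fix x assume "x \<in> N.cols"
    then obtain d b where "d \<in> H'" "x = d b" unfolding N.cols_def by auto
    then show "x \<in> {x * u | x u. x \<in> F.cols \<and> u \<in> UA} \<union> {x * u | x u. x \<in> Y \<and> u \<in> RU.cols}"
    proof (cases rule: H'_cases)
      case (H c u)
      then have "c b \<in> F.cols" "x = c b * u" using \<open>x = d b\<close> by (auto simp: F.cols_def)
      then show ?thesis using H by blast
    next
      case (Y y u)
      then have "u b \<in> RU.cols" "x = y * u b" using \<open>x = d b\<close> by (auto simp: RU.cols_def)
      then show ?thesis using Y by blast
    qed
  next
    fix x assume "x \<in> {x * u | x u. x \<in> F.cols \<and> u \<in> UA} \<union> {x * u | x u. x \<in> Y \<and> u \<in> RU.cols}"
    then consider c b u where "c \<in> H" "u \<in> UA" "x = (\<lambda>b. c b * u) b" | y u b where "y \<in> Y" "u \<in> UB" "x = (\<lambda>b. y * u b) b"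
      unfolding F.cols_def RU.cols_def by auto
    then show "x \<in> N.cols"
      unfolding N.cols_def by cases (blast intro: H'_H H'_Y)+
  qed
  then show ?thesis by simp
qed

text \<open>The product vectors \<open>c b * u b'\<close> are recovered from the Bell vectors as
  sums and differences over the phase. This is why the tower exhausts the given algebra although its
  diagonal is a new one.\<close>

lemma (in refinement) span_Y: "cspan Y' = cspan ({x * u | x u. x \<in> F.cols \<and> u \<in> QU.cols} \<union> {x * u | x u. x \<in> Y \<and> u \<in> UD})"
  (is "_ = cspan ?R")
proof (intro antisym complex_vector.span_minimal subsetI)
  fix x assume "x \<in> Y'"
  then show "x \<in> cspan ?R"
  proof (cases rule: Y'_cases)
    case (H i s c u)
    have "c b * u b' \<in> cspan ?R" for b b'
    proof -
      have "c b \<in> F.cols" "u b' \<in> QU.cols" using H by (auto simp: F.cols_def QU.cols_def)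
      then show ?thesis by (intro complex_vector.span_base) blast
    qed
    then show ?thesis unfolding H(3) bell_def by (intro cspan_scaleR complex_vector.span_add)
  next
    case (Y y u)
    then show ?thesis by (intro complex_vector.span_base) blast
  qed
next
  fix x assume "x \<in> ?R"
  then consider c b u b' where "c \<in> H" "u \<in> UC" "x = c b * u b'" | y u where "y \<in> Y" "u \<in> UD" "x = y * u"
    unfolding F.cols_def QU.cols_def by auto
  then show "x \<in> cspan Y'"
  proof cases
    case 1
    have bl: "bell i s c u \<in> cspan Y'" for i s using 1 Y'_H by (intro complex_vector.span_base) auto
    have "c b * u False = (sqrt 2 / 2) *\<^sub>R (bell b False c u + bell b True c u)"
      "c b * u True = (sqrt 2 / 2) *\<^sub>R (bell (\<not> b) False c u - bell (\<not> b) True c u)"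
      by (simp_all add: bell_def scaleR_2[symmetric] algebra_simps)
    then have "c b * u False \<in> cspan Y'" "c b * u True \<in> cspan Y'"
      by (auto intro!: cspan_scaleR complex_vector.span_add complex_vector.span_diff bl)
    then show ?thesis unfolding 1(3) by (cases b') auto
  next
    case 2
    then show ?thesis using Y'_Y by (intro complex_vector.span_base) auto
  qed
qed simp_all

text \<open>
  Levels whose successive matrices of multiplicities are alternately \<open>(1 1; 1 0)\<close> and \<open>(1 a; 0 1)\<close>,
  where \<open>U t k l\<close> contains the copies, within a minimal projection of the summand \<open>k\<close> of level \<open>t\<close>, of
  one of the summand \<open>l\<close> of level \<open>t + 1\<close>.
  The summand that is to contain the factors \<open>M\<^sub>2\<close> is \<open>False\<close>.
\<close>

locale levels =
  fixes one :: "'a::cstar_algebra" and C0 :: "bool \<Rightarrow> 'a set" and Q :: "nat \<Rightarrow> bool \<Rightarrow> 'a" and U :: "nat \<Rightarrow> bool \<Rightarrow> bool \<Rightarrow> 'a set"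
  assumes C0: "decomp one C0 (Q 0)" and U: "decomp (Q t k) (U t k) (Q (Suc t))"
    and even_step: "even t \<Longrightarrow> card (U t False False) = 1 \<and> card (U t False True) = 1 \<and> card (U t True False) = 1 \<and> card (U t True True) = 0"
    and odd_step: "odd t \<Longrightarrow> card (U t False False) = 1 \<and> card (U t False True) = 0 \<and> card (U t True True) = 1"
    and C0_False: "card (C0 False) > 0" and C0_True: "card (C0 True) = 1"
begin

primrec C :: "nat \<Rightarrow> bool \<Rightarrow> 'a set" where
  "C 0 = C0"
| "C (Suc t) = colprod (C t) (U t)"

text \<open>Columns along \<open>d\<close> steps from level \<open>t\<close>. For no steps the only
  column is the minimal projection itself, which makes the cardinalities an identity matrix.\<close>

primrec UU :: "nat \<Rightarrow> nat \<Rightarrow> bool \<Rightarrow> bool \<Rightarrow> 'a set" where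
  "UU t 0 = (\<lambda>k l. if k = l then {Q t k} else {})"
| "UU t (Suc d) = (\<lambda>k. colprod (UU t d k) (U (t + d)))"

lemma decomp_C: "decomp one (C t) (Q t)"
  by (induction t) (auto intro: C0 decomp_colprod(1)[OF _ U])

lemma projection_Q: "projection (Q t k)"
  using decompD(2)[OF decomp_C] .

lemma decomp_UU: "decomp (Q t k) (UU t d k) (Q (t + d))"
proof (induction d)
  case 0
  show ?case
    unfolding decomp_def using projectionD[OF projection_Q[of t k]] projection_Q[of t]
    by (cases k) (auto simp: UNIV_bool)
next
  case (Suc d)
  then show ?case using decomp_colprod(1)[OF Suc U] by simp
qed

lemma C_UU: "C (t + d) = colprod (C t) (UU t d)"
proof (induction d)
  case 0
  show ?case
  proof (rule ext, intro equalityI subsetI)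
    fix l x assume x: "x \<in> C (t + 0) l"
    then have "x = x * Q t l" using decompD(5)[OF decomp_C] by simp
    then show "x \<in> colprod (C t) (UU t 0) l" using x unfolding colprod_def by force
  qed (auto simp: colprod_def decompD(5)[OF decomp_C] split: if_splits)
next
  case (Suc d)
  then show ?case by (simp add: colprod_assoc)
qed

definition M where "M t d k l = card (UU t d k l)"
definition ncols where "ncols t l = card (C t l)"

lemma M_Suc: "M t (Suc d) k m = M t d k False * card (U (t + d) False m) + M t d k True * card (U (t + d) True m)"
  using decomp_colprod(2)[OF decomp_UU[of t k d] U[of "t + d"], of m] by (simp add: M_def UNIV_bool add.commute)

lemma M_0: "M t 0 k l = (if k = l then 1 else 0)"
  by (simp add: M_def)

lemma ncols_Suc: "ncols (Suc t) m = ncols t False * card (U t False m) + ncols t True * card (U t True m)"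
  using decomp_colprod(2)[OF decomp_C[of t] U[of t], of m] by (simp add: ncols_def UNIV_bool add.commute)

lemma ncols_add: "ncols (t + d) m = ncols t False * M t d False m + ncols t True * M t d True m"
  using decomp_colprod(2)[OF decomp_C[of t] decomp_UU[of t _ d], of m] unfolding ncols_def M_def C_UU by (simp add: UNIV_bool)

text \<open>
  A second vector on which the multiplicities act as on \<open>ncols\<close>. Modulo 2 the two vectors form a
  basis, so that a matrix of multiplicities fixing both is the identity.
\<close>

primrec aux :: "nat \<Rightarrow> bool \<Rightarrow> nat" where
  "aux 0 = (\<lambda>l. if l then 0 else 1)"
| "aux (Suc t) = (\<lambda>m. aux t False * card (U t False m) + aux t True * card (U t True m))"

lemma aux_add: "aux (t + d) m = aux t False * M t d False m + aux t True * M t d True m"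
proof (induction d arbitrary: m)
  case 0 show ?case by (cases m) (simp_all add: M_0)
next
  case (Suc d)
  show ?case unfolding add_Suc_right aux.simps Suc M_Suc by (simp only: distrib_left distrib_right ac_simps)
qed

text \<open>The determinant of the two vectors \<open>ncols t\<close> and \<open>aux t\<close>,
  written with a plus sign as only its parity matters. It starts at 1, because
  \<open>C0 True\<close> has one element and \<open>aux 0\<close> is the first unit vector, and each
  step multiplies it by a determinant 1 or -1.\<close>

lemma odd_det: "odd (ncols t False * aux t True + ncols t True * aux t False)"
proof (induction t)
  case 0
  show ?case by (simp add: ncols_def C0_True)
next
  case (Suc t)
  show ?case
  proof (cases "even t")
    case True
    show ?thesis using Suc even_step[OF True] by (simp add: ncols_Suc algebra_simps)
  next
    case False
    show ?thesis using Suc odd_step[OF False] by (simp add: ncols_Suc algebra_simps)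
  qed
qed

lemma ncols_pos: "ncols t False > 0"
proof (induction t)
  case 0 show ?case using C0_False by (simp add: ncols_def)
next
  case (Suc t)
  then show ?case using even_step[of t] odd_step[of t] by (cases "even t") (auto simp: ncols_Suc)
qed

text \<open>Copies pass directly from \<open>False\<close> to \<open>True\<close> only at even
  levels, while the copies reached persist at odd ones; among two consecutive steps one starts at an
  even level.\<close>

lemma M_pos: "M t d False False > 0" "2 \<le> d \<Longrightarrow> M t d False True > 0"
proof -
  show 1: "M t d False False > 0" for d
  proof (induction d)
    case (Suc d)
    then show ?case using even_step[of "t + d"] odd_step[of "t + d"] by (cases "even (t + d)") (auto simp: M_Suc)
  qed (simp add: M_0)
  have ev: "M t (Suc d) False True > 0" if "even (t + d)" for d
    using 1[of d] even_step[OF that] by (simp add: M_Suc)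
  have od: "M t (Suc d) False True > 0" if "M t d False True > 0" for d
  proof (cases "even (t + d)")
    case False
    then show ?thesis using that odd_step[OF False] by (simp add: M_Suc)
  qed (rule ev)
  assume "2 \<le> d"
  then show "M t d False True > 0"
  proof (induction d rule: dec_induct)
    case base
    have "M t (Suc 1) False True > 0" using ev[of 0] ev[of 1] od[of 1] by (cases "even t") auto
    then show ?case by (simp add: numeral_2_eq_2)
  qed (rule od)
qed

text \<open>Across the inserted level the two sizes are added, as in
  \<open>q\<^sub>n + q\<^sub>n\<^sub>-\<^sub>1\<close>. If the first size were odd from some level
  on, an odd number would be the sum of two odd ones.\<close>

lemma even_ncols: "\<exists>t\<ge>n. even (ncols t False)"
proof (rule ccontr)
  assume "\<not> ?thesis"
  then have o: "odd (ncols t False)" if "n \<le> t" for t using that by blast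
  have "ncols (2 * n + 2) True = ncols (2 * n) False"
    using even_step[of "2 * n"] odd_step[of "2 * n + 1"] ncols_Suc[of "2 * n + 1" True] ncols_Suc[of "2 * n" True] by simp
  moreover have "ncols (2 * n + 3) False = ncols (2 * n + 2) False + ncols (2 * n + 2) True"
    using even_step[of "2 * n + 2"] ncols_Suc[of "2 * n + 2" False] by (simp add: numeral_3_eq_3)
  ultimately show False using o[of "2 * n"] o[of "2 * n + 2"] o[of "2 * n + 3"] by auto
qed

lemma same_parity:
  "\<exists>T0. infinite T0 \<and> (\<forall>t\<in>T0. even (ncols t False)) \<and> (\<forall>t\<in>T0. \<forall>t'\<in>T0. (even (ncols t True) \<longleftrightarrow> even (ncols t' True))
      \<and> (even (aux t False) \<longleftrightarrow> even (aux t' False)) \<and> (even (aux t True) \<longleftrightarrow> even (aux t' True)))"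
proof -
  define S where "S = {t. even (ncols t False)}"
  define f where "f t = (even (ncols t True), even (aux t False), even (aux t True))" for t
  have inf: "infinite S" unfolding infinite_nat_iff_unbounded_le S_def using even_ncols by auto
  have "finite (f ` S)" by (rule finite_subset[of _ UNIV]) auto
  from pigeonhole_infinite[OF inf this] obtain t0 where "infinite {t \<in> S. f t = f t0}" by blast
  then show ?thesis by (intro exI[of _ "{t \<in> S. f t = f t0}"]) (auto simp: S_def f_def)
qed

text \<open>Modulo 2 both values of \<open>ncols\<close> are the vector (0, 1), which fixes the row
  of \<open>True\<close> to be (0, 1). As \<open>aux t False\<close> is odd by
  \<open>odd_det\<close>, the recurrence of \<open>aux\<close> then forces the remaining
  off-diagonal entry to be even.\<close>

lemma parity_M:
  assumes "even (ncols t False)" "even (ncols (t + d) False)" "even (ncols t True) \<longleftrightarrow> even (ncols (t + d) True)"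
    "even (aux t False) \<longleftrightarrow> even (aux (t + d) False)" "even (aux t True) \<longleftrightarrow> even (aux (t + d) True)"
  shows "even (M t d True False)" "even (M t d False True)"
proof -
  have o: "odd (ncols t True)" "odd (aux t False)" using odd_det[of t] assms(1) by auto
  show 1: "even (M t d True False)" using ncols_add[of t d False] assms(1,2) o by auto
  have 2: "odd (M t d True True)" using ncols_add[of t d True] assms(1,3) o by auto
  show "even (M t d False True)" using aux_add[of t d True] assms(5) o 2 by auto
qed

definition G where "G t = cspan {u * star v | u v. \<exists>l. u \<in> C t l \<and> v \<in> C t l}"

lemma G_Suc: "G t \<subseteq> G (Suc t)"
  unfolding G_def
proof (intro complex_vector.span_minimal subsetI)
  fix y assume "y \<in> {u * star v | u v. \<exists>l. u \<in> C t l \<and> v \<in> C t l}"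
  then obtain u v l where y: "y = u * star v" "u \<in> C t l" "v \<in> C t l" by blast
  have "y = (u * Q t l) * star v" using y decompD(5)[OF decomp_C y(2)] by simp
  also have "\<dots> = (\<Sum>m\<in>UNIV. \<Sum>w\<in>U t l m. (u * w) * star (v * w))"
    by (simp add: decompD(4)[OF U, of t l, symmetric] sum_distrib_left sum_distrib_right star_mult mult.assoc)
  also have "\<dots> \<in> cspan {u * star v | u v. \<exists>l. u \<in> C (Suc t) l \<and> v \<in> C (Suc t) l}"
  proof (intro complex_vector.span_sum complex_vector.span_base)
    fix m w assume "w \<in> U t l m"
    then have "u * w \<in> C (Suc t) m" "v * w \<in> C (Suc t) m" using y by (auto simp: colprod_def)
    then show "u * w * star (v * w) \<in> {u * star v | u v. \<exists>l. u \<in> C (Suc t) l \<and> v \<in> C (Suc t) l}" by blast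
  qed
  finally show "y \<in> cspan {u * star v | u v. \<exists>l. u \<in> C (Suc t) l \<and> v \<in> C (Suc t) l}" .
qed simp

lemma G_le: "i \<le> j \<Longrightarrow> G i \<subseteq> G j"
  by (rule lift_Suc_mono_le[of G]) (rule G_Suc)

text \<open>Stages are the levels in an infinite set with constant parities. By
  \<open>parity_M\<close> the copies to be paired are even in number between any two of them, and
  the increasing choice of levels is cofinal, so the closure of the union is the same.\<close>

lemma exists_tower: "\<exists>H Y q r UA UD UB UC. tower one H Y q r UA UD UB UC \<and> tower.A H Y = closure (\<Union>t. G t)"
proof -
  from same_parity obtain T0 where T0: "infinite T0" "\<forall>t\<in>T0. even (ncols t False)"
    "\<forall>t\<in>T0. \<forall>t'\<in>T0. (even (ncols t True) \<longleftrightarrow> even (ncols t' True))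
      \<and> (even (aux t False) \<longleftrightarrow> even (aux t' False)) \<and> (even (aux t True) \<longleftrightarrow> even (aux t' True))" by (elim exE conjE)
  have inf: "\<exists>t'\<in>T0. n \<le> t'" for n using T0(1) unfolding infinite_nat_iff_unbounded_le by blast
  \<comment> \<open>A gap of at least 2 makes \<open>M\<close> positive from \<open>False\<close> to
    \<open>True\<close>, so that every \<open>UC j\<close> is nonempty.\<close>
  have "\<exists>\<tau>. \<forall>j. \<tau> j \<in> T0 \<and> \<tau> j + 2 \<le> \<tau> (Suc j)"
    by (rule dependent_nat_choice[of "\<lambda>_ t. t \<in> T0" "\<lambda>_ t t'. t + 2 \<le> t'"]) (use inf in blast)+
  then obtain \<tau> where \<tau>: "\<And>j. \<tau> j \<in> T0" "\<And>j. \<tau> j + 2 \<le> \<tau> (Suc j)" by blast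
  define d where "d j = \<tau> (Suc j) - \<tau> j" for j
  have d: "2 \<le> d j" "\<tau> j + d j = \<tau> (Suc j)" for j using \<tau>(2)[of j] by (auto simp: d_def)
  have par: "even (card (UU (\<tau> j) (d j) True False))" "even (card (UU (\<tau> j) (d j) False True))" for j
  proof -
    have "even (ncols (\<tau> j) False)" "even (ncols (\<tau> j + d j) False)" unfolding d(2) using T0(2) \<tau>(1) by auto
    moreover note T0(3)[rule_format, OF \<tau>(1)[of j] \<tau>(1)[of "Suc j"], folded d(2)]
    ultimately show "even (card (UU (\<tau> j) (d j) True False))" "even (card (UU (\<tau> j) (d j) False True))"
      unfolding M_def[symmetric] using parity_M[of "\<tau> j" "d j"] by blast+
  qed
  define q where "q j = Q (\<tau> j) False" for j
  define r where "r j = Q (\<tau> j) True" for j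
  define UA where "UA j = UU (\<tau> j) (d j) False False" for j
  define UD where "UD j = UU (\<tau> j) (d j) True True" for j
  have "\<exists>UC. frame (q j) UC (UA j) (r (Suc j)) (q (Suc j)) \<and> (\<Union>c\<in>UC. range c) = UU (\<tau> j) (d j) False True" for j
    using decomp_frame[OF decomp_UU[of "\<tau> j" False "d j"] par(2)] by (simp add: q_def r_def UA_def d(2))
  from choice[OF allI[OF this]] obtain UC where
    "\<forall>j. frame (q j) (UC j) (UA j) (r (Suc j)) (q (Suc j)) \<and> (\<Union>c\<in>UC j. range c) = UU (\<tau> j) (d j) False True" by (rule exE)
  then have UC: "\<And>j. frame (q j) (UC j) (UA j) (r (Suc j)) (q (Suc j))"
    "\<And>j. (\<Union>c\<in>UC j. range c) = UU (\<tau> j) (d j) False True" by simp_all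
  have "\<exists>UB. frame (r j) UB (UD j) (q (Suc j)) (r (Suc j)) \<and> (\<Union>c\<in>UB. range c) = UU (\<tau> j) (d j) True False" for j
    using decomp_frame[OF decomp_UU[of "\<tau> j" True "d j"] par(1)] by (simp add: q_def r_def UD_def d(2))
  from choice[OF allI[OF this]] obtain UB where
    "\<forall>j. frame (r j) (UB j) (UD j) (q (Suc j)) (r (Suc j)) \<and> (\<Union>c\<in>UB j. range c) = UU (\<tau> j) (d j) True False" by (rule exE)
  then have UB: "\<And>j. frame (r j) (UB j) (UD j) (q (Suc j)) (r (Suc j))"
    "\<And>j. (\<Union>c\<in>UB j. range c) = UU (\<tau> j) (d j) True False" by simp_all
  have "even (card (C (\<tau> 0) False))" using T0(2) \<tau>(1)[of 0] by (simp add: ncols_def)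
  from decomp_frame[OF decomp_C this] obtain H0 where
    H0: "frame one H0 (C (\<tau> 0) True) (q 0) (r 0)" "(\<Union>c\<in>H0. range c) = C (\<tau> 0) False"
    by (auto simp: q_def r_def)
  define HY where "HY = rec_nat (H0, C (\<tau> 0) True)
    (\<lambda>j (H, Y). (refinement.H' H Y (UA j) (UB j), refinement.Y' H Y (UC j) (UD j)))"
  define H where "H j = fst (HY j)" for j
  define Y where "Y j = snd (HY j)" for j
  have HY0: "H 0 = H0" "Y 0 = C (\<tau> 0) True" by (simp_all add: H_def Y_def HY_def)
  have HYS: "H (Suc j) = refinement.H' (H j) (Y j) (UA j) (UB j)" "Y (Suc j) = refinement.Y' (H j) (Y j) (UC j) (UD j)" for j
    by (simp_all add: H_def Y_def HY_def case_prod_unfold)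
  have fr: "frame one (H j) (Y j) (q j) (r j)" for j
  proof (induction j)
    case 0 show ?case using H0(1) by (simp add: HY0)
  next
    case (Suc j)
    interpret R: refinement one "H j" "Y j" "q j" "r j" "UA j" "UB j" "UC j" "UD j" "q (Suc j)" "r (Suc j)"
      by (intro refinement.intro Suc UC UB)
    show ?case unfolding HYS by (rule R.N.frame_axioms)
  qed
  have ref: "refinement one (H j) (Y j) (q j) (r j) (UA j) (UB j) (UC j) (UD j) (q (Suc j)) (r (Suc j))" for j
    by (intro refinement.intro fr UC UB)
  have cols: "frame.cols (UB j) = UU (\<tau> j) (d j) True False" "frame.cols (UC j) = UU (\<tau> j) (d j) False True" for j
    using UB(2) UC(2) frame.cols_def[OF UB(1)] frame.cols_def[OF UC(1)] by auto
  have Cstep: "C (\<tau> (Suc j)) m = {u * v | u v. u \<in> C (\<tau> j) False \<and> v \<in> UU (\<tau> j) (d j) False m}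
      \<union> {u * v | u v. u \<in> C (\<tau> j) True \<and> v \<in> UU (\<tau> j) (d j) True m}" for j m
    unfolding d(2)[symmetric] C_UU colprod_def by (auto, (metis (full_types))+)
  \<comment> \<open>The columns of the tower agree with the given ones only at the start; later just
    their spans agree, which is all that the algebra depends on.\<close>
  have span: "cspan (frame.cols (H j)) = cspan (C (\<tau> j) False) \<and> cspan (Y j) = cspan (C (\<tau> j) True)" for j
  proof (induction j)
    case 0
    show ?case using H0(2) frame.cols_def[OF H0(1)] by (simp add: HY0)
  next
    case (Suc j)
    show ?case
      unfolding HYS refinement.span_cols[OF ref] refinement.span_Y[OF ref] Cstep cols
      unfolding UA_def UD_def
      using Suc by (intro conjI cspan_Un_cong cspan_mult_cong) auto
  qed
  have alg: "frame.alg (H j) (Y j) = G (\<tau> j)" for j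
  proof (rule antisym)
    show "frame.alg (H j) (Y j) \<subseteq> G (\<tau> j)"
      unfolding frame.alg_def[OF fr] G_def
    proof (intro complex_vector.span_minimal subsetI)
      fix y assume "y \<in> frame.gens (H j) (Y j)"
      then consider u v where "u \<in> frame.cols (H j)" "v \<in> frame.cols (H j)" "y = u * star v" | u v where "u \<in> Y j" "v \<in> Y j" "y = u * star v"
        unfolding frame.gens_def[OF fr] frame.cols_def[OF fr] by blast
      then have "\<exists>l u v. u \<in> cspan (C (\<tau> j) l) \<and> v \<in> cspan (C (\<tau> j) l) \<and> y = u * star v"
      proof cases
        case 1
        then have "u \<in> cspan (C (\<tau> j) False)" "v \<in> cspan (C (\<tau> j) False)"
          using span[of j] complex_vector.span_base[of _ "frame.cols (H j)"] by auto
        then show ?thesis using 1 by blast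
      next
        case 2
        then have "u \<in> cspan (C (\<tau> j) True)" "v \<in> cspan (C (\<tau> j) True)"
          using span[of j] complex_vector.span_base[of _ "Y j"] by auto
        then show ?thesis using 2 by blast
      qed
      then obtain l u v where uv: "u \<in> cspan (C (\<tau> j) l)" "v \<in> cspan (C (\<tau> j) l)" "y = u * star v" by blast
      have "{x * star z | x z. x \<in> C (\<tau> j) l \<and> z \<in> C (\<tau> j) l} \<subseteq> {u * star v | u v. \<exists>l. u \<in> C (\<tau> j) l \<and> v \<in> C (\<tau> j) l}" by blast
      from complex_vector.span_mono[OF this]
      show "y \<in> cspan {u * star v | u v. \<exists>l. u \<in> C (\<tau> j) l \<and> v \<in> C (\<tau> j) l}"
        using cspan_star_mult[OF uv(1,2)] uv(3) by blast
    qed simp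
    show "G (\<tau> j) \<subseteq> frame.alg (H j) (Y j)"
      unfolding G_def
    proof (intro complex_vector.span_minimal subsetI frame.csubspace_alg[OF fr])
      fix y assume "y \<in> {u * star v | u v. \<exists>l. u \<in> C (\<tau> j) l \<and> v \<in> C (\<tau> j) l}"
      then obtain u v l where uv: "y = u * star v" "u \<in> C (\<tau> j) l" "v \<in> C (\<tau> j) l" by blast
      show "y \<in> frame.alg (H j) (Y j)"
      proof (cases l)
        case True
        have "u \<in> cspan (Y j)" "v \<in> cspan (Y j)" using uv True span[of j] by (auto intro: complex_vector.span_base)
        then show ?thesis unfolding uv(1) by (rule frame.Y_Y_alg[OF fr])
      next
        case False
        have "u \<in> cspan (frame.cols (H j))" "v \<in> cspan (frame.cols (H j))"
          using uv False span[of j] by (auto intro: complex_vector.span_base)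
        then show ?thesis unfolding uv(1) by (rule frame.cols_cols_alg[OF fr])
      qed
    qed
  qed
  have tower: "tower one H Y q r UA UD UB UC"
  proof (rule tower.intro)
    show "refinement one (H j) (Y j) (q j) (r j) (UA j) (UB j) (UC j) (UD j) (q (Suc j)) (r (Suc j))" for j by (rule ref)
    show "UC j \<noteq> {}" for j
    proof
      assume "UC j = {}"
      then have "M (\<tau> j) (d j) False True = 0" using UC(2)[of j] by (simp add: M_def)
      then show False using M_pos(2)[OF d(1), of "\<tau> j" j] by simp
    qed
    show "UA j \<noteq> {}" for j
      using M_pos(1)[of "\<tau> j" "d j"] by (auto simp: M_def UA_def)
    show "H 0 \<noteq> {}"
      using H0(2) ncols_pos[of "\<tau> 0"] by (auto simp: ncols_def HY0)
  qed (rule HYS)+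
  have le: "j \<le> \<tau> j" for j
  proof (induction j)
    case (Suc j) then show ?case using \<tau>(2)[of j] by simp
  qed simp
  have "(\<Union>j. G (\<tau> j)) = (\<Union>t. G t)"
    using G_le[OF le] by blast
  then have "tower.A H Y = closure (\<Union>t. G t)"
    unfolding tower.A_def[OF tower] alg by simp
  then show ?thesis using tower by blast
qed

text \<open>The standard minimal projections of a level compress every element of that level to a
  scalar, since a column \<open>u\<close> meets a matrix unit \<open>a * star b\<close> only if
  \<open>a = u = b\<close>. This is the form in which unique extension of characters enters
  \<open>not_conjugate\<close>.\<close>

lemma level_projections:
  assumes S': "S' \<in> G t"
  shows "\<exists>R. finite R \<and> R \<subseteq> {u * star u | u l. u \<in> C t l} \<and> (\<Sum>p\<in>R. p) = one
      \<and> (\<forall>p\<in>R. star p = p \<and> p * p = p \<and> (\<exists>m. p * S' * p = m *\<^sub>C p))"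
proof -
  note D = decompD[OF decomp_C[of t]]
  define f where "f = (\<lambda>u::'a. u * star u)"
  define R where "R = f ` (C t False \<union> C t True)"
  have inj: "u = v \<and> l = l'" if "u \<in> C t l" "v \<in> C t l'" "f u = f v" for u v l l'
  proof -
    have "u = f u * u" using D(3)[OF that(1,1)] D(5)[OF that(1)] by (simp add: f_def mult.assoc)
    also have "\<dots> = v * (star v * u)" by (simp only: that(3)) (simp add: f_def mult.assoc)
    finally have "v * (star v * u) \<noteq> 0" using D(6)[OF that(1)] by auto
    then show ?thesis using D(3)[OF that(2,1)] by (auto split: if_splits)
  qed
  have "(\<Sum>p\<in>R. p) = (\<Sum>u\<in>C t False \<union> C t True. f u)"
    unfolding R_def by (rule sum.reindex_cong[of f]) (use inj in \<open>auto simp: inj_on_def\<close>)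
  also have "\<dots> = (\<Sum>u\<in>C t False. f u) + (\<Sum>u\<in>C t True. f u)"
  proof (rule sum.union_disjoint)
    show "C t False \<inter> C t True = {}" using inj[of _ False _ True] by blast
  qed (rule D(1))+
  also have "\<dots> = one" using D(4) by (simp add: UNIV_bool f_def add.commute)
  finally have sum: "(\<Sum>p\<in>R. p) = one" .
  have "\<exists>m. f u * S' * f u = m *\<^sub>C f u" if u: "u \<in> C t l" for u l
  proof -
    have "\<exists>m. star u * S' * u = m *\<^sub>C Q t l"
      using S' unfolding G_def
    proof (induction rule: complex_vector.span_induct_alt)
      case base show ?case by (auto intro!: exI[of _ 0])
    next
      case (step c y w)
      then obtain a b k where y: "y = a * star b" "a \<in> C t k" "b \<in> C t k" by blast
      obtain m where m: "star u * w * u = m *\<^sub>C Q t l" using step.IH by blast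
      have "star u * y * u = (star u * a) * (star b * u)" by (simp add: y mult.assoc)
      also have "\<dots> = (if l = k \<and> u = a \<and> b = u then 1 else 0) *\<^sub>C Q t l"
        using D(3)[OF u y(2)] D(3)[OF y(3) u] projectionD(2)[OF projection_Q[of t l]] by auto
      finally have "star u * (c *\<^sub>C y + w) * u = (c * (if l = k \<and> u = a \<and> b = u then 1 else 0) + m) *\<^sub>C Q t l"
        using m by (simp add: ring_distribs scaleC_mult scaleC_add_left scaleC_scaleC)
      then show ?case by blast
    qed
    then obtain m where m: "star u * S' * u = m *\<^sub>C Q t l" by blast
    have "f u * S' * f u = u * (star u * S' * u) * star u" by (simp add: f_def mult.assoc)
    also have "\<dots> = m *\<^sub>C f u" unfolding m by (simp add: scaleC_mult D(5)[OF u] f_def)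
    finally show ?thesis by blast
  qed
  moreover have "star (f u) = f u" "f u * f u = f u" if "u \<in> C t l" for u l
  proof -
    show "star (f u) = f u" by (simp add: f_def star_simps)
    have "f u * f u = u * (star u * u) * star u" by (simp add: f_def mult.assoc)
    then show "f u * f u = f u" using D(3)[OF that that] D(5)[OF that] by (simp add: f_def)
  qed
  ultimately have "\<forall>p\<in>R. star p = p \<and> p * p = p \<and> (\<exists>m. p * S' * p = m *\<^sub>C p)"
    unfolding R_def by blast
  moreover have "finite R" using D(1) by (simp add: R_def)
  moreover have "R \<subseteq> {u * star u | u l. u \<in> C t l}" unfolding R_def f_def by blast
  ultimately show ?thesis using sum by blast
qed

theorem exists_nonconjugate:
  assumes "\<And>t l u. u \<in> C (2 * t) l \<Longrightarrow> u * star u \<in> Diag"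
  shows "\<exists>B. cartan_subalgebra (closure (\<Union>t. G t)) B \<and> \<not> conjugate_in (closure (\<Union>t. G t)) B Diag"
proof -
  from exists_tower obtain H Y q r UA UD UB UC where tw: "tower one H Y q r UA UD UB UC"
    and A: "tower.A H Y = closure (\<Union>t. G t)" by (elim exE conjE)
  interpret tower one H Y q r UA UD UB UC by (rule tw)
  have "\<not> conjugate_in A B Diag"
  proof (rule not_conjugate)
    fix S and e :: real assume S: "S \<in> A" and e: "0 < e"
    obtain S' where S': "S' \<in> (\<Union>t. G t)" "dist S' S < e"
      using S e unfolding A closure_approachable by blast
    then obtain t where "S' \<in> G t" by blast
    \<comment> \<open>The projections are known to lie in \<open>Diag\<close> for even levels only,
      and levels increase.\<close>
    then have t: "S' \<in> G (2 * t)" using G_le[of t "2 * t"] by auto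
    obtain R where R: "finite R" "R \<subseteq> {u * star u | u l. u \<in> C (2 * t) l}" "(\<Sum>p\<in>R. p) = one"
      "\<forall>p\<in>R. star p = p \<and> p * p = p \<and> (\<exists>m. p * S' * p = m *\<^sub>C p)" using level_projections[OF t] by blast
    have "R \<subseteq> Diag" using R(2) assms by blast
    moreover have "norm (S - S') < e" using S'(2) by (simp add: dist_norm norm_minus_commute)
    ultimately show "\<exists>S' Q. norm (S - S') < e \<and> finite Q \<and> Q \<subseteq> Diag \<and> (\<Sum>q\<in>Q. q) = one
      \<and> (\<forall>q\<in>Q. star q = q \<and> q * q = q \<and> (\<exists>m. q * S' * q = m *\<^sub>C q))" using R by blast
  qed
  then show ?thesis using cartan unfolding A by blast
qed

end

section \<open>Effros--Shen algebras\<close>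

lemma cf_complete_quotient_irrational:
  assumes "\<theta> \<notin> \<rat>" shows "cf_complete_quotient \<theta> n \<notin> \<rat>"
proof (induction n)
  case (Suc n)
  have "frac (cf_complete_quotient \<theta> n) \<notin> \<rat>"
  proof
    assume "frac (cf_complete_quotient \<theta> n) \<in> \<rat>"
    then have "frac (cf_complete_quotient \<theta> n) + of_int \<lfloor>cf_complete_quotient \<theta> n\<rfloor> \<in> \<rat>" by (intro Rats_add) auto
    then show False using Suc by (simp add: frac_def)
  qed
  then have "inverse (inverse (frac (cf_complete_quotient \<theta> n))) \<notin> \<rat>" by simp
  then show ?case using Rats_inverse[of "inverse (frac (cf_complete_quotient \<theta> n))"] by (auto simp: inverse_eq_divide)
qed (use assms in simp)

text \<open>Irrationality keeps every fractional part strictly between 0 and 1, so its reciprocal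
  exceeds 1. Positivity is what allows a copy to be split off below.\<close>

lemma cf_coeff_pos: assumes "\<theta> \<notin> \<rat>" shows "cf_coeff \<theta> (Suc n) > 0"
proof -
  have "cf_complete_quotient \<theta> n \<notin> \<int>"
    using cf_complete_quotient_irrational[OF assms, of n] Ints_subset_Rats by blast
  then have "0 < frac (cf_complete_quotient \<theta> n)" "frac (cf_complete_quotient \<theta> n) < 1"
    using frac_gt_0_iff frac_lt_1 by auto
  then have "1 \<le> cf_complete_quotient \<theta> (Suc n)" by (simp add: divide_simps)
  then show ?thesis unfolding cf_coeff_def by (simp add: le_floor_iff)
qed

lemma cf_denom_pos: assumes "\<theta> \<notin> \<rat>" shows "cf_denom \<theta> n > 0"
  by (induction n rule: induct_nat_012) (use cf_coeff_pos[OF assms] in auto)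

text \<open>Splits off one copy \<open>u\<close>, which yields the intermediate algebra between \<open>A\<^sub>n\<close> and \<open>A\<^sub>n\<^sub>+\<^sub>1\<close>.\<close>

lemma decomp_split:
  fixes q w :: "'a::cstar_algebra"
  assumes D: "decomp q (\<lambda>l. if l then {w} else S) Q" and q: "projection q" and u: "u \<in> S"
  defines "rest \<equiv> q - u * star u"
  shows "decomp q (\<lambda>l. if l then {rest} else {u}) (\<lambda>l. if l then rest else Q False)"
    and "decomp rest (\<lambda>l. if l then {w} else S - {u}) Q"
    and "projection rest"
    and "rest * w = w"
proof -
  have uu: "star u * u = Q False" and uw: "star u * w = 0" and qu: "q * u = u" and qw: "q * w = w"
    and w0: "w \<noteq> 0" and uQ: "u * Q False = u"
    using decompD(3)[OF D, of u False u False] decompD(3)[OF D, of u False w True]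
      decompD(7)[OF D, of u False] decompD(7)[OF D, of w True] decompD(6)[OF D, of w True] decompD(5)[OF D, of u False] u by auto
  have uq: "star u * q = star u" using arg_cong[OF qu, of star] projectionD(1)[OF q] by (simp add: star_mult)
  have Qu: "Q False * star u = star u"
    using arg_cong[OF uQ, of star] projectionD(1)[OF decompD(2)[OF D, of False]] by (simp add: star_mult)
  have su: "star u * rest = 0" by (simp add: rest_def right_diff_distrib uq mult.assoc[symmetric] uu Qu)
  have rw: "rest * w = w" by (simp add: rest_def left_diff_distrib qw mult.assoc uw)
  have sr: "star rest = rest" by (simp add: rest_def star_simps projectionD(1)[OF q])
  have ru: "rest * u = 0" using arg_cong[OF su, of star] by (simp add: star_mult sr star_star)
  have qr: "q * rest = rest" by (simp add: rest_def right_diff_distrib projectionD[OF q] mult.assoc[symmetric] qu)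
  have rr: "rest * rest = rest"
  proof -
    have "rest * rest = q * rest - u * (star u * rest)" by (subst (1) rest_def) (simp add: left_diff_distrib mult.assoc)
    then show ?thesis by (simp add: su qr)
  qed
  show pr: "projection rest"
    unfolding projection_def using sr rr rw w0 by auto
  show "decomp q (\<lambda>l. if l then {rest} else {u}) (\<lambda>l. if l then rest else Q False)"
    unfolding decomp_def using decompD(2)[OF D] pr
    by (auto simp: UNIV_bool sr rr su ru uu) (simp_all add: rest_def)
  have "q = (\<Sum>s\<in>S. s * star s) + w * star w" using decompD(4)[OF D] by (simp add: UNIV_bool add.commute)
  moreover have "(\<Sum>s\<in>S. s * star s) = u * star u + (\<Sum>s\<in>S - {u}. s * star s)"
    using decompD(1)[OF D, of False] u by (simp add: sum.remove)
  ultimately have "rest = (\<Sum>s\<in>S - {u}. s * star s) + w * star w" by (simp add: rest_def)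
  then show "decomp rest (\<lambda>l. if l then {w} else S - {u}) Q"
    unfolding decomp_def using decompD(1)[OF D, of False] decompD(2)[OF D] decompD(3)[OF D, of _ False _ False]
      decompD(3)[OF D, of _ False _ True] decompD(3)[OF D, of _ True _ False] decompD(3)[OF D, of _ True _ True]
    by (auto simp: UNIV_bool add.commute)
  show "rest * w = w" by (rule rw)
qed

locale effros_shen =
  fixes \<theta> :: real and e :: "nat \<Rightarrow> nat \<Rightarrow> nat \<Rightarrow> nat \<Rightarrow> 'a::cstar_algebra"
  assumes irr: "\<theta> \<notin> \<rat>" and mu: "es_matrix_units \<theta> e"
begin

abbreviation "sz \<equiv> es_size \<theta>"

lemma sz_pos: "k < 2 \<Longrightarrow> 0 < sz (Suc n) k"
  using cf_denom_pos[OF irr] by (simp add: es_size_def)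

lemma e_mult: "k < 2 \<Longrightarrow> l < 2 \<Longrightarrow> a < sz n k \<Longrightarrow> b < sz n k \<Longrightarrow> c < sz n l \<Longrightarrow> d < sz n l \<Longrightarrow>
    e n k a b * e n l c d = (if k = l \<and> b = c then e n k a d else 0)"
  using mu unfolding es_matrix_units_def by blast

lemma e_star: "k < 2 \<Longrightarrow> a < sz n k \<Longrightarrow> b < sz n k \<Longrightarrow> star (e n k a b) = e n k b a"
  using mu unfolding es_matrix_units_def by blast

lemma e_nz: "k < 2 \<Longrightarrow> a < sz n k \<Longrightarrow> b < sz n k \<Longrightarrow> e n k a b \<noteq> 0"
  using mu unfolding es_matrix_units_def by blast

definition \<phi> where "\<phi> = (SOME \<phi>. \<forall>n. (\<forall>k<2. bij_betw (\<phi> n k) (es_blocks \<theta> n k) {..<sz (Suc n) k}) \<and>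
        (\<forall>l<2. \<forall>a<sz n l. \<forall>b<sz n l. e n l a b =
             (\<Sum>k<2. \<Sum>s<es_mult \<theta> (Suc n) k l. e (Suc n) k (\<phi> n k (l, s, a)) (\<phi> n k (l, s, b)))))"

lemma \<phi>: "\<forall>n. (\<forall>k<2. bij_betw (\<phi> n k) (es_blocks \<theta> n k) {..<sz (Suc n) k}) \<and>
        (\<forall>l<2. \<forall>a<sz n l. \<forall>b<sz n l. e n l a b =
             (\<Sum>k<2. \<Sum>s<es_mult \<theta> (Suc n) k l. e (Suc n) k (\<phi> n k (l, s, a)) (\<phi> n k (l, s, b))))"
proof -
  have "\<forall>n. \<exists>\<phi>. (\<forall>k<2. bij_betw (\<phi> k) (es_blocks \<theta> n k) {..<sz (Suc n) k}) \<and>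
        (\<forall>l<2. \<forall>a<sz n l. \<forall>b<sz n l. e n l a b =
             (\<Sum>k<2. \<Sum>s<es_mult \<theta> (Suc n) k l. e (Suc n) k (\<phi> k (l, s, a)) (\<phi> k (l, s, b))))"
    using mu unfolding es_matrix_units_def by (elim conjE)
  from someI_ex[OF choice[OF this]] show ?thesis unfolding \<phi>_def .
qed

lemma \<phi>_bij: "k < 2 \<Longrightarrow> bij_betw (\<phi> n k) (es_blocks \<theta> n k) {..<sz (Suc n) k}"
  using \<phi> by blast

lemma e_expand: "l < 2 \<Longrightarrow> a < sz n l \<Longrightarrow> b < sz n l \<Longrightarrow>
    e n l a b = (\<Sum>k<2. \<Sum>s<es_mult \<theta> (Suc n) k l. e (Suc n) k (\<phi> n k (l, s, a)) (\<phi> n k (l, s, b)))"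
  using \<phi> by blast

lemma \<phi>_less: "k < 2 \<Longrightarrow> l < 2 \<Longrightarrow> s < es_mult \<theta> (Suc n) k l \<Longrightarrow> a < sz n l \<Longrightarrow> \<phi> n k (l, s, a) < sz (Suc n) k"
  using bij_betwE[OF \<phi>_bij[of k n]] by (auto simp: es_blocks_def)

lemma \<phi>_inj: "k < 2 \<Longrightarrow> l < 2 \<Longrightarrow> s < es_mult \<theta> (Suc n) k l \<Longrightarrow> a < sz n l \<Longrightarrow>
   l' < 2 \<Longrightarrow> s' < es_mult \<theta> (Suc n) k l' \<Longrightarrow> a' < sz n l' \<Longrightarrow> \<phi> n k (l, s, a) = \<phi> n k (l', s', a') \<longleftrightarrow> l = l' \<and> s = s' \<and> a = a'"
  using inj_on_eq_iff[OF bij_betw_imp_inj_on[OF \<phi>_bij[of k n]], of "(l, s, a)" "(l', s', a')"] by (auto simp: es_blocks_def)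

lemma \<phi>_surj: assumes "k < 2" "b < sz (Suc n) k"
  obtains l s a where "l < 2" "s < es_mult \<theta> (Suc n) k l" "a < sz n l" "b = \<phi> n k (l, s, a)"
proof -
  have "b \<in> \<phi> n k ` es_blocks \<theta> n k" using bij_betw_imp_surj_on[OF \<phi>_bij[OF assms(1), of n]] assms(2) by auto
  then show ?thesis using that by (auto simp: es_blocks_def)
qed

text \<open>The column leading from the minimal projection of summand \<open>k\<close> at the next
  level onto the \<open>s\<close>-th copy of the minimal projection of summand
  \<open>l\<close>.\<close>

definition ent where "ent n k l s = e (Suc n) k (\<phi> n k (l, s, 0)) 0"

lemma e_ent:
  assumes "k < 2" "l < 2" "s < es_mult \<theta> (Suc (Suc n)) k l" "a < sz (Suc n) l"
  shows "e (Suc n) l a 0 * ent (Suc n) k l s = e (Suc (Suc n)) k (\<phi> (Suc n) k (l, s, a)) 0"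
proof -
  note z = sz_pos[OF assms(2), of n] and z' = sz_pos[OF assms(1), of "Suc n"]
  have "e (Suc n) l a 0 * ent (Suc n) k l s = (\<Sum>k'<2. \<Sum>s'<es_mult \<theta> (Suc (Suc n)) k' l.
      e (Suc (Suc n)) k' (\<phi> (Suc n) k' (l, s', a)) (\<phi> (Suc n) k' (l, s', 0)) * ent (Suc n) k l s)"
    by (simp add: e_expand[OF assms(2,4) z] sum_distrib_right)
  also have "\<dots> = (\<Sum>k'<2. \<Sum>s'<es_mult \<theta> (Suc (Suc n)) k' l. if s' = s then (if k' = k then e (Suc (Suc n)) k (\<phi> (Suc n) k (l, s, a)) 0 else 0) else 0)"
  proof (intro sum.cong refl)
    fix k' s' assume "k' \<in> {..<2::nat}" "s' \<in> {..<es_mult \<theta> (Suc (Suc n)) k' l}"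
    then have *: "k' < 2" "s' < es_mult \<theta> (Suc (Suc n)) k' l" by auto
    show "e (Suc (Suc n)) k' (\<phi> (Suc n) k' (l, s', a)) (\<phi> (Suc n) k' (l, s', 0)) * ent (Suc n) k l s
      = (if s' = s then (if k' = k then e (Suc (Suc n)) k (\<phi> (Suc n) k (l, s, a)) 0 else 0) else 0)"
      unfolding ent_def using assms * z z' by (subst e_mult) (auto simp: \<phi>_less \<phi>_inj)
  qed
  also have "\<dots> = (\<Sum>k'<2. if k' = k then e (Suc (Suc n)) k (\<phi> (Suc n) k (l, s, a)) 0 else 0)"
    using assms(3) by (intro sum.cong refl) auto
  also have "\<dots> = e (Suc (Suc n)) k (\<phi> (Suc n) k (l, s, a)) 0" using assms(1) by simp
  finally show ?thesis .
qed

lemma ent_ent: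
  assumes "k < 2" "k' < 2" "l < 2" "s < es_mult \<theta> (Suc (Suc n)) k l" "s' < es_mult \<theta> (Suc (Suc n)) k' l"
  shows "star (ent (Suc n) k l s) * ent (Suc n) k' l s' = (if k = k' \<and> s = s' then e (Suc (Suc n)) k 0 0 else 0)"
  unfolding ent_def using assms sz_pos[OF assms(3), of n] sz_pos[OF assms(1), of "Suc n"] sz_pos[OF assms(2), of "Suc n"]
  by (simp add: e_star \<phi>_less e_mult) (use \<phi>_inj[of k l s "Suc n" 0 l s' 0] in auto)

lemma ent_sum: assumes "l < 2"
  shows "e (Suc n) l 0 0 = (\<Sum>k<2. \<Sum>s<es_mult \<theta> (Suc (Suc n)) k l. ent (Suc n) k l s * star (ent (Suc n) k l s))"
  unfolding e_expand[OF assms sz_pos[OF assms] sz_pos[OF assms]] ent_def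
  using assms sz_pos[OF assms, of n] sz_pos[of _ "Suc n"]
  by (intro sum.cong refl) (simp add: e_star \<phi>_less e_mult)

section \<open>Multiplicities and interpolated levels\<close>

lemma projection_e: "k < 2 \<Longrightarrow> projection (e (Suc n) k 0 0)"
  unfolding projection_def using sz_pos[of k n] by (simp add: e_star e_mult e_nz)

abbreviation "g n \<equiv> cf_coeff \<theta> (Suc (Suc n))"
abbreviation "u n \<equiv> ent (Suc n) 0 0 0"
abbreviation "w n \<equiv> ent (Suc n) (Suc 0) 0 0"
abbreviation "v n \<equiv> ent (Suc n) 0 (Suc 0) 0"
definition "S n = ent (Suc n) 0 0 ` {..<g n}"
definition "rest n = e (Suc n) 0 0 0 - u n * star (u n)"
definition "QE n l = e (Suc n) (of_bool l) 0 0"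

lemma mult_simps: "es_mult \<theta> (Suc (Suc n)) 0 0 = g n" "es_mult \<theta> m (Suc 0) 0 = 1" "es_mult \<theta> m 0 (Suc 0) = 1" "es_mult \<theta> m (Suc 0) (Suc 0) = 0"
  by (simp_all add: es_mult_def)

lemma g_pos: "0 < g n" using cf_coeff_pos[OF irr] .

lemma less2: "(0::nat) < 2" "Suc 0 < 2" by auto

lemma inj_S: "inj_on (ent (Suc n) 0 0) {..<g n}"
proof (rule inj_onI)
  fix s s' assume *: "s \<in> {..<g n}" "s' \<in> {..<g n}" "ent (Suc n) 0 0 s = ent (Suc n) 0 0 s'"
  have "star (ent (Suc n) 0 0 s) * ent (Suc n) 0 0 s' = e (Suc (Suc n)) 0 0 0"
    using ent_ent[of 0 0 0 s n s] * by (simp add: mult_simps)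
  then show "s = s'" using ent_ent[of 0 0 0 s n s'] * e_nz[OF less2(1) sz_pos[OF less2(1)] sz_pos[OF less2(1)], of "Suc n"]
    by (auto simp: mult_simps split: if_splits)
qed

lemma decomp_QE_False: "decomp (QE n False) (\<lambda>l. if l then {w n} else S n) (QE (Suc n))"
proof -
  have "QE n False = (\<Sum>s<g n. ent (Suc n) 0 0 s * star (ent (Suc n) 0 0 s)) + w n * star (w n)"
    unfolding QE_def using ent_sum[OF less2(1), of n] by (simp add: mult_simps lessThan_nat_numeral numeral_2_eq_2 lessThan_Suc add.commute)
  also have "(\<Sum>s<g n. ent (Suc n) 0 0 s * star (ent (Suc n) 0 0 s)) = (\<Sum>x\<in>S n. x * star x)"
    unfolding S_def by (simp add: sum.reindex[OF inj_S])
  finally have sum: "QE n False = (\<Sum>x\<in>S n. x * star x) + w n * star (w n)" .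
  have ss: "star x * y = (if x = y then QE (Suc n) False else 0)" if xy: "x \<in> S n" "y \<in> S n" for x y
  proof -
    obtain s s' where s: "s < g n" "s' < g n" "x = ent (Suc n) 0 0 s" "y = ent (Suc n) 0 0 s'" using xy unfolding S_def by auto
    then show ?thesis using ent_ent[of 0 0 0 s n s'] inj_on_eq_iff[OF inj_S, of s n s'] by (simp add: mult_simps QE_def)
  qed
  have sw: "star x * w n = 0" "star (w n) * x = 0" if "x \<in> S n" for x
    using that ent_ent[of 0 "Suc 0" 0 _ n 0] ent_ent[of "Suc 0" 0 0 0 n] by (auto simp: S_def mult_simps)
  have ww: "star (w n) * w n = QE (Suc n) True"
    using ent_ent[of "Suc 0" "Suc 0" 0 0 n 0] by (simp add: mult_simps QE_def)
  show ?thesis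
    unfolding decomp_def
  proof (intro conjI allI ballI)
    show "projection (QE (Suc n) l)" for l by (simp add: QE_def projection_e)
    show "finite (if l then {w n} else S n)" for l by (simp add: S_def)
    fix l l' x y assume "x \<in> (if l then {w n} else S n)" "y \<in> (if l' then {w n} else S n)"
    then show "star x * y = (if l = l' \<and> x = y then QE (Suc n) l else 0)"
      by (cases l; cases l') (simp_all add: ss sw ww)
  qed (simp add: UNIV_bool sum)
qed

lemma u_S: "u n \<in> S n" unfolding S_def using g_pos by auto

lemma v_v: "v n * star (v n) = QE n True" "star (v n) * v n = QE (Suc n) False"
proof -
  show "v n * star (v n) = QE n True"
    using ent_sum[OF less2(2), of n] by (simp add: mult_simps numeral_2_eq_2 lessThan_Suc QE_def)
  show "star (v n) * v n = QE (Suc n) False"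
    using ent_ent[of 0 0 "Suc 0" 0 n 0] by (simp add: mult_simps QE_def)
qed

text \<open>Level \<open>2 * n\<close> is \<open>A\<^sub>n\<^sub>+\<^sub>1\<close>; the start at \<open>A\<^sub>1\<close> avoids the empty summand of \<open>A\<^sub>0\<close>.\<close>

definition Q where
  "Q t = (let n = t div 2 in if even t then QE n else (\<lambda>l. if l then rest n else QE (Suc n) False))"

text \<open>From an even level, the first minimal projection splits into one copy \<open>u n\<close>
  and \<open>rest n\<close>, and the second one becomes a copy \<open>v n\<close>. From an odd
  level, \<open>rest n\<close> resolves into the other \<open>g n - 1\<close> copies and
  \<open>w n\<close>. With rows for the old summands, the matrices (1 1; 1 0) and (1 0; g-1 1)
  multiply to (g 1; 1 0).\<close>

definition U where
  "U t k = (let n = t div 2 in if even t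
     then if k then (\<lambda>l. if l then {} else {v n}) else (\<lambda>l. if l then {rest n} else {u n})
     else if k then (\<lambda>l. if l then {w n} else S n - {u n}) else (\<lambda>l. if l then {} else {QE (Suc n) False}))"

definition CE where "CE n l = (\<lambda>a. e (Suc n) (of_bool l) a 0) ` {..<sz (Suc n) (of_bool l)}"

definition one where "one = (\<Sum>l\<in>UNIV. \<Sum>x\<in>CE 0 l. x * star x)"

lemma split: 
  "decomp (QE n False) (\<lambda>l. if l then {rest n} else {u n}) (\<lambda>l. if l then rest n else QE (Suc n) False)"
  "decomp (rest n) (\<lambda>l. if l then {w n} else S n - {u n}) (QE (Suc n))" "projection (rest n)" "rest n * w n = w n"
proof -
  have "projection (QE n False)" by (simp add: QE_def projection_e)
  moreover have "rest n = QE n False - u n * star (u n)" by (simp add: rest_def QE_def)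
  ultimately show "decomp (QE n False) (\<lambda>l. if l then {rest n} else {u n}) (\<lambda>l. if l then rest n else QE (Suc n) False)"
    "decomp (rest n) (\<lambda>l. if l then {w n} else S n - {u n}) (QE (Suc n))" "projection (rest n)" "rest n * w n = w n"
    using decomp_split[OF decomp_QE_False _ u_S, of n] by metis+
qed

lemma of_bool_less: "of_bool l < (2::nat)" by (cases l) auto

lemma CE_orth: assumes "x \<in> CE n l" "y \<in> CE n l'" shows "star x * y = (if l = l' \<and> x = y then QE n l else 0)"
proof -
  obtain a b where ab: "x = e (Suc n) (of_bool l) a 0" "a < sz (Suc n) (of_bool l)" "y = e (Suc n) (of_bool l') b 0" "b < sz (Suc n) (of_bool l')"
    using assms unfolding CE_def by auto
  note z = sz_pos[OF of_bool_less[of l], of n] sz_pos[OF of_bool_less[of l'], of n]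
  have "star x * y = e (Suc n) (of_bool l) 0 a * e (Suc n) (of_bool l') b 0"
    by (simp only: ab(1,3) e_star[OF of_bool_less ab(2) z(1)])
  also have "\<dots> = (if of_bool l = (of_bool l' :: nat) \<and> a = b then QE n l else 0)"
    unfolding QE_def by (rule e_mult[OF of_bool_less of_bool_less z(1) ab(2,4) z(2)])
  finally have xy: "star x * y = (if l = l' \<and> a = b then QE n l else 0)" by simp
  show ?thesis
  proof (cases "l = l' \<and> a = b")
    case True
    then show ?thesis using xy ab by simp
  next
    case False
    have "star x * x = e (Suc n) (of_bool l) 0 a * e (Suc n) (of_bool l) a 0"
      by (simp only: ab(1) e_star[OF of_bool_less ab(2) z(1)])
    also have "\<dots> = QE n l" unfolding QE_def by (simp add: e_mult[OF of_bool_less of_bool_less z(1) ab(2,2) z(1)])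
    finally have "star x * x = QE n l" .
    moreover have "QE n l \<noteq> 0" unfolding QE_def by (rule e_nz[OF of_bool_less z(1) z(1)])
    ultimately show ?thesis using xy False by auto
  qed
qed

lemma decomp_CE: "decomp one (CE 0) (QE 0)"
  unfolding decomp_def one_def
  by (intro conjI allI ballI refl CE_orth) (simp_all add: CE_def QE_def projection_e of_bool_less)

sublocale levels one "CE 0" Q U
proof
  show "decomp one (CE 0) (Q 0)" using decomp_CE by (simp add: Q_def)
  show "decomp (Q t k) (U t k) (Q (Suc t))" for t k
  proof (cases "even t"; cases k)
    assume *: "even t" k
    have "projection (QE (Suc (t div 2)) False)" by (simp add: QE_def projection_e)
    then show ?thesis using * v_v[of "t div 2"] split(3)[of "t div 2"]
      by (auto simp: Q_def U_def Let_def decomp_def UNIV_bool)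
  next
    assume *: "even t" "\<not> k"
    then show ?thesis using split(1) by (simp add: Q_def U_def Let_def)
  next
    assume *: "odd t" k
    then have "Suc t div 2 = Suc (t div 2)" by simp
    then show ?thesis using * split(2) by (simp add: Q_def U_def Let_def)
  next
    assume *: "odd t" "\<not> k"
    then have "Suc t div 2 = Suc (t div 2)" by simp
    moreover have "projection (QE (Suc (t div 2)) l)" for l by (simp add: QE_def projection_e of_bool_less)
    ultimately show ?thesis using * projectionD[of "QE (Suc (t div 2)) False"]
      by (auto simp: Q_def U_def Let_def decomp_def UNIV_bool)
  qed
  show "even t \<Longrightarrow> card (U t False False) = 1 \<and> card (U t False True) = 1 \<and> card (U t True False) = 1 \<and> card (U t True True) = 0" for t
    by (simp add: U_def Let_def)
  show "odd t \<Longrightarrow> card (U t False False) = 1 \<and> card (U t False True) = 0 \<and> card (U t True True) = 1" for t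
    by (simp add: U_def Let_def)
  show "card (CE 0 False) > 0" using sz_pos[OF less2(1), of 0] by (auto simp: CE_def card_gt_0_iff)
  show "card (CE 0 True) = 1" by (simp add: CE_def es_size_def lessThan_Suc)
qed

text \<open>The interpolation leaves no trace after two steps: \<open>rest n\<close> fixes
  \<open>w n\<close> and the copies other than \<open>u n\<close>, so the composed columns are
  exactly the first columns of the matrix units, enumerated through the bijections
  \<open>\<phi>\<close>.\<close>

lemma C_even: "C (2 * n) = CE n"
proof (induction n)
  case (Suc n)
  have C2: "C (2 * Suc n) = colprod (colprod (CE n) (U (2 * n))) (U (Suc (2 * n)))"
    using Suc by simp
  have rS: "rest n * x = x" if "x \<in> S n - {u n}" for x using decompD(7)[OF split(2), of x False] that by simp
  have uQ: "u n * QE (Suc n) False = u n" "v n * QE (Suc n) False = v n"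
    using decompD(5)[OF decomp_QE_False[of n], of "u n" False] u_S right_support[OF v_v(2)] projection_e[OF less2(1), of "Suc n"]
    by (auto simp: QE_def)
  have Ue: "U (2 * n) False True = {rest n}" "U (2 * n) False False = {u n}" "U (2 * n) True False = {v n}"
    "U (2 * n) True True = {}" "U (Suc (2 * n)) False False = {QE (Suc n) False}" "U (Suc (2 * n)) False True = {}"
    "U (Suc (2 * n)) True True = {w n}" "U (Suc (2 * n)) True False = S n - {u n}"
    by (simp_all add: U_def Let_def)
  have F: "C (2 * Suc n) False = {x * s | x s. x \<in> CE n False \<and> s \<in> S n} \<union> {y * v n | y. y \<in> CE n True}"
  proof (rule set_eqI)
    fix z
    have "z \<in> C (2 * Suc n) False \<longleftrightarrow> (\<exists>x\<in>CE n False. z = x * (u n * QE (Suc n) False)) \<or> (\<exists>y\<in>CE n True. z = y * (v n * QE (Suc n) False))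
        \<or> (\<exists>x\<in>CE n False. \<exists>s\<in>S n - {u n}. z = x * (rest n * s))"
      unfolding C2 colprod_iff colprod_ex Ue by (simp add: mult.assoc disj_assoc)
    also have "\<dots> \<longleftrightarrow> (\<exists>x\<in>CE n False. z = x * u n) \<or> (\<exists>y\<in>CE n True. z = y * v n) \<or> (\<exists>x\<in>CE n False. \<exists>s\<in>S n - {u n}. z = x * s)"
      unfolding uQ by (simp only: rS cong: bex_cong)
    also have "\<dots> \<longleftrightarrow> z \<in> {x * s | x s. x \<in> CE n False \<and> s \<in> S n} \<union> {y * v n | y. y \<in> CE n True}"
      using u_S[of n] by blast
    finally show "z \<in> C (2 * Suc n) False \<longleftrightarrow> z \<in> {x * s | x s. x \<in> CE n False \<and> s \<in> S n} \<union> {y * v n | y. y \<in> CE n True}" .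
  qed
  have T: "C (2 * Suc n) True = {x * w n | x. x \<in> CE n False}"
  proof (rule set_eqI)
    fix z
    have "z \<in> C (2 * Suc n) True \<longleftrightarrow> (\<exists>x\<in>CE n False. z = x * (rest n * w n))"
      unfolding C2 colprod_iff colprod_ex Ue by (simp add: mult.assoc disj_assoc)
    then show "z \<in> C (2 * Suc n) True \<longleftrightarrow> z \<in> {x * w n | x. x \<in> CE n False}"
      unfolding split(4) by blast
  qed
  have "{x * s | x s. x \<in> CE n False \<and> s \<in> S n} \<union> {y * v n | y. y \<in> CE n True} = CE (Suc n) False"
  proof (intro equalityI subsetI)
    fix z assume "z \<in> {x * s | x s. x \<in> CE n False \<and> s \<in> S n} \<union> {y * v n | y. y \<in> CE n True}"
    then consider a s where "a < sz (Suc n) 0" "s < g n" "z = e (Suc n) 0 a 0 * ent (Suc n) 0 0 s"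
      | a where "a < sz (Suc n) (Suc 0)" "z = e (Suc n) (Suc 0) a 0 * ent (Suc n) 0 (Suc 0) 0"
      by (auto simp: CE_def S_def)
    then show "z \<in> CE (Suc n) False"
    proof cases
      case 1
      then show ?thesis using e_ent[of 0 0 s n a] \<phi>_less[of 0 0 s "Suc n" a] by (simp add: mult_simps CE_def)
    next
      case 2
      then show ?thesis using e_ent[of 0 "Suc 0" 0 n a] \<phi>_less[of 0 "Suc 0" 0 "Suc n" a] by (simp add: mult_simps CE_def)
    qed
  next
    fix z assume "z \<in> CE (Suc n) False"
    then obtain b where b: "b < sz (Suc (Suc n)) 0" "z = e (Suc (Suc n)) 0 b 0" by (auto simp: CE_def)
    obtain l s a where lsa: "l < 2" "s < es_mult \<theta> (Suc (Suc n)) 0 l" "a < sz (Suc n) l" "b = \<phi> (Suc n) 0 (l, s, a)"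
      using \<phi>_surj[OF less2(1) b(1)] .
    have z: "z = e (Suc n) l a 0 * ent (Suc n) 0 l s" using e_ent[OF less2(1) lsa(1,2,3)] b lsa by simp
    have "l = 0 \<or> l = Suc 0" using lsa(1) by auto
    then show "z \<in> {x * s | x s. x \<in> CE n False \<and> s \<in> S n} \<union> {y * v n | y. y \<in> CE n True}"
    proof
      assume l: "l = 0"
      then have "e (Suc n) l a 0 \<in> CE n False" "ent (Suc n) 0 l s \<in> S n" using lsa by (auto simp: CE_def S_def mult_simps)
      then show ?thesis unfolding z by blast
    next
      assume l: "l = Suc 0"
      then have *: "e (Suc n) l a 0 \<in> CE n True" "ent (Suc n) 0 l s = v n" using lsa by (auto simp: CE_def mult_simps)
      show ?thesis unfolding z *(2) using *(1) by blast
    qed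
  qed
  moreover have "{x * w n | x. x \<in> CE n False} = CE (Suc n) True"
  proof (intro equalityI subsetI)
    fix z assume "z \<in> {x * w n | x. x \<in> CE n False}"
    then obtain a where "a < sz (Suc n) 0" "z = e (Suc n) 0 a 0 * w n" by (auto simp: CE_def)
    then show "z \<in> CE (Suc n) True"
      using e_ent[of "Suc 0" 0 0 n a] \<phi>_less[of "Suc 0" 0 0 "Suc n" a] by (simp add: mult_simps CE_def)
  next
    fix z assume "z \<in> CE (Suc n) True"
    then obtain b where b: "b < sz (Suc (Suc n)) (Suc 0)" "z = e (Suc (Suc n)) (Suc 0) b 0" by (auto simp: CE_def)
    obtain l s a where lsa: "l < 2" "s < es_mult \<theta> (Suc (Suc n)) (Suc 0) l" "a < sz (Suc n) l" "b = \<phi> (Suc n) (Suc 0) (l, s, a)"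
      using \<phi>_surj[OF less2(2) b(1)] .
    have z: "z = e (Suc n) l a 0 * ent (Suc n) (Suc 0) l s" using e_ent[OF less2(2) lsa(1,2,3)] b lsa by simp
    have l: "l = 0" using lsa(1,2) by (cases "l = 0") (auto simp: es_mult_def split: if_splits)
    then have *: "e (Suc n) l a 0 \<in> CE n False" "ent (Suc n) (Suc 0) l s = w n" using lsa by (auto simp: CE_def mult_simps)
    show "z \<in> {x * w n | x. x \<in> CE n False}" unfolding z *(2) using *(1) by blast
  qed
  ultimately have "C (2 * Suc n) l = CE (Suc n) l" for l using F T by (cases l) simp_all
  then show ?case by (rule ext)
qed simp

lemma G_even: "G (2 * n) = es_level \<theta> e (Suc n)"
proof -
  have "{u * star v | u v. \<exists>l. u \<in> CE n l \<and> v \<in> CE n l} = {e (Suc n) k a b | k a b. k < 2 \<and> a < sz (Suc n) k \<and> b < sz (Suc n) k}"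
  proof (intro equalityI subsetI)
    fix z assume "z \<in> {u * star v | u v. \<exists>l. u \<in> CE n l \<and> v \<in> CE n l}"
    then obtain l a b where ab: "a < sz (Suc n) (of_bool l)" "b < sz (Suc n) (of_bool l)"
      "z = e (Suc n) (of_bool l) a 0 * star (e (Suc n) (of_bool l) b 0)" unfolding CE_def by auto
    then have "z = e (Suc n) (of_bool l) a b" using sz_pos[OF of_bool_less[of l], of n] of_bool_less[of l] by (simp add: e_star e_mult)
    then show "z \<in> {e (Suc n) k a b | k a b. k < 2 \<and> a < sz (Suc n) k \<and> b < sz (Suc n) k}"
      using ab of_bool_less by blast
  next
    fix z assume "z \<in> {e (Suc n) k a b | k a b. k < 2 \<and> a < sz (Suc n) k \<and> b < sz (Suc n) k}"
    then obtain k a b where k: "k < 2" "a < sz (Suc n) k" "b < sz (Suc n) k" "z = e (Suc n) k a b" by blast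
    have kb: "of_bool (k = Suc 0) = k" using k(1) by auto
    have "z = e (Suc n) k a 0 * star (e (Suc n) k b 0)" using k sz_pos[OF k(1), of n] by (simp add: e_star e_mult)
    moreover have "e (Suc n) k a 0 \<in> CE n (k = Suc 0)" "e (Suc n) k b 0 \<in> CE n (k = Suc 0)"
      unfolding CE_def kb using k by auto
    ultimately show "z \<in> {u * star v | u v. \<exists>l. u \<in> CE n l \<and> v \<in> CE n l}" by blast
  qed
  then show ?thesis by (simp add: G_def C_even es_level_def)
qed

text \<open>Since the levels start at \<open>A\<^sub>1\<close>, the inclusion of
  \<open>A\<^sub>0\<close> is needed separately to identify the unions.\<close>

lemma level_0: "es_level \<theta> e 0 \<subseteq> es_level \<theta> e 1"
  unfolding es_level_def
proof (intro complex_vector.span_minimal subsetI)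
  fix z assume "z \<in> {e 0 k a b | k a b. k < 2 \<and> a < sz 0 k \<and> b < sz 0 k}"
  then obtain k a b where k: "k < 2" "a < sz 0 k" "b < sz 0 k" "z = e 0 k a b" by blast
  show "z \<in> cspan {e 1 k a b | k a b. k < 2 \<and> a < sz 1 k \<and> b < sz 1 k}"
    unfolding k(4) e_expand[OF k(1,2,3)]
  proof (intro complex_vector.span_sum complex_vector.span_base)
    fix k' s assume "k' \<in> {..<2::nat}" "s \<in> {..<es_mult \<theta> (Suc 0) k' k}"
    then have "\<phi> 0 k' (k, s, a) < sz 1 k'" "\<phi> 0 k' (k, s, b) < sz 1 k'" "k' < 2" using \<phi>_less[of k' k s 0] k by auto
    then show "e (Suc 0) k' (\<phi> 0 k' (k, s, a)) (\<phi> 0 k' (k, s, b)) \<in> {e 1 k a b | k a b. k < 2 \<and> a < sz 1 k \<and> b < sz 1 k}"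
      by auto
  qed
qed simp

lemma algebra_eq: "effros_shen_algebra \<theta> e = closure (\<Union>t. G t)"
proof -
  have "(\<Union>n. es_level \<theta> e n) = (\<Union>t. G t)"
  proof (intro equalityI subsetI)
    fix x assume "x \<in> (\<Union>n. es_level \<theta> e n)"
    then obtain n where n: "x \<in> es_level \<theta> e n" by blast
    then have "x \<in> G (2 * (n - 1))"
      using level_0 G_even[of 0] G_even[of "n - 1"] by (cases n) auto
    then show "x \<in> (\<Union>t. G t)" by blast
  next
    fix x assume "x \<in> (\<Union>t. G t)"
    then obtain t where "x \<in> G t" by blast
    then have "x \<in> G (2 * t)" using G_le[of t "2 * t"] by auto
    then show "x \<in> (\<Union>n. es_level \<theta> e n)" unfolding G_even by blast
  qed
  then show ?thesis unfolding effros_shen_algebra_def by simp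
qed

lemma diagonal: assumes "y \<in> C (2 * n) l" shows "y * star y \<in> standard_diagonal \<theta> e"
proof -
  obtain a where a: "a < sz (Suc n) (of_bool l)" "y = e (Suc n) (of_bool l) a 0" using assms unfolding C_even CE_def by auto
  then have "y * star y = e (Suc n) (of_bool l) a a"
    using sz_pos[OF of_bool_less[of l], of n] of_bool_less[of l] by (simp add: e_star e_mult)
  moreover have "e (Suc n) (of_bool l) a a \<in> es_diag_level \<theta> e (Suc n)"
    unfolding es_diag_level_def using a of_bool_less[of l] by (intro complex_vector.span_base) blast
  ultimately have "y * star y \<in> (\<Union>n. es_diag_level \<theta> e n)" by (intro UN_I[of "Suc n"]) simp_all
  then show ?thesis unfolding standard_diagonal_def by (rule subsetD[OF closure_subset])
qed

end

theorem corollary7p12: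
  fixes \<theta> :: real
    and e :: "nat \<Rightarrow> nat \<Rightarrow> nat \<Rightarrow> nat \<Rightarrow> 'a::cstar_algebra"
  assumes "\<theta> \<notin> \<rat>" and "0 < \<theta>" and "\<theta> < 1"
    and "es_matrix_units \<theta> e"
  shows "\<exists>B. cartan_subalgebra (effros_shen_algebra \<theta> e) B \<and>
    \<not> conjugate_in (effros_shen_algebra \<theta> e) B (standard_diagonal \<theta> e)"
proof -
  interpret effros_shen \<theta> e using assms by unfold_locales
  show ?thesis
    unfolding algebra_eq by (rule exists_nonconjugate) (rule diagonal)
qed

end
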